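(* Let $A\in\mathbb Z^{d\times n}$ be a normal matrix of rank $d$ as in the context. (i) If $d=1$ or $d=2$, or if $A$ is graded and $d=3$, then every regular triangulation of $cone(A)$ supports at least one Gomory family. (ii) If $d=2$ and $A$ is graded, then every regular triangulation of $cone(A)$ supports exactly one Gomory family. (iii) There exist such matrices $A$ with $d=3$ and $A$ not graded, and also with $d=4$ and $A$ graded, for which some regular triangulation of $cone(A)$ supports no Gomory family; in particular such an $A$ need not be $\Delta$-normal with respect to every regular triangulation $\Delta$.
   Context: $A\in\mathbb Z^{d\times n}$ has rank $d$, columns $a_1,\dots,a_n$, $cone(A)$ pointed, $\{x\in\mathbb R^n_{\ge0}:Ax=0\}=\{0\}$, $\mathbb ZA=\mathbb Z^d$, $\mathbb NA=\{Au:u\in\mathbb N^n\}$. Standing assumption: $A$ is normal ($\mathbb NA=cone(A)\cap\mathbb Z^d$) and its columns form the unique minimal Hilbert basis of $cone(A)$. $A$ is graded if its columns lie on an affine hyperplane of $\mathbb R^d$ not through the origin. For $c\in\mathbb R^n$, $\Delta_c$ is the collection of $\sigma\subseteq\{1,\dots,n\}$ (cones $cone(A_\sigma)$) for which some $y\in\mathbb R^d$ has $y\cdot a_j=c_j$ ($j\in\sigma$), $y\cdot a_j<c_j$ ($j\notin\sigma$); a triangulation is regular if it equals some $\Delta_c$. A cost vector $c$ is generic if $\Delta_c$ is a triangulation and every program $IP_{A,c}(b)=\min\{c\cdot x: Ax=b,\ x\in\mathbb N^n\}$, $b\in\mathbb NA$, has a unique optimal solution; $IP_{A,c}$ is the family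 of these programs and $\mathcal O_c$ the set of their optimal solutions. Two generic $c,c'$ give the same family if $\mathcal O_c=\mathcal O_{c'}$. For a maximal face $\sigma$ of $\Delta_c$ let $\tilde c_{\bar\sigma}=c_{\bar\sigma}-c_\sigma A_\sigma^{-1}A_{\bar\sigma}$; the group relaxation $G^\sigma(b)$ is $\min\{\tilde c_{\bar\sigma}\cdot x_{\bar\sigma}: A_\sigma x_\sigma+A_{\bar\sigma}x_{\bar\sigma}=b,\ x_{\bar\sigma}\ge0,\ x\in\mathbb Z^n\}$, which solves $IP_{A,c}(b)$ if its optimal solution is non-negative. $IP_{A,c}$ is a Gomory family if for every $b\in\mathbb NA$ some maximal face $\sigma$ of $\Delta_c$ has $G^\sigma(b)$ solving $IP_{A,c}(b)$. A triangulation $\Delta$ supports the Gomory family $IP_{A,c}$ (equivalently the set $\mathcal O_c$) if $c$ is generic, $\Delta=\Delta_c$ and $IP_{A,c}$ is a Gomory family; "exactly one" counts distinct sets $\mathcal O_c$. $A$ is $\Delta$-normal if for each maximal face $\sigma$ of $\Delta$ the columns of $A$ lying in $cone(A_\sigma)$ form a Hilbert basis of $cone(A_\sigma)$. *)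

theory Defs
  imports Complex_Main
begin

text \<open>Conventions. The matrix A in Z^(d x n) is a function A :: nat => nat => int, the entry
in row i < d and column j < n being A i j; entries outside this range are ignored.
Vectors in Z^d / R^d are functions nat => int / nat => real that vanish at indices >= d;
vectors in N^n / Z^n are functions on nat that vanish at indices >= n.
Column indices are 0,...,n-1 (instead of 1,...,n).\<close>

definition ivecs :: "nat \<Rightarrow> (nat \<Rightarrow> int) set" where
  "ivecs d = {b. \<forall>i\<ge>d. b i = 0}"

definition mv :: "nat \<Rightarrow> nat \<Rightarrow> (nat \<Rightarrow> nat \<Rightarrow> int) \<Rightarrow> (nat \<Rightarrow> int) \<Rightarrow> (nat \<Rightarrow> int)" where
  "mv d n A x = (\<lambda>i. if i < d then (\<Sum>j<n. A i j * x j) else 0)"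

definition mvr :: "nat \<Rightarrow> nat \<Rightarrow> (nat \<Rightarrow> nat \<Rightarrow> int) \<Rightarrow> (nat \<Rightarrow> real) \<Rightarrow> (nat \<Rightarrow> real)" where
  "mvr d n A x = (\<lambda>i. if i < d then (\<Sum>j<n. of_int (A i j) * x j) else 0)"

definition col :: "nat \<Rightarrow> (nat \<Rightarrow> nat \<Rightarrow> int) \<Rightarrow> nat \<Rightarrow> (nat \<Rightarrow> int)" where
  "col d A j = (\<lambda>i. if i < d then A i j else 0)"

definition rvec :: "(nat \<Rightarrow> int) \<Rightarrow> (nat \<Rightarrow> real)" where
  "rvec b = (\<lambda>i. of_int (b i))"

definition dotcol :: "nat \<Rightarrow> (nat \<Rightarrow> nat \<Rightarrow> int) \<Rightarrow> (nat \<Rightarrow> real) \<Rightarrow> nat \<Rightarrow> real" where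
  "dotcol d A y j = (\<Sum>i<d. y i * of_int (A i j))"

definition full_row_rank :: "nat \<Rightarrow> nat \<Rightarrow> (nat \<Rightarrow> nat \<Rightarrow> int) \<Rightarrow> bool" where
  "full_row_rank d n A \<longleftrightarrow> (\<forall>y. (\<forall>j<n. dotcol d A y j = 0) \<longrightarrow> (\<forall>i<d. y i = 0))"

definition cone_of :: "nat \<Rightarrow> nat \<Rightarrow> (nat \<Rightarrow> nat \<Rightarrow> int) \<Rightarrow> nat set \<Rightarrow> (nat \<Rightarrow> real) set" where
  "cone_of d n A \<sigma> = {mvr d n A x | x. (\<forall>j. 0 \<le> x j) \<and> (\<forall>j. j \<notin> \<sigma> \<longrightarrow> x j = 0)}"

definition coneA :: "nat \<Rightarrow> nat \<Rightarrow> (nat \<Rightarrow> nat \<Rightarrow> int) \<Rightarrow> (nat \<Rightarrow> real) set" where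
  "coneA d n A = cone_of d n A {..<n}"

definition pointed_cone :: "(nat \<Rightarrow> real) set \<Rightarrow> bool" where
  "pointed_cone K \<longleftrightarrow> (\<forall>v. v \<in> K \<and> (\<lambda>i. - v i) \<in> K \<longrightarrow> v = (\<lambda>i. 0))"

definition lattice_pts :: "nat \<Rightarrow> (nat \<Rightarrow> real) set \<Rightarrow> (nat \<Rightarrow> int) set" where
  "lattice_pts d K = {b \<in> ivecs d. rvec b \<in> K}"

definition semigroup :: "nat \<Rightarrow> nat \<Rightarrow> (nat \<Rightarrow> nat \<Rightarrow> int) \<Rightarrow> (nat \<Rightarrow> int) set" where
  "semigroup d n A = {mv d n A (\<lambda>j. int (u j)) | u. True}"

definition hilbert_basis :: "nat \<Rightarrow> (nat \<Rightarrow> real) set \<Rightarrow> (nat \<Rightarrow> int) set \<Rightarrow> bool" where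
  "hilbert_basis d K H \<longleftrightarrow> finite H \<and> H \<subseteq> lattice_pts d K \<and>
     (\<forall>b \<in> lattice_pts d K. \<exists>m :: (nat \<Rightarrow> int) \<Rightarrow> nat. b = (\<lambda>i. \<Sum>h\<in>H. int (m h) * h i))"

definition minimal_hilbert_basis :: "nat \<Rightarrow> (nat \<Rightarrow> real) set \<Rightarrow> (nat \<Rightarrow> int) set \<Rightarrow> bool" where
  "minimal_hilbert_basis d K H \<longleftrightarrow> hilbert_basis d K H \<and> (\<forall>H'. H' \<subset> H \<longrightarrow> \<not> hilbert_basis d K H')"

definition standing :: "nat \<Rightarrow> nat \<Rightarrow> (nat \<Rightarrow> nat \<Rightarrow> int) \<Rightarrow> bool" where
  "standing d n A \<longleftrightarrow>
     full_row_rank d n A \<and>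
     pointed_cone (coneA d n A) \<and>
     (\<forall>x. (\<forall>j<n. 0 \<le> x j) \<and> mvr d n A x = (\<lambda>i. 0) \<longrightarrow> (\<forall>j<n. x j = 0)) \<and>
     (\<forall>b \<in> ivecs d. \<exists>u. b = mv d n A u) \<and>
     semigroup d n A = lattice_pts d (coneA d n A) \<and>
     inj_on (col d A) {..<n} \<and>
     (\<forall>H. minimal_hilbert_basis d (coneA d n A) H \<longleftrightarrow> H = col d A ` {..<n})"

definition graded :: "nat \<Rightarrow> nat \<Rightarrow> (nat \<Rightarrow> nat \<Rightarrow> int) \<Rightarrow> bool" where
  "graded d n A \<longleftrightarrow> (\<exists>w \<gamma>. (\<exists>i<d. w i \<noteq> 0) \<and> \<gamma> \<noteq> (0::real) \<and> (\<forall>j<n. dotcol d A w j = \<gamma>))"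

definition delta :: "nat \<Rightarrow> nat \<Rightarrow> (nat \<Rightarrow> nat \<Rightarrow> int) \<Rightarrow> (nat \<Rightarrow> real) \<Rightarrow> nat set set" where
  "delta d n A c = {\<sigma>. \<sigma> \<subseteq> {..<n} \<and> (\<exists>y. (\<forall>j\<in>\<sigma>. dotcol d A y j = c j) \<and>
                                         (\<forall>j\<in>{..<n} - \<sigma>. dotcol d A y j < c j))}"

definition lin_indep_cols :: "nat \<Rightarrow> nat \<Rightarrow> (nat \<Rightarrow> nat \<Rightarrow> int) \<Rightarrow> nat set \<Rightarrow> bool" where
  "lin_indep_cols d n A \<sigma> \<longleftrightarrow>
     (\<forall>x. (\<forall>j. j \<notin> \<sigma> \<longrightarrow> x j = 0) \<and> mvr d n A x = (\<lambda>i. 0) \<longrightarrow> (\<forall>j\<in>\<sigma>. x j = 0))"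

definition triangulation :: "nat \<Rightarrow> nat \<Rightarrow> (nat \<Rightarrow> nat \<Rightarrow> int) \<Rightarrow> nat set set \<Rightarrow> bool" where
  "triangulation d n A \<Delta> \<longleftrightarrow>
     \<Delta> \<noteq> {} \<and>
     (\<forall>\<sigma>\<in>\<Delta>. \<sigma> \<subseteq> {..<n}) \<and>
     (\<forall>\<sigma>\<in>\<Delta>. \<forall>\<tau>. \<tau> \<subseteq> \<sigma> \<longrightarrow> \<tau> \<in> \<Delta>) \<and>
     (\<forall>\<sigma>\<in>\<Delta>. lin_indep_cols d n A \<sigma>) \<and>
     (\<forall>\<sigma>\<in>\<Delta>. \<forall>\<tau>\<in>\<Delta>. cone_of d n A \<sigma> \<inter> cone_of d n A \<tau> = cone_of d n A (\<sigma> \<inter> \<tau>)) \<and>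
     (\<Union>\<sigma>\<in>\<Delta>. cone_of d n A \<sigma>) = coneA d n A"

definition regular_triangulation :: "nat \<Rightarrow> nat \<Rightarrow> (nat \<Rightarrow> nat \<Rightarrow> int) \<Rightarrow> nat set set \<Rightarrow> bool" where
  "regular_triangulation d n A \<Delta> \<longleftrightarrow> triangulation d n A \<Delta> \<and> (\<exists>c. \<Delta> = delta d n A c)"

definition max_face :: "nat set set \<Rightarrow> nat set \<Rightarrow> bool" where
  "max_face \<Delta> \<sigma> \<longleftrightarrow> \<sigma> \<in> \<Delta> \<and> (\<forall>\<tau>\<in>\<Delta>. \<sigma> \<subseteq> \<tau> \<longrightarrow> \<tau> = \<sigma>)"

definition natvecs :: "nat \<Rightarrow> (nat \<Rightarrow> nat) set" where
  "natvecs n = {x. \<forall>j\<ge>n. x j = 0}"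

definition cost :: "nat \<Rightarrow> (nat \<Rightarrow> real) \<Rightarrow> (nat \<Rightarrow> nat) \<Rightarrow> real" where
  "cost n c x = (\<Sum>j<n. c j * real (x j))"

definition ip_feasible :: "nat \<Rightarrow> nat \<Rightarrow> (nat \<Rightarrow> nat \<Rightarrow> int) \<Rightarrow> (nat \<Rightarrow> int) \<Rightarrow> (nat \<Rightarrow> nat) \<Rightarrow> bool" where
  "ip_feasible d n A b x \<longleftrightarrow> x \<in> natvecs n \<and> mv d n A (\<lambda>j. int (x j)) = b"

definition ip_optimal :: "nat \<Rightarrow> nat \<Rightarrow> (nat \<Rightarrow> nat \<Rightarrow> int) \<Rightarrow> (nat \<Rightarrow> real) \<Rightarrow> (nat \<Rightarrow> int) \<Rightarrow> (nat \<Rightarrow> nat) \<Rightarrow> bool" where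
  "ip_optimal d n A c b x \<longleftrightarrow> ip_feasible d n A b x \<and>
     (\<forall>x'. ip_feasible d n A b x' \<longrightarrow> cost n c x \<le> cost n c x')"

definition generic :: "nat \<Rightarrow> nat \<Rightarrow> (nat \<Rightarrow> nat \<Rightarrow> int) \<Rightarrow> (nat \<Rightarrow> real) \<Rightarrow> bool" where
  "generic d n A c \<longleftrightarrow> triangulation d n A (delta d n A c) \<and>
     (\<forall>b \<in> semigroup d n A. \<exists>!x. ip_optimal d n A c b x)"

definition optimal_set :: "nat \<Rightarrow> nat \<Rightarrow> (nat \<Rightarrow> nat \<Rightarrow> int) \<Rightarrow> (nat \<Rightarrow> real) \<Rightarrow> (nat \<Rightarrow> nat) set" where
  "optimal_set d n A c = {x. \<exists>b \<in> semigroup d n A. ip_optimal d n A c b x}"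

text \<open>The row vector c_sigma A_sigma^{-1}: the unique y in R^d with y . a_j = c_j for j in sigma.\<close>
definition dual_vec :: "nat \<Rightarrow> (nat \<Rightarrow> nat \<Rightarrow> int) \<Rightarrow> (nat \<Rightarrow> real) \<Rightarrow> nat set \<Rightarrow> (nat \<Rightarrow> real)" where
  "dual_vec d A c \<sigma> = (THE y. (\<forall>i\<ge>d. y i = 0) \<and> (\<forall>j\<in>\<sigma>. dotcol d A y j = c j))"

definition reduced_cost :: "nat \<Rightarrow> (nat \<Rightarrow> nat \<Rightarrow> int) \<Rightarrow> (nat \<Rightarrow> real) \<Rightarrow> nat set \<Rightarrow> nat \<Rightarrow> real" where
  "reduced_cost d A c \<sigma> j = c j - dotcol d A (dual_vec d A c \<sigma>) j"

definition gr_feasible :: "nat \<Rightarrow> nat \<Rightarrow> (nat \<Rightarrow> nat \<Rightarrow> int) \<Rightarrow> nat set \<Rightarrow> (nat \<Rightarrow> int) \<Rightarrow> (nat \<Rightarrow> int) \<Rightarrow> bool" where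
  "gr_feasible d n A \<sigma> b x \<longleftrightarrow> (\<forall>j\<ge>n. x j = 0) \<and> (\<forall>j\<in>{..<n} - \<sigma>. 0 \<le> x j) \<and> mv d n A x = b"

definition gr_objective :: "nat \<Rightarrow> nat \<Rightarrow> (nat \<Rightarrow> nat \<Rightarrow> int) \<Rightarrow> (nat \<Rightarrow> real) \<Rightarrow> nat set \<Rightarrow> (nat \<Rightarrow> int) \<Rightarrow> real" where
  "gr_objective d n A c \<sigma> x = (\<Sum>j\<in>{..<n} - \<sigma>. reduced_cost d A c \<sigma> j * of_int (x j))"

definition gr_optimal :: "nat \<Rightarrow> nat \<Rightarrow> (nat \<Rightarrow> nat \<Rightarrow> int) \<Rightarrow> (nat \<Rightarrow> real) \<Rightarrow> nat set \<Rightarrow> (nat \<Rightarrow> int) \<Rightarrow> (nat \<Rightarrow> int) \<Rightarrow> bool" where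
  "gr_optimal d n A c \<sigma> b x \<longleftrightarrow> gr_feasible d n A \<sigma> b x \<and>
     (\<forall>x'. gr_feasible d n A \<sigma> b x' \<longrightarrow> gr_objective d n A c \<sigma> x \<le> gr_objective d n A c \<sigma> x')"

definition gr_solves :: "nat \<Rightarrow> nat \<Rightarrow> (nat \<Rightarrow> nat \<Rightarrow> int) \<Rightarrow> (nat \<Rightarrow> real) \<Rightarrow> nat set \<Rightarrow> (nat \<Rightarrow> int) \<Rightarrow> bool" where
  "gr_solves d n A c \<sigma> b \<longleftrightarrow> (\<exists>x. gr_optimal d n A c \<sigma> b x \<and> (\<forall>j<n. 0 \<le> x j))"

definition gomory_family :: "nat \<Rightarrow> nat \<Rightarrow> (nat \<Rightarrow> nat \<Rightarrow> int) \<Rightarrow> (nat \<Rightarrow> real) \<Rightarrow> bool" where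
  "gomory_family d n A c \<longleftrightarrow>
     (\<forall>b \<in> semigroup d n A. \<exists>\<sigma>. max_face (delta d n A c) \<sigma> \<and> gr_solves d n A c \<sigma> b)"

definition supports :: "nat \<Rightarrow> nat \<Rightarrow> (nat \<Rightarrow> nat \<Rightarrow> int) \<Rightarrow> nat set set \<Rightarrow> (nat \<Rightarrow> real) \<Rightarrow> bool" where
  "supports d n A \<Delta> c \<longleftrightarrow> generic d n A c \<and> \<Delta> = delta d n A c \<and> gomory_family d n A c"

definition delta_normal :: "nat \<Rightarrow> nat \<Rightarrow> (nat \<Rightarrow> nat \<Rightarrow> int) \<Rightarrow> nat set set \<Rightarrow> bool" where
  "delta_normal d n A \<Delta> \<longleftrightarrow>
     (\<forall>\<sigma>. max_face \<Delta> \<sigma> \<longrightarrow>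
        hilbert_basis d (cone_of d n A \<sigma>)
          {col d A j | j. j < n \<and> rvec (col d A j) \<in> cone_of d n A \<sigma>})"

end

theory Submission
  imports Defs "HOL-Analysis.Continuum_Not_Denumerable"
begin

text \<open>A group relaxation drops nonnegativity on a maximal face. Suppose that the columns in every maximal cone of a
  regular triangulation generate the lattice points of that cone. Raise the unused columns slightly above the
  piecewise linear cost, by nearly the sum of their coordinates in the cone and rationally independently. Then the
  optima of the relaxations are nonnegative and unique, so the triangulation supports a Gomory family. In dimension
  at most 2, and in graded dimension 3, the generation hypothesis is automatic: a cone can be subdivided by the
  columns inside it, and a simplicial cone that contains no further column is unimodular.

  In the graded plane, each unused column is the optimum of its own fiber. A double count of reduced costs forces it to be
  solved by the face whose cone contains it, and this determines all optima.

  The two counterexamples contain a simplicial cone of index 3 without further columns and a lattice point of it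
  whose single representation uses a column outside the cone. Relations forced by the triangulation or by
  genericity make this representation non-optimal in every group relaxation.\<close>

text \<open>Why the coordinate sum decides: as long as only columns of the cone occur, the
  coordinates contributed by columns outside \<open>\<sigma>\<close> are determined modulo 1 by
  \<open>b\<close>. A negative entry on \<open>\<sigma>\<close> therefore costs a full extra unit of
  coordinate sum, while the perturbation distorts the comparison by less than one unit. Columns
  outside the cone must stay more expensive than that, which ties the size of the perturbation to
  the smallest gap over all faces. The dimension bounds come from heights. Under a grading the
  lattice points of height 1 are exactly the columns, and points of a half open parallelepiped have
  height below \<open>d\<close>. For \<open>d = 3\<close> reflection in the centre exchanges heights
  1 and 2, so an empty cone has neither. For \<open>d = 4\<close> height 2 reflects to itself, and
  the lattice point of the second counterexample indeed has height 2. In the ungraded plane, the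
  position of the columns on the two sides of an empty cone replaces the height.\<close>

section \<open>Homogeneous linear systems and rationally independent reals\<close>

lemma homogeneous_system:
  fixes M :: "'e \<Rightarrow> 'i \<Rightarrow> real"
  assumes "finite E" "finite I" "card E < card I"
  shows "\<exists>x. (\<exists>i\<in>I. x i \<noteq> 0) \<and> (\<forall>e\<in>E. (\<Sum>i\<in>I. M e i * x i) = 0)"
  using assms
proof (induction E arbitrary: M I rule: finite_induct)
  case empty
  then have "I \<noteq> {}" by auto
  then show ?case by (intro exI[of _ "\<lambda>_. 1"]) auto
next
  case (insert e E)
  show ?case
  proof (cases "\<forall>i\<in>I. M e i = 0")
    case True
    obtain x where "\<exists>i\<in>I. x i \<noteq> 0" "\<forall>e\<in>E. (\<Sum>i\<in>I. M e i * x i) = 0"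
      using insert.IH[OF insert.prems(1), of M] insert.prems insert.hyps by auto
    with True show ?thesis by (intro exI[of _ x]) auto
  next
    case False
    then obtain k where k: "k \<in> I" "M e k \<noteq> 0" by auto
    define J where "J = I - {k}"
    have fJ: "finite J" using insert.prems J_def by auto
    have IJ: "I = insert k J" "k \<notin> J" using k J_def by auto
    have cJ: "card E < card J" using insert.prems insert.hyps IJ fJ by auto
    \<comment> \<open>One step of Gaussian elimination: equation \<open>e\<close> is solved for the
      pivot variable \<open>k\<close> and substituted into the other equations. The value at
      \<open>k\<close> is recovered afterwards in \<open>x'\<close>.\<close>
    define M' where "M' e' i = M e' i - M e' k * M e i / M e k" for e' i
    obtain x where x: "\<exists>i\<in>J. x i \<noteq> 0" "\<forall>e\<in>E. (\<Sum>i\<in>J. M' e i * x i) = 0"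
      using insert.IH[OF fJ cJ, of M'] by auto
    define s where "s = (\<Sum>i\<in>J. M e i * x i)"
    define x' where "x' = x(k := - s / M e k)"
    have sumx: "(\<Sum>i\<in>I. M e' i * x' i) = (\<Sum>i\<in>J. M e' i * x i) - M e' k * s / M e k" for e'
    proof -
      have "(\<Sum>i\<in>J. M e' i * x' i) = (\<Sum>i\<in>J. M e' i * x i)"
        using IJ by (intro sum.cong) (auto simp: x'_def)
      then show ?thesis unfolding IJ(1) using fJ IJ(2) by (simp add: x'_def)
    qed
    have "(\<Sum>i\<in>J. M' e' i * x i) = (\<Sum>i\<in>J. M e' i * x i) - M e' k * s / M e k" for e'
      unfolding M'_def s_def
      by (simp add: left_diff_distrib sum_subtractf sum_distrib_left sum_divide_distrib mult.assoc)
    then have "\<forall>e'\<in>E. (\<Sum>i\<in>I. M e' i * x' i) = 0" using x(2) sumx by simp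
    moreover have "(\<Sum>i\<in>I. M e i * x' i) = 0" using sumx[of e] k by (simp add: s_def)
    moreover have "\<exists>i\<in>I. x' i \<noteq> 0" using x(1) IJ by (auto simp: x'_def)
    ultimately show ?thesis by blast
  qed
qed

lemma countable_int_combinations:
  assumes "finite N"
  shows "countable {\<Sum>j\<in>N. real_of_int (z j) * \<eta> j |z. True}"
  using assms
proof (induction N rule: finite_induct)
  case (insert k N)
  let ?S = "{\<Sum>j\<in>N. real_of_int (z j) * \<eta> j |z. True}"
  have "{\<Sum>j\<in>insert k N. real_of_int (z j) * \<eta> j |z. True}
      \<subseteq> (\<lambda>(s, m::int). of_int m * \<eta> k + s) ` (?S \<times> UNIV)"
    using insert.hyps by (auto simp: image_iff)
  then show ?case by (rule countable_subset) (use insert.IH in auto)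
qed simp

text \<open>The values are chosen one at a time. A value that would create an integer relation with
  the earlier ones lies in a countable set, and an open interval is uncountable.\<close>

lemma rationally_independent_choice:
  fixes l u :: "'i \<Rightarrow> real"
  assumes "finite N" "\<And>j. j \<in> N \<Longrightarrow> l j < u j"
  shows "\<exists>\<eta>. (\<forall>j\<in>N. l j < \<eta> j \<and> \<eta> j < u j) \<and>
    (\<forall>z::'i \<Rightarrow> int. (\<Sum>j\<in>N. real_of_int (z j) * \<eta> j) = 0 \<longrightarrow> (\<forall>j\<in>N. z j = 0))"
  using assms
proof (induction N rule: finite_induct)
  case (insert k N)
  then obtain \<eta> where \<eta>: "\<forall>j\<in>N. l j < \<eta> j \<and> \<eta> j < u j"
    "\<forall>z::'i \<Rightarrow> int. (\<Sum>j\<in>N. real_of_int (z j) * \<eta> j) = 0 \<longrightarrow> (\<forall>j\<in>N. z j = 0)" by auto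
  let ?S = "{\<Sum>j\<in>N. real_of_int (z j) * \<eta> j |z. True}"
  \<comment> \<open>All values of \<open>\<eta> k\<close> that could take part in a relation with
    coefficient \<open>m\<close>. The case \<open>m = 0\<close> contributes only the value 0, since
    division by zero gives 0.\<close>
  let ?B = "(\<lambda>(s, m::int). - s / of_int m) ` (?S \<times> UNIV)"
  have "countable ?B" using countable_int_combinations[OF insert.hyps(1), of \<eta>] by simp
  moreover have "uncountable {l k<..<u k}" using insert.prems by (simp add: uncountable_open_interval)
  ultimately obtain e where e: "e \<in> {l k<..<u k}" "e \<notin> ?B"
    by (meson countable_subset subsetI)
  let ?\<eta> = "\<eta>(k := e)"
  have eq: "(\<Sum>j\<in>N. real_of_int (z j) * ?\<eta> j) = (\<Sum>j\<in>N. real_of_int (z j) * \<eta> j)" for z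
    using insert.hyps by (intro sum.cong) auto
  have "\<forall>j\<in>insert k N. z j = 0" if z: "(\<Sum>j\<in>insert k N. real_of_int (z j) * ?\<eta> j) = 0" for z
  proof -
    have z': "real_of_int (z k) * e + (\<Sum>j\<in>N. real_of_int (z j) * \<eta> j) = 0"
      using z insert.hyps eq by simp
    have "z k = 0"
    proof (rule ccontr)
      assume "z k \<noteq> 0"
      then have "e = - (\<Sum>j\<in>N. real_of_int (z j) * \<eta> j) / of_int (z k)"
        using z' by (simp add: field_simps)
      then have "e \<in> ?B" by (auto simp: image_iff)
      with e(2) show False by blast
    qed
    with z' \<eta>(2) show ?thesis by auto
  qed
  moreover have "\<forall>j\<in>insert k N. l j < ?\<eta> j \<and> ?\<eta> j < u j" using \<eta>(1) e(1) by auto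
  ultimately show ?case by blast
qed simp

subsection \<open>Linear algebra of the columns\<close>

text \<open>Polymorphic, because the same vector serves as a point of N^n, Z^n and R^n and the
  coercions between them must be transparent to the simplifier.\<close>

definition unit_vec :: "nat \<Rightarrow> nat \<Rightarrow> 'a::zero_neq_one" where
  "unit_vec j = (\<lambda>i. if i = j then 1 else 0)"

lemma unit_vec_simps [simp]:
  "unit_vec j j = 1" "i \<noteq> j \<Longrightarrow> unit_vec j i = 0" "j \<noteq> i \<Longrightarrow> unit_vec j i = 0"
  by (auto simp: unit_vec_def)

lemma unit_vec_nonneg [simp]: "0 \<le> (unit_vec j i :: 'a::linordered_semidom)"
  by (simp add: unit_vec_def)

lemma of_int_unit_vec [simp]: "real_of_int (unit_vec j i) = unit_vec j i"
  by (simp add: unit_vec_def)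

lemma int_unit_vec [simp]: "int (unit_vec j i) = unit_vec j i"
  by (simp add: unit_vec_def)

lemma sum_unit_vec: "finite S \<Longrightarrow> (\<Sum>j\<in>S. f j * unit_vec k j) = (if k \<in> S then (f k::'a::comm_ring_1) else 0)"
  by (simp add: unit_vec_def if_distrib cong: if_cong)

lemma sum_unit_vec': "finite S \<Longrightarrow> (\<Sum>j\<in>S. unit_vec k j * f j) = (if k \<in> S then (f k::'a::comm_ring_1) else 0)"
  by (simp add: unit_vec_def if_distrib if_distribR cong: if_cong)

lemma mvr_cong: "(\<And>j. j < n \<Longrightarrow> x j = y j) \<Longrightarrow> mvr d n A x = mvr d n A y"
  by (auto simp: mvr_def intro!: sum.cong)

lemma mv_cong: "(\<And>j. j < n \<Longrightarrow> x j = y j) \<Longrightarrow> mv d n A x = mv d n A y"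
  by (auto simp: mv_def intro!: sum.cong)

lemma mvr_add: "mvr d n A (\<lambda>j. x j + y j) = (\<lambda>i. mvr d n A x i + mvr d n A y i)"
  by (auto simp: mvr_def distrib_left sum.distrib)

lemma mvr_diff: "mvr d n A (\<lambda>j. x j - y j) = (\<lambda>i. mvr d n A x i - mvr d n A y i)"
  by (auto simp: mvr_def right_diff_distrib sum_subtractf)

lemma mvr_scale: "mvr d n A (\<lambda>j. r * x j) = (\<lambda>i. r * mvr d n A x i)"
  by (auto simp: mvr_def sum_distrib_left fun_eq_iff mult_ac)

lemma mvr_zero [simp]: "mvr d n A (\<lambda>j. 0) = (\<lambda>i. 0)"
  by (auto simp: mvr_def)

lemma mv_add: "mv d n A (\<lambda>j. x j + y j) = (\<lambda>i. mv d n A x i + mv d n A y i)"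
  by (auto simp: mv_def distrib_left sum.distrib)

lemma mv_diff: "mv d n A (\<lambda>j. x j - y j) = (\<lambda>i. mv d n A x i - mv d n A y i)"
  by (auto simp: mv_def right_diff_distrib sum_subtractf)

lemma mv_scale: "mv d n A (\<lambda>j. r * x j) = (\<lambda>i. r * mv d n A x i)"
  by (auto simp: mv_def sum_distrib_left fun_eq_iff mult_ac)

lemma mv_zero [simp]: "mv d n A (\<lambda>j. 0) = (\<lambda>i. 0)"
  by (auto simp: mv_def)

lemma rvec_mv: "rvec (mv d n A z) = mvr d n A (\<lambda>j. real_of_int (z j))"
  by (auto simp: rvec_def mv_def mvr_def)

lemma rvec_inject: "rvec u = rvec v \<longleftrightarrow> u = v"
  by (auto simp: rvec_def fun_eq_iff)

lemma mv_ivecs [simp]: "mv d n A z \<in> ivecs d"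
  by (auto simp: mv_def ivecs_def)

lemma col_ivecs [simp]: "col d A j \<in> ivecs d"
  by (auto simp: col_def ivecs_def)

lemma mv_unit: "j < n \<Longrightarrow> mv d n A (unit_vec j) = col d A j"
  by (auto simp: mv_def col_def sum_unit_vec)

lemma mvr_unit: "j < n \<Longrightarrow> mvr d n A (unit_vec j) = rvec (col d A j)"
  by (auto simp: mvr_def col_def rvec_def sum_unit_vec)

lemma dot_mvr: "(\<Sum>i<d. y i * mvr d n A x i) = (\<Sum>j<n. x j * dotcol d A y j)"
proof -
  have "(\<Sum>i<d. y i * mvr d n A x i) = (\<Sum>i<d. \<Sum>j<n. x j * (y i * of_int (A i j)))"
    by (intro sum.cong) (auto simp: mvr_def sum_distrib_left mult_ac)
  also have "\<dots> = (\<Sum>j<n. \<Sum>i<d. x j * (y i * of_int (A i j)))" by (rule sum.swap)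
  finally show ?thesis by (simp add: dotcol_def sum_distrib_left)
qed

lemma dot_col: "(\<Sum>i<d. y i * rvec (col d A j) i) = dotcol d A y j"
  by (simp add: dotcol_def rvec_def col_def)

lemma mvr_sum: "mvr d n A (\<lambda>t. \<Sum>j\<in>J. w j * L j t) = (\<lambda>i. \<Sum>j\<in>J. w j * mvr d n A (L j) i)"
proof
  fix i
  have "(\<Sum>t<n. real_of_int (A i t) * (\<Sum>j\<in>J. w j * L j t))
      = (\<Sum>t<n. \<Sum>j\<in>J. w j * (real_of_int (A i t) * L j t))"
    by (simp add: sum_distrib_left mult_ac)
  also have "\<dots> = (\<Sum>j\<in>J. \<Sum>t<n. w j * (real_of_int (A i t) * L j t))" by (rule sum.swap)
  finally show "mvr d n A (\<lambda>t. \<Sum>j\<in>J. w j * L j t) i = (\<Sum>j\<in>J. w j * mvr d n A (L j) i)"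
    by (simp add: mvr_def sum_distrib_left)
qed

lemma dotcol_add: "dotcol d A (\<lambda>i. y i + v i) j = dotcol d A y j + dotcol d A v j"
  by (simp add: dotcol_def distrib_right sum.distrib)

lemma dotcol_diff: "dotcol d A (\<lambda>i. y i - v i) j = dotcol d A y j - dotcol d A v j"
  by (simp add: dotcol_def left_diff_distrib sum_subtractf)

lemma dotcol_scale: "dotcol d A (\<lambda>i. r * y i) j = r * dotcol d A y j"
  by (simp add: dotcol_def sum_distrib_left mult.assoc)

lemma dotcol_cong: "(\<And>i. i < d \<Longrightarrow> y i = v i) \<Longrightarrow> dotcol d A y j = dotcol d A v j"
  by (simp add: dotcol_def)

lemma cone_ofI: "\<lbrakk>v = mvr d n A x; \<And>j. 0 \<le> x j; \<And>j. j \<notin> \<sigma> \<Longrightarrow> x j = 0\<rbrakk> \<Longrightarrow> v \<in> cone_of d n A \<sigma>"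
  unfolding cone_of_def by blast

lemma cone_ofE:
  assumes "v \<in> cone_of d n A \<sigma>"
  obtains x where "v = mvr d n A x" "\<And>j. 0 \<le> x j" "\<And>j. j \<notin> \<sigma> \<Longrightarrow> x j = 0"
  using assms unfolding cone_of_def by blast

lemma cone_of_mono: "\<sigma> \<subseteq> \<tau> \<Longrightarrow> cone_of d n A \<sigma> \<subseteq> cone_of d n A \<tau>"
  unfolding cone_of_def by blast

lemma mvr_in_coneA:
  assumes "\<And>j. j < n \<Longrightarrow> 0 \<le> x j"
  shows "mvr d n A x \<in> coneA d n A"
  unfolding coneA_def
  by (rule cone_ofI[of _ _ _ _ "\<lambda>j. if j < n then x j else 0"]) (auto simp: assms intro!: mvr_cong)

lemma col_in_cone: "j \<in> \<sigma> \<Longrightarrow> j < n \<Longrightarrow> rvec (col d A j) \<in> cone_of d n A \<sigma>"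
  by (rule cone_ofI[of _ _ _ _ "unit_vec j"]) (simp add: mvr_unit, simp, metis unit_vec_simps(3))

lemma lin_indep_zero:
  assumes "lin_indep_cols d n A \<sigma>" "mvr d n A x = (\<lambda>i. 0)" "\<And>j. j \<notin> \<sigma> \<Longrightarrow> x j = 0"
  shows "x j = 0"
  using assms unfolding lin_indep_cols_def by blast

lemma lin_indep_unique:
  assumes "lin_indep_cols d n A \<sigma>" "mvr d n A x = mvr d n A y"
    "\<And>j. j \<notin> \<sigma> \<Longrightarrow> x j = 0" "\<And>j. j \<notin> \<sigma> \<Longrightarrow> y j = 0"
  shows "x = y"
proof -
  have "\<forall>j\<in>\<sigma>. (\<lambda>j. x j - y j) j = 0"
    by (rule assms(1)[unfolded lin_indep_cols_def, THEN spec, THEN mp]) (auto simp: mvr_diff assms(2-4))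
  with assms(3,4) show ?thesis by (metis ext eq_iff_diff_eq_0)
qed

lemma lin_indep_subset: "lin_indep_cols d n A \<sigma> \<Longrightarrow> \<tau> \<subseteq> \<sigma> \<Longrightarrow> lin_indep_cols d n A \<tau>"
  unfolding lin_indep_cols_def by (metis subsetD)

lemma mvr_supported:
  assumes "\<sigma> \<subseteq> {..<n}" "\<And>j. j \<notin> \<sigma> \<Longrightarrow> x j = 0" "i < d"
  shows "mvr d n A x i = (\<Sum>j\<in>\<sigma>. of_int (A i j) * x j)"
  unfolding mvr_def using assms by (auto intro!: sum.mono_neutral_right)

lemma card_lin_indep_le:
  assumes "lin_indep_cols d n A \<sigma>" "\<sigma> \<subseteq> {..<n}"
  shows "card \<sigma> \<le> d"
proof (rule ccontr)
  assume "\<not> card \<sigma> \<le> d"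
  then obtain x where x: "\<exists>j\<in>\<sigma>. x j \<noteq> 0" "\<forall>i\<in>{..<d}. (\<Sum>j\<in>\<sigma>. real_of_int (A i j) * x j) = 0"
    using homogeneous_system[of "{..<d}" \<sigma> "\<lambda>i j. real_of_int (A i j)"]
      finite_subset[OF assms(2)] by auto
  let ?x = "\<lambda>j. if j \<in> \<sigma> then x j else 0"
  have "(\<Sum>j\<in>\<sigma>. real_of_int (A i j) * ?x j) = 0" if "i < d" for i
    using x(2) that by simp
  then have "mvr d n A ?x = (\<lambda>i. 0)"
    using mvr_supported[OF assms(2), of ?x _ d A] by (auto simp: mvr_def)
  then have z: "?x j = 0" for j by (rule lin_indep_zero[OF assms(1)]) simp
  from x(1) obtain j where "j \<in> \<sigma>" "x j \<noteq> 0" by blast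
  with z[of j] show False by simp
qed

lemma card_spanning_ge:
  assumes "finite \<sigma>" "\<And>y. (\<forall>j\<in>\<sigma>. dotcol d A y j = 0) \<Longrightarrow> \<forall>i<d. y i = 0"
  shows "d \<le> card \<sigma>"
proof (rule ccontr)
  assume "\<not> d \<le> card \<sigma>"
  then obtain y where y: "\<exists>i\<in>{..<d}. y i \<noteq> 0" "\<forall>j\<in>\<sigma>. (\<Sum>i<d. real_of_int (A i j) * y i) = 0"
    using homogeneous_system[of \<sigma> "{..<d}" "\<lambda>j i. real_of_int (A i j)"] assms by auto
  then have "\<forall>j\<in>\<sigma>. dotcol d A y j = 0" by (simp add: dotcol_def mult.commute)
  with assms(2) y(1) show False by blast
qed

text \<open>Append \<open>v\<close> as an additional column with the free index \<open>n\<close>: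
  \<open>d\<close> equations in \<open>d + 1\<close> unknowns have a nontrivial solution.
  Independence forces its entry at \<open>n\<close> to be nonzero, so one can divide by it.\<close>

lemma basis_coordinates:
  assumes "lin_indep_cols d n A \<sigma>" "\<sigma> \<subseteq> {..<n}" "card \<sigma> = d" "\<And>i. d \<le> i \<Longrightarrow> v i = 0"
  shows "\<exists>x. (\<forall>j. j \<notin> \<sigma> \<longrightarrow> x j = 0) \<and> mvr d n A x = v"
proof -
  have fin: "finite \<sigma>" using assms(2) finite_subset by blast
  have nn: "n \<notin> \<sigma>" using assms(2) by auto
  let ?M = "\<lambda>i j. if j = n then v i else real_of_int (A i j)"
  obtain x where x: "\<exists>j\<in>insert n \<sigma>. x j \<noteq> 0" "\<forall>i\<in>{..<d}. (\<Sum>j\<in>insert n \<sigma>. ?M i j * x j) = 0"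
    using homogeneous_system[of "{..<d}" "insert n \<sigma>" ?M] fin nn assms(3) by auto
  have "(\<Sum>j\<in>\<sigma>. ?M i j * x j) = (\<Sum>j\<in>\<sigma>. real_of_int (A i j) * x j)" for i
    using nn by (intro sum.cong) auto
  with x(2) have x2: "v i * x n + (\<Sum>j\<in>\<sigma>. real_of_int (A i j) * x j) = 0" if "i < d" for i
    using fin nn that by auto
  let ?x = "\<lambda>j. if j \<in> \<sigma> then x j else 0"
  have m: "mvr d n A ?x i = - v i * x n" if "i < d" for i
    using x2[OF that] mvr_supported[OF assms(2), of ?x i d A] that by simp
  have "x n \<noteq> 0"
  proof
    assume 0: "x n = 0"
    then have "mvr d n A ?x = (\<lambda>i. 0)" using m by (auto simp: mvr_def)
    then have z: "?x j = 0" for j by (rule lin_indep_zero[OF assms(1)]) simp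
    from x(1) 0 obtain j where "j \<in> \<sigma>" "x j \<noteq> 0" by auto
    with z[of j] show False by simp
  qed
  then have "mvr d n A (\<lambda>j. (- 1 / x n) * ?x j) = v"
    unfolding mvr_scale using m assms(4) by (fastforce simp: mvr_def field_simps)
  then show ?thesis by (intro exI[of _ "\<lambda>j. (- 1 / x n) * ?x j"]) simp
qed

text \<open>Induction on the columns. The crux is a functional that vanishes on
  \<open>\<sigma>\<close> but not on the new column \<open>s\<close>; if there were none,
  interpolation on \<open>\<sigma>\<close> would be exact at \<open>s\<close> and would exhibit
  column \<open>s\<close> as a combination of the others.\<close>

lemma lin_indep_dual:
  assumes "finite \<sigma>" "\<sigma> \<subseteq> {..<n}" "lin_indep_cols d n A \<sigma>"
  shows "\<exists>y. \<forall>j\<in>\<sigma>. dotcol d A y j = f j"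
  using assms
proof (induction \<sigma> arbitrary: f rule: finite_induct)
  case (insert s \<sigma>)
  have li: "lin_indep_cols d n A \<sigma>" using insert.prems lin_indep_subset by blast
  note IH = insert.IH[OF _ li]
  obtain v where v: "\<And>t j. j \<in> \<sigma> \<Longrightarrow> dotcol d A (v t) j = unit_vec t j"
    using IH[of "unit_vec t" for t] insert.prems(1) by (metis insert_subset)
  have "\<exists>y. (\<forall>j\<in>\<sigma>. dotcol d A y j = 0) \<and> dotcol d A y s \<noteq> 0"
  proof (rule ccontr)
    assume "\<not> ?thesis"
    then have ann: "dotcol d A y s = 0" if "\<forall>j\<in>\<sigma>. dotcol d A y j = 0" for y using that by blast
    define x where "x = (\<lambda>t. if t = s then - 1 else if t \<in> \<sigma> then dotcol d A (v t) s else 0)"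
    have "mvr d n A x k = 0" if k: "k < d" for k
    proof -
      \<comment> \<open>The \<open>k\<close>-th coordinate functional minus its interpolation on
        \<open>\<sigma>\<close>. It vanishes on \<open>\<sigma>\<close>, hence at \<open>s\<close>
        by assumption, and this is row \<open>k\<close> of the linear dependence
        \<open>x\<close>.\<close>
      let ?y = "\<lambda>i. unit_vec k i - (\<Sum>t\<in>\<sigma>. real_of_int (A k t) * v t i)"
      have dy: "dotcol d A ?y j = of_int (A k j) - (\<Sum>t\<in>\<sigma>. of_int (A k t) * dotcol d A (v t) j)" for j
      proof -
        have "dotcol d A (\<lambda>i. \<Sum>t\<in>\<sigma>. real_of_int (A k t) * v t i) j
            = (\<Sum>i<d. \<Sum>t\<in>\<sigma>. real_of_int (A k t) * (v t i * real_of_int (A i j)))"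
          by (simp add: dotcol_def sum_distrib_right mult.assoc)
        also have "\<dots> = (\<Sum>t\<in>\<sigma>. \<Sum>i<d. real_of_int (A k t) * (v t i * real_of_int (A i j)))"
          by (rule sum.swap)
        finally have "dotcol d A (\<lambda>i. \<Sum>t\<in>\<sigma>. real_of_int (A k t) * v t i) j
            = (\<Sum>t\<in>\<sigma>. of_int (A k t) * dotcol d A (v t) j)"
          by (simp add: dotcol_def sum_distrib_left)
        then show ?thesis using k
          by (simp add: dotcol_diff) (simp add: dotcol_def sum_unit_vec')
      qed
      have "dotcol d A ?y j = 0" if "j \<in> \<sigma>" for j
      proof -
        have "(\<Sum>t\<in>\<sigma>. real_of_int (A k t) * dotcol d A (v t) j)
            = (\<Sum>t\<in>\<sigma>. real_of_int (A k t) * unit_vec j t)"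
          using v that by (intro sum.cong) (auto simp: unit_vec_def)
        then show ?thesis using dy[of j] that insert.hyps by (simp add: sum_unit_vec)
      qed
      then have "dotcol d A ?y s = 0" by (intro ann) blast
      moreover have "mvr d n A x k = (\<Sum>t\<in>insert s \<sigma>. of_int (A k t) * x t)"
        using insert.prems k by (intro mvr_supported) (auto simp: x_def)
      moreover have "(\<Sum>t\<in>\<sigma>. of_int (A k t) * x t) = (\<Sum>t\<in>\<sigma>. of_int (A k t) * dotcol d A (v t) s)"
        using insert.hyps by (intro sum.cong) (auto simp: x_def)
      ultimately show ?thesis using dy[of s] insert.hyps by (simp add: x_def)
    qed
    then have "mvr d n A x = (\<lambda>i. 0)" by (auto simp: mvr_def)
    moreover have "\<forall>j. j \<notin> insert s \<sigma> \<longrightarrow> x j = 0" by (auto simp: x_def)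
    ultimately have "x s = 0" using insert.prems(2) unfolding lin_indep_cols_def by blast
    then show False by (simp add: x_def)
  qed
  then obtain w where w: "\<forall>j\<in>\<sigma>. dotcol d A w j = 0" "dotcol d A w s \<noteq> 0" by blast
  obtain y where y: "\<forall>j\<in>\<sigma>. dotcol d A y j = f j" using IH insert.prems by blast
  define r where "r = (f s - dotcol d A y s) / dotcol d A w s"
  have "\<forall>j\<in>insert s \<sigma>. dotcol d A (\<lambda>i. y i + r * w i) j = f j"
    using w y by (simp add: dotcol_add dotcol_scale) (simp add: r_def)
  then show ?case by blast
qed simp

subsection \<open>Fibers of the semigroup\<close>

lemma semigroup_iff: "b \<in> semigroup d n A \<longleftrightarrow> (\<exists>u. b = mv d n A (\<lambda>j. int (u j)))"
  by (simp add: semigroup_def)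

lemma hilbert_combination:
  assumes "inj_on (col d A) S" "S \<subseteq> {..<n}" "\<And>k. k < n \<Longrightarrow> k \<notin> S \<Longrightarrow> u k = 0"
  shows "\<exists>m. mv d n A (\<lambda>j. int (u j)) = (\<lambda>i. \<Sum>h\<in>col d A ` S. int (m h) * h i)"
proof (intro exI ext)
  fix i
  let ?m = "\<lambda>h. u (inv_into S (col d A) h)"
  have "(\<Sum>h\<in>col d A ` S. int (?m h) * h i) = (\<Sum>k\<in>S. int (u k) * col d A k i)"
    using assms(1) by (simp add: sum.reindex)
  also have "\<dots> = (\<Sum>k<n. int (u k) * col d A k i)"
    using assms(2,3) by (intro sum.mono_neutral_left) auto
  also have "\<dots> = mv d n A (\<lambda>j. int (u j)) i" by (simp add: mv_def col_def mult.commute)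
  finally show "mv d n A (\<lambda>j. int (u j)) i = (\<Sum>h\<in>col d A ` S. int (?m h) * h i)" ..
qed

locale standing_matrix =
  fixes d n :: nat and A :: "nat \<Rightarrow> nat \<Rightarrow> int"
  assumes standing: "standing d n A"
begin

abbreviation rcol :: "nat \<Rightarrow> nat \<Rightarrow> real" where
  "rcol j \<equiv> rvec (col d A j)"

abbreviation cone :: "nat set \<Rightarrow> (nat \<Rightarrow> real) set" where
  "cone \<equiv> cone_of d n A"

lemma full_rank: "full_row_rank d n A"
  using standing by (simp add: standing_def)

lemma kernel: "\<lbrakk>mvr d n A x = (\<lambda>i. 0); \<And>j. j < n \<Longrightarrow> 0 \<le> x j; j < n\<rbrakk> \<Longrightarrow> x j = 0"
  using standing unfolding standing_def by blast

lemma nat_kernel: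
  assumes "mv d n A (\<lambda>j. int (w j)) = (\<lambda>i. 0)" "j < n"
  shows "w j = 0"
proof -
  have "mvr d n A (\<lambda>j. real (w j)) = (\<lambda>i. 0)"
    using arg_cong[OF assms(1), of rvec] by (simp add: rvec_mv) (simp add: rvec_def)
  from kernel[OF this _ assms(2)] show ?thesis by simp
qed

lemma semigroup_eq: "semigroup d n A = lattice_pts d (coneA d n A)"
  using standing by (simp add: standing_def)

lemma inj_col: "inj_on (col d A) {..<n}"
  using standing by (simp add: standing_def)

lemma lattice_point_nat:
  assumes "b \<in> ivecs d" "rvec b \<in> coneA d n A"
  obtains u where "b = mv d n A (\<lambda>j. int (u j))"
  using assms semigroup_eq unfolding lattice_pts_def semigroup_def by blast

text \<open>Minimality of the Hilbert basis as irreducibility. If \<open>w\<close> uses column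
  \<open>j\<close>, removing one copy leaves a representation of 0, which is trivial. If it does
  not, every use of column \<open>j\<close> can be replaced by \<open>w\<close>, so the other
  columns already form a Hilbert basis.\<close>

lemma col_fiber_unique:
  assumes w: "mv d n A (\<lambda>i. int (w i)) = col d A j" and j: "j < n" and "k < n"
  shows "w k = unit_vec j k"
proof (cases "w j = 0")
  case False
  define w' where "w' = w(j := w j - 1)"
  have "(\<lambda>i. int (w' i)) = (\<lambda>i. int (w i) - unit_vec j i)"
    using False by (auto simp: w'_def unit_vec_def)
  then have "mv d n A (\<lambda>i. int (w' i)) = (\<lambda>i. 0)"
    using w j by (simp add: mv_diff mv_unit)
  from nat_kernel[OF this \<open>k < n\<close>] show ?thesis
    using False by (auto simp: w'_def unit_vec_def split: if_splits)
next
  case True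
  let ?S = "{..<n} - {j}"
  let ?H = "col d A ` {..<n}" and ?H' = "col d A ` ?S"
  have mhb: "minimal_hilbert_basis d (coneA d n A) ?H" using standing by (simp add: standing_def)
  then have hb: "hilbert_basis d (coneA d n A) ?H" by (simp add: minimal_hilbert_basis_def)
  have "hilbert_basis d (coneA d n A) ?H'"
    unfolding hilbert_basis_def
  proof (intro conjI ballI)
    show "finite ?H'" by simp
    show "?H' \<subseteq> lattice_pts d (coneA d n A)" using hb unfolding hilbert_basis_def by auto
    fix b assume "b \<in> lattice_pts d (coneA d n A)"
    then obtain u where u: "b = mv d n A (\<lambda>j. int (u j))"
      using semigroup_eq semigroup_iff[of b d n A] by blast
    define u' where "u' i = (if i = j then 0 else u i + u j * w i)" for i
    have "(\<lambda>i. int (u' i)) = (\<lambda>i. int (u i) + int (u j) * (int (w i) - unit_vec j i))"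
      using True by (auto simp: u'_def unit_vec_def)
    then have "mv d n A (\<lambda>i. int (u' i)) = mv d n A (\<lambda>i. int (u i) + int (u j) * (int (w i) - unit_vec j i))"
      by (rule arg_cong)
    also have "\<dots> = b"
      unfolding mv_add mv_scale mv_diff by (simp add: u w mv_unit[OF j])
    finally have b: "b = mv d n A (\<lambda>i. int (u' i))" ..
    have "inj_on (col d A) ?S" by (rule inj_on_subset[OF inj_col]) auto
    then show "\<exists>m. b = (\<lambda>i. \<Sum>h\<in>?H'. int (m h) * h i)"
      unfolding b by (rule hilbert_combination) (auto simp: u'_def)
  qed
  moreover have "?H' \<subset> ?H"
  proof -
    have "col d A j \<notin> ?H'" using inj_col j by (auto simp: inj_on_def)
    then show ?thesis using j by blast
  qed
  ultimately show ?thesis using mhb unfolding minimal_hilbert_basis_def by blast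
qed

lemma col_nonzero: "j < n \<Longrightarrow> col d A j \<noteq> (\<lambda>i. 0)"
  using nat_kernel[of "unit_vec j" j] mv_unit[of j n d A] by auto

text \<open>A lattice point \<open>b\<close> strictly between 0 and column \<open>t\<close> splits
  the column as \<open>b\<close> plus its complement, both in the semigroup by normality.
  Irreducibility makes one of the two summands 0.\<close>

lemma ray_primitive:
  assumes t: "t < n" and \<phi>: "0 \<le> \<phi>" "\<phi> < 1" and b: "b \<in> ivecs d" "rvec b = (\<lambda>i. \<phi> * rcol t i)"
  shows "\<phi> = 0"
proof (rule ccontr)
  assume "\<phi> \<noteq> 0"
  have "rvec b = mvr d n A (\<lambda>i. \<phi> * unit_vec t i)" using b t by (simp add: mvr_scale mvr_unit)
  then have "rvec b \<in> coneA d n A" using \<phi> by (simp add: mvr_in_coneA)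
  then obtain p where p: "b = mv d n A (\<lambda>j. int (p j))" using b lattice_point_nat by blast
  let ?b = "\<lambda>i. col d A t i - b i"
  have "rvec ?b = (\<lambda>i. rcol t i - rvec b i)" by (simp add: rvec_def)
  also have "\<dots> = mvr d n A (\<lambda>i. (1 - \<phi>) * unit_vec t i)"
    unfolding b(2) mvr_scale using t by (simp add: mvr_unit left_diff_distrib)
  also have "\<dots> \<in> coneA d n A" using \<phi> by (simp add: mvr_in_coneA)
  finally have "rvec ?b \<in> coneA d n A" .
  moreover have "?b \<in> ivecs d" using b by (auto simp: ivecs_def col_def)
  ultimately obtain q where q: "?b = mv d n A (\<lambda>j. int (q j))" using lattice_point_nat by blast
  have "mv d n A (\<lambda>i. int (p i + q i)) = col d A t"
    using p q by (simp add: mv_add fun_eq_iff) (metis add_diff_cancel_left' add.commute diff_add_cancel)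
  then have pq: "p k + q k = unit_vec t k" if "k < n" for k
    by (rule col_fiber_unique[where w = "\<lambda>i. p i + q i"]) (use t that in auto)
  obtain i where i: "col d A t i \<noteq> 0" using col_nonzero[OF t] by auto
  have "p t = 0 \<or> q t = 0" using pq[OF t] by auto
  then show False
  proof
    assume "p t = 0"
    then have "p k = 0" if "k < n" for k using pq[OF that] by (cases "k = t") auto
    then have "b i = 0" using p by (simp add: mv_def)
    then show False using fun_cong[OF b(2), of i] i \<open>\<phi> \<noteq> 0\<close> by (simp add: rvec_def)
  next
    assume "q t = 0"
    then have "q k = 0" if "k < n" for k using pq[OF that] by (cases "k = t") auto
    then have "?b i = 0" using fun_cong[OF q, of i] by (simp add: mv_def)
    then show False using fun_cong[OF b(2), of i] i \<phi> by (simp add: rvec_def)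
  qed
qed

text \<open>Primitivity applied to the fractional parts of \<open>r\<close> and of
  \<open>1 / r\<close> shows that both are integers, so \<open>r = 1\<close>, and distinct indices
  give distinct columns.\<close>

lemma columns_not_parallel:
  assumes "l < n" "t < n" "rcol l = (\<lambda>i. r * rcol t i)" "0 < r"
  shows "l = t"
proof -
  have frac0: "frac r = 0" if "l < n" "t < n" and eq: "rcol l = (\<lambda>i. r * rcol t i)" and "0 < r" for l t r
  proof (rule ray_primitive[OF \<open>t < n\<close>])
    let ?b = "\<lambda>i. col d A l i - \<lfloor>r\<rfloor> * col d A t i"
    show "?b \<in> ivecs d" by (auto simp: ivecs_def col_def)
    show "rvec ?b = (\<lambda>i. frac r * rcol t i)"
      using eq by (auto simp: rvec_def frac_def left_diff_distrib fun_eq_iff)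
  qed (auto simp: frac_ge_0 frac_lt_1)
  have fr: "frac r = 0" using frac0[OF assms] .
  have "frac (1 / r) = 0"
    by (rule frac0[OF assms(2,1)]) (use assms(3,4) in auto)
  then obtain p q :: int where pq: "r = of_int p" "1 / r = of_int q"
    using fr by (auto simp: frac_eq_0_iff elim!: Ints_cases)
  then have "real_of_int (p * q) = 1" using assms(4) by (simp flip: pq)
  then have "p * q = 1" by linarith
  moreover have "0 < p" using pq assms(4) by simp
  ultimately have "p = 1" by (metis pos_zmult_eq_1_iff)
  then have "rcol l = rcol t" using assms(3) pq by simp
  then show ?thesis using inj_col assms by (auto simp: rvec_inject inj_on_def)
qed

end

subsection \<open>Regular subdivisions and their dual vectors\<close>

lemma deltaE:
  assumes "\<sigma> \<in> delta d n A c"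
  obtains y where "\<sigma> \<subseteq> {..<n}" "\<And>j. j \<in> \<sigma> \<Longrightarrow> dotcol d A y j = c j"
    "\<And>j. j < n \<Longrightarrow> j \<notin> \<sigma> \<Longrightarrow> dotcol d A y j < c j"
  using assms unfolding delta_def by blast

lemma deltaI:
  assumes "\<sigma> \<subseteq> {..<n}" "\<And>j. j \<in> \<sigma> \<Longrightarrow> dotcol d A y j = c j"
    "\<And>j. j < n \<Longrightarrow> j \<notin> \<sigma> \<Longrightarrow> dotcol d A y j < c j"
  shows "\<sigma> \<in> delta d n A c"
  using assms unfolding delta_def by blast

lemma max_faceD: "max_face \<Delta> \<sigma> \<Longrightarrow> \<sigma> \<in> \<Delta>"
  by (simp add: max_face_def)

lemma max_face_above:
  assumes "\<sigma> \<in> \<Delta>" "\<And>\<tau>. \<tau> \<in> \<Delta> \<Longrightarrow> \<tau> \<subseteq> {..<n::nat}"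
  shows "\<exists>\<tau>. max_face \<Delta> \<tau> \<and> \<sigma> \<subseteq> \<tau>"
proof -
  have "finite \<Delta>" using assms(2) by (intro finite_subset[of \<Delta> "Pow {..<n}"]) auto
  from finite_has_maximal2[OF this assms(1)]
  obtain m where "m \<in> \<Delta>" "\<sigma> \<subseteq> m" "\<And>b. b \<in> \<Delta> \<Longrightarrow> m \<subseteq> b \<Longrightarrow> m = b" by auto
  then show ?thesis unfolding max_face_def by (intro exI[of _ m]) auto
qed

text \<open>If the columns of a face do not span, its dual vector can be moved along their annihilator
  until a further column becomes tight.\<close>

lemma max_face_spanning:
  assumes rank: "full_row_rank d n A" and max: "max_face (delta d n A c) \<sigma>"
    and v: "\<forall>j\<in>\<sigma>. dotcol d A v j = 0"
  shows "\<forall>i<d. v i = 0"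
proof (rule ccontr)
  assume nz: "\<not> ?thesis"
  obtain y where y: "\<sigma> \<subseteq> {..<n}" "\<And>j. j \<in> \<sigma> \<Longrightarrow> dotcol d A y j = c j"
    "\<And>j. j < n \<Longrightarrow> j \<notin> \<sigma> \<Longrightarrow> dotcol d A y j < c j"
    using deltaE[OF max_faceD[OF max]] by blast
  have "\<exists>u. (\<forall>j\<in>\<sigma>. dotcol d A u j = 0) \<and> (\<exists>j<n. dotcol d A u j > 0)"
  proof -
    obtain j where j: "j < n" "dotcol d A v j \<noteq> 0"
      using rank nz unfolding full_row_rank_def by blast
    have m: "dotcol d A (\<lambda>i. (-1) * v i) j = - dotcol d A v j" for j by (subst dotcol_scale) simp
    show ?thesis
    proof (cases "0 < dotcol d A v j")
      case True
      then show ?thesis using v j by blast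
    next
      case False
      then show ?thesis using v j m by (intro exI[of _ "\<lambda>i. (-1) * v i"]) (auto intro!: exI[of _ j])
    qed
  qed
  then obtain u where u: "\<And>j. j \<in> \<sigma> \<Longrightarrow> dotcol d A u j = 0" and ex: "\<exists>j<n. dotcol d A u j > 0" by blast
  define P where "P = {j. j < n \<and> dotcol d A u j > 0}"
  have P: "finite P" "P \<noteq> {}" using ex by (auto simp: P_def)
  define q where "q j = (c j - dotcol d A y j) / dotcol d A u j" for j
  define t where "t = Min (q ` P)"
  have tle: "t \<le> q j" if "j \<in> P" for j using P that by (simp add: t_def)
  obtain k where k: "k \<in> P" "t = q k"
    using Min_in[of "q ` P"] P unfolding t_def by blast
  have kn: "k \<notin> \<sigma>" using k u by (auto simp: P_def)
  then have tpos: "t > 0" using k y(3)[of k] by (auto simp: P_def q_def)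
  let ?y = "\<lambda>i. y i + t * u i"
  have dy: "dotcol d A ?y j = dotcol d A y j + t * dotcol d A u j" for j
    by (simp add: dotcol_add dotcol_scale)
  have le: "dotcol d A ?y j \<le> c j" if "j < n" for j
  proof (cases "j \<in> P")
    case True
    then show ?thesis using tle[OF True] by (simp add: dy q_def P_def field_simps)
  next
    case False
    then have "dotcol d A u j \<le> 0" using that by (auto simp: P_def)
    then have "t * dotcol d A u j \<le> 0" using tpos by (simp add: mult_nonneg_nonpos)
    moreover have "dotcol d A y j \<le> c j" using y(2,3) that by (cases "j \<in> \<sigma>") (auto simp: less_imp_le)
    ultimately show ?thesis by (simp add: dy)
  qed
  define \<tau> where "\<tau> = {j. j < n \<and> dotcol d A ?y j = c j}"
  have "\<tau> \<in> delta d n A c"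
    using le by (intro deltaI[of _ _ _ _ ?y]) (auto simp: \<tau>_def less_le)
  moreover have "\<sigma> \<subseteq> \<tau>" using y(1,2) u by (auto simp: \<tau>_def dy)
  moreover have "t * dotcol d A u k = c k - dotcol d A y k" using k by (simp add: P_def q_def)
  then have "k \<in> \<tau>" using k(1) by (simp add: \<tau>_def dy P_def)
  ultimately show False using max kn unfolding max_face_def by blast
qed

text \<open>\<open>dual_vec\<close> is a definite description, so it is meaningful only once
  uniqueness is known. The columns of a maximal face span, which gives uniqueness and identifies it
  with the witness from \<open>delta\<close>.\<close>

lemma dual_vec_tight:
  assumes "full_row_rank d n A" "max_face (delta d n A c) \<sigma>"
  shows "j \<in> \<sigma> \<Longrightarrow> dotcol d A (dual_vec d A c \<sigma>) j = c j"
    and "j < n \<Longrightarrow> j \<notin> \<sigma> \<Longrightarrow> dotcol d A (dual_vec d A c \<sigma>) j < c j"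
proof -
  obtain y where y: "\<sigma> \<subseteq> {..<n}" "\<And>j. j \<in> \<sigma> \<Longrightarrow> dotcol d A y j = c j"
    "\<And>j. j < n \<Longrightarrow> j \<notin> \<sigma> \<Longrightarrow> dotcol d A y j < c j"
    using deltaE[OF max_faceD[OF assms(2)]] by blast
  \<comment> \<open>The witness from \<open>delta\<close> is unconstrained at indices from
    \<open>d\<close> on, whereas \<open>dual_vec\<close> has to vanish there.\<close>
  define y' where "y' i = (if i < d then y i else 0)" for i
  have y': "dotcol d A y' j = dotcol d A y j" for j by (rule dotcol_cong) (simp add: y'_def)
  have "dual_vec d A c \<sigma> = y'"
    unfolding dual_vec_def
  proof (rule the_equality)
    show "(\<forall>i\<ge>d. y' i = 0) \<and> (\<forall>j\<in>\<sigma>. dotcol d A y' j = c j)" using y y' by (auto simp: y'_def)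
    fix w assume w: "(\<forall>i\<ge>d. w i = 0) \<and> (\<forall>j\<in>\<sigma>. dotcol d A w j = c j)"
    have "\<forall>i<d. w i - y' i = 0"
      by (rule max_face_spanning[OF assms]) (use w y y' in \<open>auto simp: dotcol_diff\<close>)
    then show "w = y'" using w by (auto simp: y'_def fun_eq_iff not_less)
  qed
  then show "j \<in> \<sigma> \<Longrightarrow> dotcol d A (dual_vec d A c \<sigma>) j = c j"
    and "j < n \<Longrightarrow> j \<notin> \<sigma> \<Longrightarrow> dotcol d A (dual_vec d A c \<sigma>) j < c j"
    using y y' by auto
qed

lemma reduced_cost_zero:
  "full_row_rank d n A \<Longrightarrow> max_face (delta d n A c) \<sigma> \<Longrightarrow> j \<in> \<sigma> \<Longrightarrow> reduced_cost d A c \<sigma> j = 0"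
  by (simp add: reduced_cost_def dual_vec_tight)

lemma reduced_cost_pos:
  "full_row_rank d n A \<Longrightarrow> max_face (delta d n A c) \<sigma> \<Longrightarrow> j < n \<Longrightarrow> j \<notin> \<sigma> \<Longrightarrow> 0 < reduced_cost d A c \<sigma> j"
  by (simp add: reduced_cost_def dual_vec_tight)

lemma reduced_cost_nonneg:
  "full_row_rank d n A \<Longrightarrow> max_face (delta d n A c) \<sigma> \<Longrightarrow> j < n \<Longrightarrow> 0 \<le> reduced_cost d A c \<sigma> j"
  using reduced_cost_zero reduced_cost_pos by (metis less_eq_real_def)

lemma max_face_subset: "max_face (delta d n A c) \<sigma> \<Longrightarrow> \<sigma> \<subseteq> {..<n}"
  by (auto simp: max_face_def delta_def)

lemma gr_objective_all:
  assumes "full_row_rank d n A" "max_face (delta d n A c) \<sigma>"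
  shows "gr_objective d n A c \<sigma> z = (\<Sum>j<n. reduced_cost d A c \<sigma> j * of_int (z j))"
  unfolding gr_objective_def using assms
  by (intro sum.mono_neutral_left) (auto simp: reduced_cost_zero)

text \<open>On a fixed fiber the reduced objective differs from the original cost by a constant.
  Hence the relaxations for different faces can all be compared through the single cost
  \<open>c\<close>.\<close>

lemma gr_objective_eq:
  assumes "full_row_rank d n A" "max_face (delta d n A c) \<sigma>" "mv d n A z = b"
  shows "gr_objective d n A c \<sigma> z
    = (\<Sum>j<n. c j * of_int (z j)) - (\<Sum>i<d. dual_vec d A c \<sigma> i * of_int (b i))"
proof -
  let ?y = "dual_vec d A c \<sigma>"
  have "(\<Sum>i<d. ?y i * of_int (b i)) = (\<Sum>i<d. ?y i * mvr d n A (\<lambda>j. of_int (z j)) i)"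
    using assms(3) rvec_mv[of d n A z] by (simp add: rvec_def fun_eq_iff)
  then show ?thesis
    unfolding gr_objective_all[OF assms(1,2)] reduced_cost_def dot_mvr
    by (simp add: left_diff_distrib right_diff_distrib sum_subtractf mult.commute)
qed

lemma gr_optimal_iff:
  assumes "full_row_rank d n A" "max_face (delta d n A c) \<sigma>"
  shows "gr_optimal d n A c \<sigma> b x \<longleftrightarrow> gr_feasible d n A \<sigma> b x \<and>
    (\<forall>z. gr_feasible d n A \<sigma> b z \<longrightarrow> (\<Sum>j<n. c j * of_int (x j)) \<le> (\<Sum>j<n. c j * of_int (z j)))"
  unfolding gr_optimal_def gr_feasible_def using gr_objective_eq[OF assms] by auto

lemma ip_feasible_gr_feasible:
  "ip_feasible d n A b x \<Longrightarrow> gr_feasible d n A \<sigma> b (\<lambda>j. int (x j))"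
  by (auto simp: ip_feasible_def gr_feasible_def natvecs_def)

lemma cost_int: "cost n c x = (\<Sum>j<n. c j * of_int (int (x j)))"
  by (simp add: cost_def)

lemma gr_feasible_ip_feasible:
  assumes "gr_feasible d n A \<sigma> b z" "\<And>j. j < n \<Longrightarrow> 0 \<le> z j"
  shows "ip_feasible d n A b (\<lambda>j. nat (z j))" "int (nat (z j)) = z j"
proof -
  have "int (nat (z j)) = z j" for j
    using assms by (cases "j < n") (auto simp: gr_feasible_def)
  then show "ip_feasible d n A b (\<lambda>j. nat (z j))" "int (nat (z j)) = z j"
    using assms by (auto simp: ip_feasible_def gr_feasible_def natvecs_def)
qed

lemma gr_optimal_ip_optimal:
  assumes "full_row_rank d n A" "max_face (delta d n A c) \<sigma>"
    "gr_optimal d n A c \<sigma> b x" "\<And>j. j < n \<Longrightarrow> 0 \<le> x j"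
  shows "ip_optimal d n A c b (\<lambda>j. nat (x j))"
proof -
  have f: "gr_feasible d n A \<sigma> b x" using assms(3) by (simp add: gr_optimal_def)
  note g = gr_feasible_ip_feasible[OF f assms(4)]
  show ?thesis
    unfolding ip_optimal_def
  proof (intro conjI allI impI)
    show "ip_feasible d n A b (\<lambda>j. nat (x j))" by (rule g(1))
    fix x' assume "ip_feasible d n A b x'"
    then have "(\<Sum>j<n. c j * of_int (x j)) \<le> (\<Sum>j<n. c j * of_int (int (x' j)))"
      using assms(3) ip_feasible_gr_feasible unfolding gr_optimal_iff[OF assms(1,2)] by blast
    then show "cost n c (\<lambda>j. nat (x j)) \<le> cost n c x'" by (simp only: cost_int g(2))
  qed
qed

lemma ip_feasible_semigroup: "ip_feasible d n A b x \<Longrightarrow> b \<in> semigroup d n A"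
  by (auto simp: ip_feasible_def semigroup_def)

text \<open>Adding the same large multiple of the columns of \<open>\<sigma>\<close> to two optima of a group relaxation
  makes them optima of an integer program.\<close>

lemma gr_optimal_unique:
  assumes "full_row_rank d n A" "max_face (delta d n A c) \<sigma>" "generic d n A c"
    "gr_optimal d n A c \<sigma> b x" "gr_optimal d n A c \<sigma> b z"
  shows "x = z"
proof -
  note iff = gr_optimal_iff[OF assms(1,2)]
  have sub: "\<sigma> \<subseteq> {..<n}" using max_face_subset[OF assms(2)] .
  then have fin: "finite \<sigma>" using finite_subset by blast
  define K where "K = (\<Sum>t\<in>\<sigma>. \<bar>x t\<bar> + \<bar>z t\<bar>)"
  have K: "\<bar>x t\<bar> + \<bar>z t\<bar> \<le> K" if "t \<in> \<sigma>" for t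
    unfolding K_def using that fin by (intro member_le_sum) auto
  define v where "v t = (if t \<in> \<sigma> then K else 0)" for t
  let ?b = "\<lambda>i. b i + mv d n A v i"
  have feas: "gr_feasible d n A \<sigma> ?b (\<lambda>j. u j + v j)" if "gr_feasible d n A \<sigma> b u" for u
    using that sub by (auto simp: gr_feasible_def mv_add) (auto simp: v_def)
  have feas': "gr_feasible d n A \<sigma> b (\<lambda>j. u j - v j)" if "gr_feasible d n A \<sigma> ?b u" for u
    using that sub by (auto simp: gr_feasible_def mv_diff) (auto simp: v_def)
  \<comment> \<open>Entries on \<open>\<sigma>\<close> are free, so translation by \<open>v\<close>
    is a bijection between the feasible points for \<open>b\<close> and those for \<open>?b\<close>,
    and it changes every cost by the same amount.\<close>
  have shift: "gr_optimal d n A c \<sigma> ?b (\<lambda>j. u j + v j)" if u: "gr_optimal d n A c \<sigma> b u" for u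
    unfolding iff
  proof (intro conjI allI impI)
    show "gr_feasible d n A \<sigma> ?b (\<lambda>j. u j + v j)" using feas u iff by blast
    fix w assume "gr_feasible d n A \<sigma> ?b w"
    then have "(\<Sum>j<n. c j * of_int (u j)) \<le> (\<Sum>j<n. c j * of_int (w j - v j))"
      using feas' u iff by blast
    then show "(\<Sum>j<n. c j * of_int (u j + v j)) \<le> (\<Sum>j<n. c j * of_int (w j))"
      by (simp add: distrib_left right_diff_distrib sum.distrib sum_subtractf)
  qed
  have nn: "0 \<le> x j + v j" "0 \<le> z j + v j" if "j < n" for j
    using that K[of j] assms(4,5) by (auto simp: gr_optimal_def gr_feasible_def v_def)
  have o1: "ip_optimal d n A c ?b (\<lambda>j. nat (x j + v j))"
    by (rule gr_optimal_ip_optimal[OF assms(1,2) shift[OF assms(4)]]) (rule nn)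
  have o2: "ip_optimal d n A c ?b (\<lambda>j. nat (z j + v j))"
    by (rule gr_optimal_ip_optimal[OF assms(1,2) shift[OF assms(5)]]) (rule nn)
  have "?b \<in> semigroup d n A" using o1 ip_feasible_semigroup unfolding ip_optimal_def by blast
  with assms(3) o1 o2 have eq: "(\<lambda>j. nat (x j + v j)) = (\<lambda>j. nat (z j + v j))"
    unfolding generic_def by blast
  show "x = z"
  proof
    fix j
    show "x j = z j"
    proof (cases "j < n")
      case True
      then show ?thesis using fun_cong[OF eq, of j] nn[OF True] by simp
    next
      case False
      then show ?thesis using assms(4,5) by (simp add: gr_optimal_def gr_feasible_def)
    qed
  qed
qed

context standing_matrix
begin

subsection \<open>Subdividing simplicial cones\<close>

lemma fractional_part:
  assumes "b \<in> ivecs d" "rvec b = mvr d n A x"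
  shows "(\<lambda>i. b i - mv d n A (\<lambda>j. \<lfloor>x j\<rfloor>) i) \<in> ivecs d"
    and "rvec (\<lambda>i. b i - mv d n A (\<lambda>j. \<lfloor>x j\<rfloor>) i) = mvr d n A (\<lambda>j. frac (x j))"
proof -
  let ?m = "mv d n A (\<lambda>j. \<lfloor>x j\<rfloor>)"
  show "(\<lambda>i. b i - ?m i) \<in> ivecs d" using assms(1) by (simp add: ivecs_def mv_def)
  have "rvec (\<lambda>i. b i - ?m i) = (\<lambda>i. rvec b i - rvec ?m i)" by (simp add: rvec_def)
  then show "rvec (\<lambda>i. b i - ?m i) = mvr d n A (\<lambda>j. frac (x j))"
    by (simp add: assms(2) rvec_mv frac_def mvr_diff)
qed

text \<open>This is \<Delta>-normality of a single cone, with multiplicities attached to column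
  indices instead of vectors.\<close>

definition generated :: "nat set \<Rightarrow> bool" where
  "generated \<sigma> \<longleftrightarrow> (\<forall>b\<in>ivecs d. rvec b \<in> cone \<sigma> \<longrightarrow>
     (\<exists>u. mv d n A (\<lambda>j. int (u j)) = b \<and> (\<forall>j. u j \<noteq> 0 \<longrightarrow> j < n \<and> rcol j \<in> cone \<sigma>)))"

text \<open>If 0 is the only lattice point of the half open parallelepiped, then
  \<open>\<sigma>\<close> is unimodular: lattice points of the cone have integral coordinates, and
  the columns of \<open>\<sigma>\<close> alone suffice.\<close>

lemma generated_if_no_fractional_point:
  assumes "\<sigma> \<subseteq> {..<n}"
    and zero: "\<And>\<phi> b. \<lbrakk>\<And>t. 0 \<le> \<phi> t; \<And>t. \<phi> t < 1; \<And>t. t \<notin> \<sigma> \<Longrightarrow> \<phi> t = 0;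
      b \<in> ivecs d; rvec b = mvr d n A \<phi>\<rbrakk> \<Longrightarrow> \<phi> = (\<lambda>t. 0)"
  shows "generated \<sigma>"
  unfolding generated_def
proof (intro ballI impI)
  fix b assume b: "b \<in> ivecs d" "rvec b \<in> cone \<sigma>"
  then obtain x where x: "rvec b = mvr d n A x" "\<And>j. 0 \<le> x j" "\<And>j. j \<notin> \<sigma> \<Longrightarrow> x j = 0"
    using cone_ofE by blast
  have "(\<lambda>j. frac (x j)) = (\<lambda>t. 0)"
    by (rule zero[OF _ _ _ fractional_part[OF b(1) x(1)]]) (use x in \<open>auto simp: frac_lt_1\<close>)
  then have fx: "real (nat \<lfloor>x j\<rfloor>) = x j" for j
    using x(2)[of j] by (simp add: fun_eq_iff frac_def)
  have "rvec (mv d n A (\<lambda>j. int (nat \<lfloor>x j\<rfloor>))) = rvec b"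
    unfolding rvec_mv x(1) of_int_of_nat_eq fx ..
  then have "mv d n A (\<lambda>j. int (nat \<lfloor>x j\<rfloor>)) = b" by (simp only: rvec_inject)
  moreover have "j < n \<and> rcol j \<in> cone \<sigma>" if "nat \<lfloor>x j\<rfloor> \<noteq> 0" for j
  proof -
    have "j \<in> \<sigma>" using x(3)[of j] that by (cases "j \<in> \<sigma>") auto
    then show ?thesis using assms(1) col_in_cone by blast
  qed
  ultimately show "\<exists>u. mv d n A (\<lambda>j. int (u j)) = b \<and>
      (\<forall>j. u j \<noteq> 0 \<longrightarrow> j < n \<and> rcol j \<in> cone \<sigma>)"
    by (intro exI[of _ "\<lambda>j. nat \<lfloor>x j\<rfloor>"]) auto
qed

text \<open>The ratio test of the simplex method: column \<open>l\<close> replaces the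
  \<open>t\<close> that minimises \<open>x t / \<mu> t\<close> among positive
  \<open>\<mu> t\<close>, which keeps the coordinates of \<open>v\<close> nonnegative. Column
  \<open>t\<close> really leaves the cone, since otherwise \<open>l\<close> would lie on its ray.
  This strict loss is what makes a recursion terminate.\<close>

lemma stellar_subdivision:
  assumes \<sigma>: "\<sigma> \<subseteq> {..<n}" "lin_indep_cols d n A \<sigma>"
    and l: "l < n" "l \<notin> \<sigma>" "rcol l \<in> cone \<sigma>"
    and v: "v \<in> cone \<sigma>"
  shows "\<exists>t\<in>\<sigma>. lin_indep_cols d n A (insert l (\<sigma> - {t})) \<and> v \<in> cone (insert l (\<sigma> - {t})) \<and>
    cone (insert l (\<sigma> - {t})) \<subseteq> cone \<sigma> \<and>
    rcol t \<notin> cone (insert l (\<sigma> - {t}))"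
proof -
  have fin: "finite \<sigma>" using \<sigma> finite_subset by blast
  obtain \<mu> where \<mu>: "rcol l = mvr d n A \<mu>" "\<And>j. 0 \<le> \<mu> j" "\<And>j. j \<notin> \<sigma> \<Longrightarrow> \<mu> j = 0"
    using l(3) cone_ofE by blast
  obtain x where x: "v = mvr d n A x" "\<And>j. 0 \<le> x j" "\<And>j. j \<notin> \<sigma> \<Longrightarrow> x j = 0"
    using v cone_ofE by blast
  define T where "T = {t \<in> \<sigma>. 0 < \<mu> t}"
  have T: "finite T" using fin by (simp add: T_def)
  have "T \<noteq> {}"
  proof
    assume "T = {}"
    then have "\<mu> = (\<lambda>t. 0)" using \<mu>(2,3) by (auto simp: T_def fun_eq_iff) (metis less_le)
    then have "rcol l = rvec (\<lambda>i. 0)" using \<mu>(1) by (simp add: rvec_def)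
    then show False using col_nonzero[OF l(1)] by (simp only: rvec_inject)
  qed
  then obtain t where t: "t \<in> T" "\<And>s. s \<in> T \<Longrightarrow> x t / \<mu> t \<le> x s / \<mu> s"
    using ex_min_if_finite[of "(\<lambda>s. x s / \<mu> s) ` T"] T by (fastforce simp: not_less)
  have t\<sigma>: "t \<in> \<sigma>" and \<mu>t: "0 < \<mu> t" using t(1) by (auto simp: T_def)
  let ?\<tau> = "insert l (\<sigma> - {t})"
  have conv: "mvr d n A z = mvr d n A (\<lambda>s. (if s = l then 0 else z s) + z l * \<mu> s)" for z
  proof -
    have z: "z = (\<lambda>s. (if s = l then 0 else z s) + z l * unit_vec l s)" by (auto simp: unit_vec_def)
    have "mvr d n A z = mvr d n A (\<lambda>s. (if s = l then 0 else z s) + z l * unit_vec l s)"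
      using z by (rule arg_cong)
    then show ?thesis unfolding mvr_add mvr_scale mvr_unit[OF l(1)] \<mu>(1) .
  qed
  have "lin_indep_cols d n A ?\<tau>"
    unfolding lin_indep_cols_def
  proof (intro allI impI ballI)
    fix z j assume z: "(\<forall>j. j \<notin> ?\<tau> \<longrightarrow> z j = 0) \<and> mvr d n A z = (\<lambda>i. 0)" and j: "j \<in> ?\<tau>"
    have 0: "(if s = l then 0 else z s) + z l * \<mu> s = 0" for s
      by (rule lin_indep_zero[OF \<sigma>(2)]) (use z \<mu>(3) conv[of z] in auto)
    have "t \<noteq> l" using t\<sigma> l by auto
    with 0[of t] z \<mu>t have "z l = 0" by auto
    with 0[of j] show "z j = 0" by (cases "j = l") auto
  qed
  moreover have "v \<in> cone ?\<tau>"
  proof -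
    \<comment> \<open>The minimal ratio becomes the coordinate of \<open>v\<close> at
      \<open>l\<close>; minimality says exactly that \<open>x s - r * \<mu> s\<close> stays
      nonnegative.\<close>
    define r where "r = x t / \<mu> t"
    have r: "0 \<le> r" using x(2) \<mu>t by (simp add: r_def)
    have rle: "r * \<mu> s \<le> x s" for s
    proof (cases "s \<in> T")
      case True
      then show ?thesis using t(2)[of s] by (simp add: r_def[symmetric] T_def pos_le_divide_eq)
    next
      case False
      then have "\<mu> s = 0" using \<mu>(2)[of s] \<mu>(3)[of s] by (auto simp: T_def)
      then show ?thesis using x(2) by simp
    qed
    define z where "z s = (if s = l then r else x s - r * \<mu> s)" for s
    have "(\<lambda>s. (if s = l then 0 else z s) + z l * \<mu> s) = x"
      using l \<mu>(3)[of l] x(3)[of l] by (auto simp: z_def)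
    then have "v = mvr d n A z" using conv[of z] x(1) by simp
    moreover have "0 \<le> z s" for s using r rle by (simp add: z_def)
    moreover have "z s = 0" if "s \<notin> ?\<tau>" for s
      using that x(3) \<mu>(3) \<mu>t by (cases "s = t") (auto simp: z_def r_def)
    ultimately show ?thesis by (rule cone_ofI)
  qed
  moreover have "cone ?\<tau> \<subseteq> cone \<sigma>"
  proof
    fix w assume "w \<in> cone ?\<tau>"
    then obtain z where z: "w = mvr d n A z" "\<And>j. 0 \<le> z j" "\<And>j. j \<notin> ?\<tau> \<Longrightarrow> z j = 0"
      using cone_ofE by blast
    show "w \<in> cone \<sigma>"
      by (rule cone_ofI[of _ _ _ _ "\<lambda>s. (if s = l then 0 else z s) + z l * \<mu> s"])
        (use z \<mu> conv[of z] in auto)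
  qed
  moreover have "rcol t \<notin> cone ?\<tau>"
  proof
    assume "rcol t \<in> cone ?\<tau>"
    then obtain z where z: "rcol t = mvr d n A z" "\<And>j. 0 \<le> z j" "\<And>j. j \<notin> ?\<tau> \<Longrightarrow> z j = 0"
      using cone_ofE by blast
    have tn: "t < n" "t \<noteq> l" using t\<sigma> \<sigma> l by auto
    have "unit_vec t = (\<lambda>s. (if s = l then 0 else z s) + z l * \<mu> s)"
    proof (rule lin_indep_unique[OF \<sigma>(2)])
      show "mvr d n A (unit_vec t) = mvr d n A (\<lambda>s. (if s = l then 0 else z s) + z l * \<mu> s)"
        using conv[of z] z(1) tn by (simp add: mvr_unit)
      show "unit_vec t j = (0::real)" if "j \<notin> \<sigma>" for j using that t\<sigma> by (auto simp: unit_vec_def)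
    qed (use z \<mu> in auto)
    then have eq: "unit_vec t s = (if s = l then 0 else z s) + z l * \<mu> s" for s by (rule fun_cong)
    have "z t = 0" using z(3)[of t] tn by auto
    then have "z l * \<mu> t = 1" using eq[of t] tn by simp
    then have zl: "0 < z l" using \<mu>t by (metis zero_less_mult_pos2 zero_less_one)
    have "\<mu> s = 0" if "s \<noteq> t" for s
    proof (cases "s = l")
      case False
      have "0 \<le> z l * \<mu> s" using zl \<mu>(2)[of s] by simp
      then have "z l * \<mu> s = 0" using eq[of s] that z(2)[of s] False by (simp del: mult_eq_0_iff)
      then show ?thesis using zl by simp
    qed (use \<mu>(3) l in simp)
    then have "\<mu> = (\<lambda>s. \<mu> t * unit_vec t s)" by (auto simp: unit_vec_def)
    then have "mvr d n A \<mu> = mvr d n A (\<lambda>s. \<mu> t * unit_vec t s)" by (rule arg_cong)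
    then have "rcol l = (\<lambda>i. \<mu> t * rcol t i)"
      unfolding mvr_scale mvr_unit[OF tn(1)] \<mu>(1) .
    then show False using columns_not_parallel l(1) tn \<mu>t by blast
  qed
  ultimately show ?thesis using t\<sigma> by blast
qed

text \<open>Induction on the number of columns inside the cone. Only the subcone containing the
  given \<open>b\<close> is followed, so no complete subdivision has to be constructed.\<close>

lemma generated_by_subdivision:
  assumes empty: "\<And>\<sigma>. \<lbrakk>\<sigma> \<subseteq> {..<n}; lin_indep_cols d n A \<sigma>; card \<sigma> = d;
      \<And>j. j < n \<Longrightarrow> rcol j \<in> cone \<sigma> \<Longrightarrow> j \<in> \<sigma>\<rbrakk> \<Longrightarrow> generated \<sigma>"
    and "\<sigma> \<subseteq> {..<n}" "lin_indep_cols d n A \<sigma>" "card \<sigma> = d"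
  shows "generated \<sigma>"
  using assms(2-)
proof (induction "card {j. j < n \<and> rcol j \<in> cone \<sigma>}" arbitrary: \<sigma> rule: less_induct)
  case less
  let ?C = "\<lambda>\<sigma>. {j. j < n \<and> rcol j \<in> cone \<sigma>}"
  show ?case
  proof (cases "\<forall>j<n. rcol j \<in> cone \<sigma> \<longrightarrow> j \<in> \<sigma>")
    case True
    then show ?thesis using empty less.prems by blast
  next
    case False
    then obtain l where l: "l < n" "l \<notin> \<sigma>" "rcol l \<in> cone \<sigma>" by blast
    show ?thesis
      unfolding generated_def
    proof (intro ballI impI)
      fix b assume b: "b \<in> ivecs d" "rvec b \<in> cone \<sigma>"
      obtain t where t: "t \<in> \<sigma>" "lin_indep_cols d n A (insert l (\<sigma> - {t}))"
        "rvec b \<in> cone (insert l (\<sigma> - {t}))"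
        "cone (insert l (\<sigma> - {t})) \<subseteq> cone \<sigma>"
        "rcol t \<notin> cone (insert l (\<sigma> - {t}))"
        using stellar_subdivision[OF less.prems(1,2) l b(2)] by blast
      let ?\<tau> = "insert l (\<sigma> - {t})"
      have fin: "finite \<sigma>" using less.prems(1) finite_subset by blast
      have "t < n" using t(1) less.prems(1) by auto
      then have "t \<in> ?C \<sigma>" using t(1) col_in_cone by blast
      moreover have "t \<notin> ?C ?\<tau>" using t(5) by blast
      moreover have "?C ?\<tau> \<subseteq> ?C \<sigma>" using t(4) by blast
      ultimately have "?C ?\<tau> \<subset> ?C \<sigma>" by blast
      then have "card (?C ?\<tau>) < card (?C \<sigma>)" by (intro psubset_card_mono) auto
      moreover have "?\<tau> \<subseteq> {..<n}" using less.prems(1) l by auto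
      moreover have "card ?\<tau> = d"
        using fin l(2) less.prems(3) card_Suc_Diff1[OF fin t(1)] by (subst card_insert_disjoint) auto
      ultimately have "generated ?\<tau>" using less.hyps t(2) by blast
      then obtain u where "mv d n A (\<lambda>j. int (u j)) = b"
        "\<And>j. u j \<noteq> 0 \<Longrightarrow> j < n \<and> rcol j \<in> cone ?\<tau>"
        unfolding generated_def using b(1) t(3) by blast
      then show "\<exists>u. mv d n A (\<lambda>j. int (u j)) = b \<and>
          (\<forall>j. u j \<noteq> 0 \<longrightarrow> j < n \<and> rcol j \<in> cone \<sigma>)"
        using t(4) by blast
    qed
  qed
qed

subsection \<open>Empty simplicial cones in low dimension\<close>

lemma generated_dim1:
  assumes "d = 1" "\<sigma> \<subseteq> {..<n}" "card \<sigma> = d"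
  shows "generated \<sigma>"
proof (rule generated_if_no_fractional_point[OF assms(2)])
  fix \<phi> b
  assume \<phi>: "\<And>t. 0 \<le> \<phi> t" "\<And>t. \<phi> t < 1" "\<And>t. t \<notin> \<sigma> \<Longrightarrow> \<phi> t = 0"
    and b: "b \<in> ivecs d" "rvec b = mvr d n A \<phi>"
  obtain t where t: "\<sigma> = {t}" using assms(1,3) card_1_singletonE by metis
  then have tn: "t < n" using assms(2) by auto
  have eq: "\<phi> = (\<lambda>s. \<phi> t * unit_vec t s)" using \<phi>(3) t by (auto simp: unit_vec_def)
  have "mvr d n A \<phi> = mvr d n A (\<lambda>s. \<phi> t * unit_vec t s)" using eq by (rule arg_cong)
  then have "rvec b = (\<lambda>i. \<phi> t * rcol t i)"
    unfolding b(2) mvr_scale mvr_unit[OF tn] .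
  then have "\<phi> t = 0" using ray_primitive[OF tn _ _ b(1)] \<phi> by blast
  then show "\<phi> = (\<lambda>t. 0)" using eq by simp
qed

text \<open>By normality \<open>b\<close> is a sum of columns, and each column has height 1. The
  height of \<open>b\<close> therefore counts the summands, and a single summand is a
  column.\<close>

lemma graded_lattice_point:
  assumes w: "\<And>j. j < n \<Longrightarrow> dotcol d A w j = 1"
    and b: "b \<in> ivecs d" "rvec b = mvr d n A x" "\<And>t. 0 \<le> x t"
    and \<sigma>: "\<sigma> \<subseteq> {..<n}" "\<And>t. t \<notin> \<sigma> \<Longrightarrow> x t = 0"
  shows "\<exists>k. (\<Sum>t\<in>\<sigma>. x t) = real k \<and> (k = 1 \<longrightarrow> (\<exists>j<n. b = col d A j))"
proof -
  have "rvec b \<in> coneA d n A" unfolding b(2) by (intro mvr_in_coneA) (rule b(3))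
  then obtain m where m: "b = mv d n A (\<lambda>j. int (m j))" using b(1) lattice_point_nat by blast
  have "(\<Sum>i<d. w i * rvec b i) = (\<Sum>j<n. real (m j))" unfolding m rvec_mv dot_mvr by (simp add: w)
  moreover have "(\<Sum>i<d. w i * rvec b i) = (\<Sum>t<n. x t)" unfolding b(2) dot_mvr by (simp add: w)
  moreover have "(\<Sum>t<n. x t) = (\<Sum>t\<in>\<sigma>. x t)" using \<sigma> by (intro sum.mono_neutral_right) auto
  ultimately have "(\<Sum>t\<in>\<sigma>. x t) = real (\<Sum>j<n. m j)" by simp
  moreover have "\<exists>j<n. b = col d A j" if s1: "(\<Sum>j<n. m j) = 1"
  proof -
    obtain k where k: "k < n" "m k = 1" "\<And>j. j < n \<Longrightarrow> j \<noteq> k \<Longrightarrow> m j = 0"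
      using sum_eq_1_iff[of "{..<n}" m] s1 by auto
    then have "mv d n A (\<lambda>j. int (m j)) = mv d n A (unit_vec k)"
      by (intro mv_cong) (auto simp: unit_vec_def)
    then show ?thesis using k m mv_unit by metis
  qed
  ultimately show ?thesis by blast
qed

text \<open>The lattice point \<open>b\<close> lies in the parallelepiped of \<open>\<sigma>\<close>, so its height is less than 3; when it is 2, the
  opposite point of the parallelepiped has height 1.\<close>

lemma generated_graded3_empty:
  assumes d3: "d = 3" and w: "\<And>j. j < n \<Longrightarrow> dotcol d A w j = 1"
    and \<sigma>: "\<sigma> \<subseteq> {..<n}" "lin_indep_cols d n A \<sigma>" "card \<sigma> = d"
    and empty: "\<And>j. j < n \<Longrightarrow> rcol j \<in> cone \<sigma> \<Longrightarrow> j \<in> \<sigma>"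
  shows "generated \<sigma>"
proof (rule generated_if_no_fractional_point[OF \<sigma>(1)])
  fix \<phi> b
  assume \<phi>: "\<And>t. 0 \<le> \<phi> t" "\<And>t. \<phi> t < 1" "\<And>t. t \<notin> \<sigma> \<Longrightarrow> \<phi> t = 0"
    and b: "b \<in> ivecs d" "rvec b = mvr d n A \<phi>"
  have fin: "finite \<sigma>" using \<sigma>(1) finite_subset by blast
  \<comment> \<open>A lattice point of height 1 in the cone is a column; emptiness makes it a vertex
    of \<open>\<sigma>\<close>, and independence then makes its coordinates a unit vector.\<close>
  have no_height1: False
    if x: "\<And>t. 0 \<le> x t" "\<And>t. t \<notin> \<sigma> \<Longrightarrow> x t = 0" "b' \<in> ivecs d" "rvec b' = mvr d n A x" "(\<Sum>t\<in>\<sigma>. x t) = 1"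
      and unit: "\<And>k. k \<in> \<sigma> \<Longrightarrow> x \<noteq> unit_vec k" for x b'
  proof -
    have inc: "rvec b' \<in> cone \<sigma>" using x by (intro cone_ofI[of _ _ _ _ x])
    obtain k where k: "k < n" and bk: "b' = col d A k"
      using graded_lattice_point[OF w x(3,4,1) \<sigma>(1) x(2)] x(5) by auto
    have "k \<in> \<sigma>" using empty k inc bk by blast
    moreover have "x = unit_vec k"
    proof (rule lin_indep_unique[OF \<sigma>(2)])
      show "mvr d n A x = mvr d n A (unit_vec k)" using x(4) bk k by (simp add: mvr_unit)
      show "unit_vec k j = (0::real)" if "j \<notin> \<sigma>" for j
        using that \<open>k \<in> \<sigma>\<close> by (auto simp: unit_vec_def)
    qed (rule x(2))
    ultimately show False using unit by blast
  qed
  obtain k where hm: "(\<Sum>t\<in>\<sigma>. \<phi> t) = real k"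
    using graded_lattice_point[OF w b \<phi>(1) \<sigma>(1) \<phi>(3)] by blast
  have "\<sigma> \<noteq> {}" using \<sigma>(3) d3 by auto
  then have "(\<Sum>t\<in>\<sigma>. \<phi> t) < (\<Sum>t\<in>\<sigma>. 1)" using fin \<phi>(2) by (intro sum_strict_mono) auto
  then have "(\<Sum>t\<in>\<sigma>. \<phi> t) < 3" using \<sigma>(3) d3 by simp
  then have "k < 3" using hm by linarith
  then consider "k = 0" | "k = 1" | "k = 2" by linarith
  then show "\<phi> = (\<lambda>t. 0)"
  proof cases
    case 1
    then have "(\<Sum>t\<in>\<sigma>. \<phi> t) = 0" using hm by simp
    then have "\<forall>t\<in>\<sigma>. \<phi> t = 0" using fin \<phi>(1) by (simp add: sum_nonneg_eq_0_iff)
    then show ?thesis using \<phi>(3) by blast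
  next
    case 2
    then have "(\<Sum>t\<in>\<sigma>. \<phi> t) = 1" using hm by simp
    moreover have "\<phi> \<noteq> unit_vec k" for k using \<phi>(2)[of k] by auto
    ultimately show ?thesis using no_height1[of \<phi> b] \<phi> b by blast
  next
    case 3
    define x where "x t = (if t \<in> \<sigma> then 1 - \<phi> t else 0)" for t
    define b' where "b' = (\<lambda>i. mv d n A (\<lambda>t. if t \<in> \<sigma> then 1 else 0) i - b i)"
    have "(\<lambda>t. (if t \<in> \<sigma> then 1 else 0) - \<phi> t) = x" using \<phi>(3) by (auto simp: x_def)
    moreover have "rvec b' = (\<lambda>i. rvec (mv d n A (\<lambda>t. if t \<in> \<sigma> then 1 else 0)) i - rvec b i)"
      by (simp add: b'_def rvec_def)
    ultimately have "rvec b' = mvr d n A x"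
      unfolding rvec_mv b(2) mvr_diff[symmetric] by (simp add: if_distrib[of real_of_int] cong: if_cong)
    moreover have "(\<Sum>t\<in>\<sigma>. x t) = 1"
      using hm 3 fin \<sigma>(3) d3 by (simp add: x_def sum_subtractf)
    moreover have "x \<noteq> unit_vec k" if "k \<in> \<sigma>" for k
    proof
      assume eq: "x = unit_vec k"
      obtain t where t: "t \<in> \<sigma>" "t \<noteq> k"
      proof -
        have "\<sigma> \<noteq> {k}" using \<sigma>(3) d3 by auto
        then show ?thesis using that \<open>k \<in> \<sigma>\<close> by blast
      qed
      then have "x t = 0" using eq by simp
      then show False using t \<phi>(2)[of t] by (simp add: x_def)
    qed
    moreover have "b' \<in> ivecs d" using b(1) by (simp add: b'_def ivecs_def mv_def)
    moreover have "0 \<le> x t" for t using \<phi>(2)[of t] by (simp add: x_def)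
    ultimately show ?thesis using no_height1[of x b'] by (auto simp: x_def)
  qed
qed

text \<open>The difference is a lattice point of the cone, hence itself a sum of columns. Together
  with \<open>M\<close> it represents column \<open>t\<close>, and that representation is
  unique.\<close>

lemma col_dominates:
  assumes t: "t < n" and r: "(\<lambda>i. rcol t i - rvec (mv d n A (\<lambda>j. int (M j))) i) \<in> coneA d n A"
    and "j < n"
  shows "M j \<le> unit_vec t j"
proof -
  let ?b = "\<lambda>i. col d A t i - mv d n A (\<lambda>j. int (M j)) i"
  have "rvec ?b = (\<lambda>i. rcol t i - rvec (mv d n A (\<lambda>j. int (M j))) i)" by (simp add: rvec_def)
  then have "rvec ?b \<in> coneA d n A" using r by simp
  moreover have "?b \<in> ivecs d" by (auto simp: ivecs_def col_def mv_def)
  ultimately obtain u where u: "?b = mv d n A (\<lambda>j. int (u j))" using lattice_point_nat by blast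
  have "mv d n A (\<lambda>j. int (M j + u j)) = col d A t"
    unfolding of_nat_add mv_add u[symmetric] by simp
  from col_fiber_unique[OF this t \<open>j < n\<close>] show ?thesis by linarith
qed

text \<open>In the plane, write a point of the half open parallelogram as \<open>P + Q\<close> with \<open>P\<close> and \<open>Q\<close> sums of columns
  on the two sides of an empty cone. Then both edges of the cone lie in the cone of \<open>P\<close> and \<open>Q\<close>, and
  irreducibility of the edges forces \<open>P\<close> or \<open>Q\<close> to be an edge.\<close>

lemma generated_dim2_empty:
  assumes d2: "d = 2"
    and \<sigma>: "\<sigma> \<subseteq> {..<n}" "lin_indep_cols d n A \<sigma>" "card \<sigma> = d"
    and empty: "\<And>j. j < n \<Longrightarrow> rcol j \<in> cone \<sigma> \<Longrightarrow> j \<in> \<sigma>"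
  shows "generated \<sigma>"
proof (rule generated_if_no_fractional_point[OF \<sigma>(1)])
  fix \<phi> b
  assume \<phi>: "\<And>t. 0 \<le> \<phi> t" "\<And>t. \<phi> t < 1" "\<And>t. t \<notin> \<sigma> \<Longrightarrow> \<phi> t = 0"
    and b: "b \<in> ivecs d" "rvec b = mvr d n A \<phi>"
  obtain p q where pq: "\<sigma> = {p, q}" "p \<noteq> q" using \<sigma>(3) d2 card_2_iff[of \<sigma>] by auto
  have pn: "p < n" and qn: "q < n" using pq \<sigma>(1) by auto
  let ?p = "rcol p" and ?q = "rcol q"
  have comb: "mvr d n A x = (\<lambda>i. x p * ?p i + x q * ?q i)" if "\<And>s. s \<notin> \<sigma> \<Longrightarrow> x s = 0" for x
  proof -
    have "x = (\<lambda>s. x p * unit_vec p s + x q * unit_vec q s)"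
      using that pq by (auto simp: unit_vec_def)
    then have "mvr d n A x = mvr d n A (\<lambda>s. x p * unit_vec p s + x q * unit_vec q s)" by (rule arg_cong)
    then show ?thesis unfolding mvr_add mvr_scale mvr_unit[OF pn] mvr_unit[OF qn] .
  qed
  have uniq: "x = x' \<and> y = y'"
    if "\<And>i. x * ?p i + y * ?q i = x' * ?p i + y' * ?q i" for x y x' y'
  proof -
    let ?f = "\<lambda>x y s. if s = p then x else if s = q then y else (0::real)"
    have "?f x y = ?f x' y'"
    proof (rule lin_indep_unique[OF \<sigma>(2)])
      show "mvr d n A (?f x y) = mvr d n A (?f x' y')"
        using comb[of "?f x y"] comb[of "?f x' y'"] that pq by auto
    qed (use pq in auto)
    from fun_cong[OF this, of p] fun_cong[OF this, of q] show ?thesis using pq by auto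
  qed
  have "\<exists>x. (\<forall>s. s \<notin> \<sigma> \<longrightarrow> x s = 0) \<and> mvr d n A x = rcol j" for j
    by (rule basis_coordinates[OF \<sigma>(2,1,3)]) (simp add: rvec_def col_def)
  then obtain X where X: "\<And>j s. s \<notin> \<sigma> \<Longrightarrow> X j s = 0" "\<And>j. mvr d n A (X j) = rcol j"
    by metis
  define \<alpha> where "\<alpha> j = X j p" for j
  define \<beta> where "\<beta> j = X j q" for j
  have colj: "rcol j i = \<alpha> j * ?p i + \<beta> j * ?q i" for i j
    using comb[of "X j"] X by (simp add: \<alpha>_def \<beta>_def)
  have pcoord: "\<alpha> p = 1" "\<beta> p = 0" using uniq[of 1 0 "\<alpha> p" "\<beta> p"] colj[of p] by auto
  have qcoord: "\<alpha> q = 0" "\<beta> q = 1" using uniq[of 0 1 "\<alpha> q" "\<beta> q"] colj[of q] by auto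
  have npos: "0 < \<alpha> j \<or> 0 < \<beta> j" if "j < n" for j
  proof (rule ccontr)
    assume "\<not> ?thesis"
    then have le: "X j s \<le> 0" for s
      using X(1)[of s j] pq by (cases "s \<in> \<sigma>") (auto simp: \<alpha>_def \<beta>_def)
    have "mvr d n A (\<lambda>s. unit_vec j s - X j s) = (\<lambda>i. 0)"
      unfolding mvr_diff using X(2) mvr_unit[OF that] by simp
    moreover have "0 \<le> unit_vec j s - X j s" for s
    proof -
      have "0 \<le> (unit_vec j s :: real)" by simp
      then show ?thesis using le[of s] by linarith
    qed
    ultimately have "unit_vec j j - X j j = 0" using kernel that by blast
    then show False using le[of j] by simp
  qed
  have inside: "j = p \<or> j = q" if "j < n" "0 \<le> \<alpha> j" "0 \<le> \<beta> j" for j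
  proof -
    have "0 \<le> X j s" for s using X(1)[of s j] pq that by (cases "s \<in> \<sigma>") (auto simp: \<alpha>_def \<beta>_def)
    then have "rcol j \<in> cone \<sigma>"
      using X by (intro cone_ofI[of _ _ _ _ "X j"]) auto
    then show ?thesis using empty that pq by auto
  qed
  \<comment> \<open>Reflection in the centre of the parallelogram reduces to
    \<open>\<kappa> + \<mu> \<le> 1\<close>. This bound enters the comparison of \<open>K\<close>
    with \<open>bQ\<close> and \<open>aP\<close> below.\<close>
  have impossible: False
    if lm: "0 < \<kappa>" "\<kappa> < 1" "0 < \<mu>" "\<mu> < 1" "\<kappa> + \<mu> \<le> 1"
      and b': "b' \<in> ivecs d" "\<And>i. rvec b' i = \<kappa> * ?p i + \<mu> * ?q i" for \<kappa> \<mu> b'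
  proof -
    let ?f = "\<lambda>s. if s = p then \<kappa> else if s = q then \<mu> else 0"
    have "rvec b' = mvr d n A ?f" using comb[of ?f] b'(2) pq by auto
    then have "rvec b' \<in> coneA d n A" using lm by (simp add: mvr_in_coneA)
    then obtain m where m: "b' = mv d n A (\<lambda>j. int (m j))" using b'(1) lattice_point_nat by blast
    \<comment> \<open>The columns on the side of \<open>p\<close>. Emptiness of the cone makes
      \<open>\<alpha>\<close> nonpositive on all remaining columns, so the sums \<open>P\<close>
      over \<open>J\<close> and \<open>Q\<close> over the rest satisfy \<open>bP \<le> 0\<close> and
      \<open>aQ \<le> 0\<close>.\<close>
    define J where "J = {j. \<beta> j \<le> 0}"
    define mP where "mP j = (if j \<in> J then m j else 0)" for j
    define mQ where "mQ j = (if j \<in> J then 0 else m j)" for j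
    define aP where "aP = (\<Sum>j<n. real (mP j) * \<alpha> j)"
    define bP where "bP = (\<Sum>j<n. real (mP j) * \<beta> j)"
    define aQ where "aQ = (\<Sum>j<n. real (mQ j) * \<alpha> j)"
    define bQ where "bQ = (\<Sum>j<n. real (mQ j) * \<beta> j)"
    have expand: "rvec (mv d n A (\<lambda>j. int (M j))) i
        = (\<Sum>j<n. real (M j) * \<alpha> j) * ?p i + (\<Sum>j<n. real (M j) * \<beta> j) * ?q i" for M i
    proof -
      have "rvec (mv d n A (\<lambda>j. int (M j))) i = (\<Sum>j<n. real (M j) * rcol j i)"
        by (simp add: rvec_def mv_def col_def mult.commute)
      also have "\<dots> = (\<Sum>j<n. real (M j) * \<alpha> j * ?p i + real (M j) * \<beta> j * ?q i)"
        by (intro sum.cong refl, subst colj) (simp add: distrib_left)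
      finally show ?thesis by (simp add: sum.distrib sum_distrib_right)
    qed
    let ?P = "rvec (mv d n A (\<lambda>j. int (mP j)))" and ?Q = "rvec (mv d n A (\<lambda>j. int (mQ j)))"
    have P: "?P i = aP * ?p i + bP * ?q i" and Q: "?Q i = aQ * ?p i + bQ * ?q i" for i
      unfolding expand aP_def bP_def aQ_def bQ_def by auto
    have "rvec b' i = ?P i + ?Q i" for i
    proof -
      have "(\<lambda>j. int (m j)) = (\<lambda>j. int (mP j) + int (mQ j))" by (auto simp: mP_def mQ_def)
      then have "b' = mv d n A (\<lambda>j. int (mP j) + int (mQ j))" using m by simp
      then show ?thesis by (simp add: mv_add rvec_def)
    qed
    then have "\<kappa> * ?p i + \<mu> * ?q i = (aP + aQ) * ?p i + (bP + bQ) * ?q i" for i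
      using P[of i] Q[of i] b'(2)[of i] by (simp add: algebra_simps)
    from uniq[OF this] have sums: "aP + aQ = \<kappa>" "bP + bQ = \<mu>" by simp_all
    have bP: "bP \<le> 0" unfolding bP_def
      by (intro sum_nonpos) (auto simp: mP_def J_def mult_nonneg_nonpos)
    have aQ: "aQ \<le> 0" unfolding aQ_def
    proof (intro sum_nonpos)
      fix j assume j: "j \<in> {..<n}"
      show "real (mQ j) * \<alpha> j \<le> 0"
      proof (cases "j \<in> J")
        case False
        then have "0 < \<beta> j" by (simp add: J_def)
        then have "\<alpha> j \<le> 0" using inside[of j] j pcoord qcoord by force
        then show ?thesis by (simp add: mult_nonneg_nonpos)
      qed (simp add: mQ_def)
    qed
    have aPpos: "0 < aP" and bQpos: "0 < bQ" using sums lm bP aQ by auto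
    \<comment> \<open>The determinant of \<open>P\<close> and \<open>Q\<close> in the basis
      \<open>p\<close>, \<open>q\<close>; the signs of \<open>bP\<close> and \<open>aQ\<close> make
      it positive.\<close>
    define K where "K = aP * bQ - bP * aQ"
    have K_eq: "K = \<kappa> * \<mu> + \<kappa> * (- bP) + (- aQ) * \<mu>"
      unfolding K_def sums[symmetric] by (simp add: algebra_simps)
    have "0 < \<kappa> * \<mu>" "0 \<le> \<kappa> * (- bP)" "0 \<le> (- aQ) * \<mu>"
      using lm bP aQ by (simp_all add: mult_nonneg_nonpos mult_nonpos_nonneg)
    then have Kpos: "0 < K" unfolding K_eq by linarith
    \<comment> \<open>Cramer's rule: \<open>K\<close> times column \<open>t\<close> equals
      \<open>b'\<close> times the sum of \<open>M\<close> minus \<open>b\<close> times the sum of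
      \<open>M'\<close>. When \<open>K \<le> b'\<close> and \<open>b \<le> 0\<close>, subtracting
      the sum of \<open>M\<close> from column \<open>t\<close> still leaves a point of the cone, so
      irreducibility of the column bounds \<open>M\<close>.\<close>
    have edge: "M j \<le> unit_vec t j"
      if "t < n" "j < n" and M: "\<And>i. rvec (mv d n A (\<lambda>j. int (M j))) i = a * rcol t i + b * s i"
        and M': "\<And>i. rvec (mv d n A (\<lambda>j. int (M' j))) i = a' * rcol t i + b' * s i"
        and K: "K = a * b' - b * a'" "K \<le> b'" "b \<le> 0" for t j M M' a b a' b' s
    proof -
      let ?z = "\<lambda>j. (b' - K) / K * real (M j) + (- b) / K * real (M' j)"
      have "(\<lambda>i. rcol t i - rvec (mv d n A (\<lambda>j. int (M j))) i) = mvr d n A ?z"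
      proof
        fix i
        have "mvr d n A ?z i = (b' - K) / K * rvec (mv d n A (\<lambda>j. int (M j))) i + (- b) / K * rvec (mv d n A (\<lambda>j. int (M' j))) i"
          unfolding mvr_add mvr_scale rvec_mv by simp
        also have "\<dots> = ((b' - K) * a - b * a') / K * rcol t i + ((b' - K) * b - b * b') / K * s i"
          unfolding M M' using Kpos by (simp add: field_simps)
        also have "(b' - K) * a - b * a' = K * (1 - a)" by (simp add: K(1) algebra_simps)
        also have "(b' - K) * b - b * b' = K * (- b)" by (simp add: algebra_simps)
        finally have eq: "mvr d n A ?z i = (1 - a) * rcol t i + (- b) * s i" using Kpos by simp
        show "rcol t i - rvec (mv d n A (\<lambda>j. int (M j))) i = mvr d n A ?z i"
          unfolding eq M by (simp add: algebra_simps)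
      qed
      also have "\<dots> \<in> coneA d n A" using K Kpos
        by (intro mvr_in_coneA add_nonneg_nonneg mult_nonneg_nonneg divide_nonneg_pos) auto
      finally show ?thesis using col_dominates[OF \<open>t < n\<close> _ \<open>j < n\<close>] by blast
    qed
    have single: "(\<Sum>j<n. real (M j) * f j) = real (M t) * f t"
      if t: "t < n" and dom: "\<And>j. j < n \<Longrightarrow> M j \<le> unit_vec t j" for M :: "nat \<Rightarrow> nat" and t f
    proof -
      have "M i = 0" if "i < n" "i \<noteq> t" for i using dom[OF that(1)] that(2) by simp
      then have "(\<Sum>j<n. real (M j) * f j) = (\<Sum>j\<in>{t}. real (M j) * f j)"
        using t by (intro sum.mono_neutral_right) auto
      then show ?thesis by simp
    qed
    have P_edge: "aP = 1 \<and> bP = 0" if "K \<le> bQ"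
    proof -
      have dom: "mP j \<le> unit_vec p j" if "j < n" for j
        by (rule edge[OF pn that P Q K_def \<open>K \<le> bQ\<close> bP])
      have "aP = real (mP p) * \<alpha> p" "bP = real (mP p) * \<beta> p"
        unfolding aP_def bP_def by (rule single[OF pn dom]; assumption)+
      then show ?thesis using pcoord dom[OF pn] aPpos by simp
    qed
    have Q_edge: "aQ = 0 \<and> bQ = 1" if "K \<le> aP"
    proof -
      have dom: "mQ j \<le> unit_vec q j" if "j < n" for j
        by (rule edge[OF qn that, of mQ bQ aQ ?p mP bP aP])
          (use \<open>K \<le> aP\<close> aQ in \<open>simp_all add: P Q K_def algebra_simps\<close>)
      have "aQ = real (mQ q) * \<alpha> q" "bQ = real (mQ q) * \<beta> q"
        unfolding aQ_def bQ_def by (rule single[OF qn dom]; assumption)+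
      then show ?thesis using qcoord dom[OF qn] bQpos by simp
    qed
    \<comment> \<open>If both inequalities failed, then \<open>bQ < - aQ\<close> and
      \<open>aP < - bP\<close>. Adding them contradicts that all four numbers sum to
      \<open>\<kappa> + \<mu> > 0\<close>.\<close>
    have "K \<le> bQ \<or> K \<le> aP"
    proof (rule ccontr)
      assume "\<not> ?thesis"
      then have gt: "bQ < K" "aP < K" by auto
      have "(1 - \<kappa>) * bQ < (- aQ) * \<mu>" using gt(1) unfolding K_eq sums(2)[symmetric] by (simp add: algebra_simps)
      moreover have "\<mu> * bQ \<le> (1 - \<kappa>) * bQ" using lm bQpos by (intro mult_right_mono) auto
      ultimately have "\<mu> * bQ < \<mu> * (- aQ)" by (simp add: mult.commute)
      then have 1: "bQ < - aQ" using lm(3) by (simp only: mult_less_cancel_left_pos)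
      have "(1 - \<mu>) * aP < \<kappa> * (- bP)" using gt(2) unfolding K_eq sums(1)[symmetric] by (simp add: algebra_simps)
      moreover have "\<kappa> * aP \<le> (1 - \<mu>) * aP" using lm aPpos by (intro mult_right_mono) auto
      ultimately have "\<kappa> * aP < \<kappa> * (- bP)" by linarith
      then have "aP < - bP" using lm(1) by (simp only: mult_less_cancel_left_pos)
      with 1 sums lm show False by linarith
    qed
    then show False
    proof
      \<comment> \<open>Here \<open>P\<close> is the edge \<open>p\<close>, so
        \<open>K = \<mu> < 1 = aP\<close>. Hence \<open>Q\<close> is an edge as well, which would
        give \<open>\<kappa> = 1\<close>. The other case is symmetric.\<close>
      assume "K \<le> bQ"
      then have 1: "aP = 1" "bP = 0" using P_edge by auto
      then have "K = \<mu>" using sums by (simp add: K_def)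
      then show False using Q_edge 1 lm sums by simp
    next
      assume "K \<le> aP"
      then have 1: "aQ = 0" "bQ = 1" using Q_edge by auto
      then have "K = \<kappa>" using sums by (simp add: K_def)
      then show False using P_edge 1 lm sums by simp
    qed
  qed
  have bi: "rvec b i = \<phi> p * ?p i + \<phi> q * ?q i" for i using comb[of \<phi>] \<phi>(3) b(2) by simp
  have "\<phi> p = 0 \<and> \<phi> q = 0"
  proof (cases "\<phi> p = 0 \<or> \<phi> q = 0")
    case True
    then show ?thesis
    proof
      assume 0: "\<phi> p = 0"
      then have "\<phi> q = 0" using bi \<phi> by (intro ray_primitive[OF qn _ _ b(1)]) auto
      with 0 show ?thesis by simp
    next
      assume 0: "\<phi> q = 0"
      then have "\<phi> p = 0" using bi \<phi> by (intro ray_primitive[OF pn _ _ b(1)]) auto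
      with 0 show ?thesis by simp
    qed
  next
    case False
    then have pos: "0 < \<phi> p" "0 < \<phi> q" using \<phi>(1)[of p] \<phi>(1)[of q] by auto
    show ?thesis
    proof (cases "\<phi> p + \<phi> q \<le> 1")
      case True
      then show ?thesis using impossible[OF pos(1) \<phi>(2) pos(2) \<phi>(2) True b(1) bi] by blast
    next
      case False
      let ?b = "\<lambda>i. col d A p i + col d A q i - b i"
      have "?b \<in> ivecs d" using b(1) by (auto simp: ivecs_def col_def)
      moreover have "rvec ?b i = (1 - \<phi> p) * ?p i + (1 - \<phi> q) * ?q i" for i
        using bi[of i] by (simp add: rvec_def algebra_simps)
      ultimately show ?thesis
        using impossible[of "1 - \<phi> p" "1 - \<phi> q" ?b] pos \<phi>(2)[of p] \<phi>(2)[of q] False by auto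
    qed
  qed
  then show "\<phi> = (\<lambda>t. 0)" using \<phi>(3) pq by (intro ext) (metis insertE singletonD)
qed

lemma graded_height:
  assumes "graded d n A"
  shows "\<exists>w. \<forall>j<n. dotcol d A w j = 1"
proof -
  obtain w \<gamma> where "\<gamma> \<noteq> 0" "\<forall>j<n. dotcol d A w j = \<gamma>" using assms unfolding graded_def by blast
  then have "\<forall>j<n. dotcol d A (\<lambda>i. (1 / \<gamma>) * w i) j = 1" by (subst dotcol_scale) simp
  then show ?thesis by blast
qed

lemma generated_low_dim:
  assumes "d = 1 \<or> d = 2 \<or> d = 3 \<and> graded d n A"
    and "\<sigma> \<subseteq> {..<n}" "lin_indep_cols d n A \<sigma>" "card \<sigma> = d"
  shows "generated \<sigma>"
proof -
  show ?thesis
    by (rule generated_by_subdivision[OF _ assms(2-4)])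
      (use assms(1) graded_height generated_dim1 generated_dim2_empty generated_graded3_empty in blast)
qed

end

context standing_matrix
begin

subsection \<open>Costs close to a piecewise linear function\<close>

lemma rvec_mv_coordinates:
  assumes "\<And>j. j < n \<Longrightarrow> z j \<noteq> 0 \<Longrightarrow> mvr d n A (L j) = rcol j"
  shows "mvr d n A (\<lambda>t. \<Sum>j<n. real_of_int (z j) * L j t) = rvec (mv d n A z)"
proof
  fix i
  have "mvr d n A (\<lambda>t. \<Sum>j<n. real_of_int (z j) * L j t) i = (\<Sum>j<n. real_of_int (z j) * mvr d n A (L j) i)"
    by (simp add: mvr_sum)
  also have "\<dots> = (\<Sum>j<n. real_of_int (z j) * rcol j i)"
    using assms by (intro sum.cong refl) (metis lessThan_iff mult_zero_left of_int_0)
  also have "\<dots> = rvec (mv d n A z) i" by (auto simp: rvec_def mv_def col_def mult.commute)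
  finally show "mvr d n A (\<lambda>t. \<Sum>j<n. real_of_int (z j) * L j t) i = rvec (mv d n A z) i" .
qed

text \<open>Among the columns of \<open>cone \<sigma>\<close> the reduced costs are nearly proportional to the sum of the coordinates
  in \<open>\<sigma>\<close>, and all other columns are expensive. A feasible point of the group relaxation with a negative
  entry exceeds the fractional part of \<open>b\<close> by at least 1 in this coordinate sum, so it is not optimal.\<close>

lemma gomory_core:
  assumes max: "max_face (delta d n A c) \<sigma>" and li: "lin_indep_cols d n A \<sigma>" and gen: "generated \<sigma>"
    and L: "\<And>j. j < n \<Longrightarrow> rcol j \<in> cone \<sigma> \<Longrightarrow> mvr d n A (L j) = rcol j"
      "\<And>j t. 0 \<le> L j t"
      "\<And>j t. j < n \<Longrightarrow> rcol j \<in> cone \<sigma> \<Longrightarrow> t \<notin> \<sigma> \<Longrightarrow> L j t = 0"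
    and far: "\<And>j. j < n \<Longrightarrow> rcol j \<notin> cone \<sigma> \<Longrightarrow> \<delta> \<le> reduced_cost d A c \<sigma> j"
    and near: "\<And>j. j < n \<Longrightarrow> rcol j \<in> cone \<sigma> \<Longrightarrow> j \<notin> \<sigma> \<Longrightarrow>
      j \<in> N \<and> reduced_cost d A c \<sigma> j = \<epsilon> * \<eta> j \<and>
      (\<Sum>t<n. L j t) \<le> \<eta> j \<and> \<eta> j \<le> (1 + \<theta>) * (\<Sum>t<n. L j t)"
    and indep: "finite N" "\<And>z::nat \<Rightarrow> int. (\<Sum>j\<in>N. real_of_int (z j) * \<eta> j) = 0 \<Longrightarrow> \<forall>j\<in>N. z j = 0"
    and pars: "0 < \<epsilon>" "0 \<le> \<theta>" "\<theta> * real n < 1" "\<epsilon> * (real n + 1) < \<delta>"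
    and b: "b \<in> ivecs d" "rvec b \<in> cone \<sigma>"
  shows "gr_solves d n A c \<sigma> b" and "\<exists>!x. ip_optimal d n A c b x"
proof -
  define K where "K = gr_objective d n A c \<sigma>"
  let ?rc = "reduced_cost d A c \<sigma>"
  let ?C = "\<lambda>j. rcol j \<in> cone \<sigma>"
  define h where "h j = (\<Sum>t<n. L j t)" for j
  have sub: "\<sigma> \<subseteq> {..<n}" using max_face_subset[OF max] .
  have fin: "finite \<sigma>" using sub finite_subset by blast
  have K_alt: "K z = (\<Sum>j\<in>{..<n} - \<sigma>. ?rc j * of_int (z j))" for z by (simp add: K_def gr_objective_def)
  have rc_pos: "0 < ?rc j" if "j < n" "j \<notin> \<sigma>" for j using reduced_cost_pos[OF full_rank max that] .
  have \<sigma>C: "?C j" if "j \<in> \<sigma>" for j using that sub col_in_cone by blast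
  have L_unit: "L j = unit_vec j" if "j \<in> \<sigma>" for j
  proof (rule lin_indep_unique[OF li])
    show "mvr d n A (L j) = mvr d n A (unit_vec j)" using L(1)[of j] \<sigma>C that sub by (auto simp: mvr_unit)
    show "L j t = 0" if "t \<notin> \<sigma>" for t using L(3)[of j t] \<sigma>C \<open>j \<in> \<sigma>\<close> that sub by auto
    show "unit_vec j t = (0::real)" if "t \<notin> \<sigma>" for t using that \<open>j \<in> \<sigma>\<close> by (auto simp: unit_vec_def)
  qed
  have coords: "(\<lambda>t. \<Sum>j<n. real_of_int (z j) * L j t) = x"
    if "\<And>j. j < n \<Longrightarrow> z j \<noteq> 0 \<Longrightarrow> ?C j" "rvec (mv d n A z) = mvr d n A x" "\<And>t. t \<notin> \<sigma> \<Longrightarrow> x t = 0" for z x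
  proof (rule lin_indep_unique[OF li _ _ that(3)])
    show "mvr d n A (\<lambda>t. \<Sum>j<n. real_of_int (z j) * L j t) = mvr d n A x"
      using rvec_mv_coordinates[of z L] L(1) that by simp
    show "(\<Sum>j<n. real_of_int (z j) * L j t) = 0" if "t \<notin> \<sigma>" for t
      using L(3) \<open>\<And>j. j < n \<Longrightarrow> z j \<noteq> 0 \<Longrightarrow> ?C j\<close> that by (intro sum.neutral) auto
  qed
  obtain x where x: "rvec b = mvr d n A x" "\<And>j. 0 \<le> x j" "\<And>j. j \<notin> \<sigma> \<Longrightarrow> x j = 0"
    using b(2) cone_ofE by blast
  \<comment> \<open>The coordinate sum of the residue of \<open>b\<close> in the half open
    parallelepiped. It is the least coordinate sum that columns outside \<open>\<sigma>\<close> can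
    contribute when only columns of the cone are used.\<close>
  define H where "H = (\<Sum>t<n. frac (x t))"
  have "H \<le> (\<Sum>t<n. 1)" unfolding H_def by (intro sum_mono) (simp add: frac_lt_1 less_imp_le)
  then have H: "0 \<le> H" "H \<le> real n" by (auto simp: H_def intro!: sum_nonneg)
  let ?b = "\<lambda>i. b i - mv d n A (\<lambda>j. \<lfloor>x j\<rfloor>) i"
  note rb = fractional_part(2)[OF b(1) x(1)]
  have "rvec ?b \<in> cone \<sigma>" using x(3) by (intro cone_ofI[OF rb]) auto
  moreover have "?b \<in> ivecs d" by (rule fractional_part(1)[OF b(1) x(1)])
  ultimately obtain u where u: "mv d n A (\<lambda>j. int (u j)) = ?b" "\<And>j. u j \<noteq> 0 \<Longrightarrow> j < n \<and> ?C j"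
    using gen unfolding generated_def by blast
  have uL: "(\<lambda>t. \<Sum>j<n. real_of_int (int (u j)) * L j t) = (\<lambda>j. frac (x j))"
    by (rule coords) (use u(2) x(3) in \<open>auto simp: u(1) rb\<close>)
  \<comment> \<open>A nonnegative competitor: the integral parts on \<open>\<sigma>\<close>, plus a
    representation of the residue supplied by the generation hypothesis. Its objective is at most
    \<open>\<epsilon> * (1 + \<theta>) * H\<close>, hence below \<open>\<epsilon> * (H + 1)\<close>
    and below \<open>\<delta>\<close>.\<close>
  define D where "D j = int (u j) + \<lfloor>x j\<rfloor>" for j
  have D_feas: "gr_feasible d n A \<sigma> b D" and D_nonneg: "0 \<le> D j" for j
  proof -
    have "D j = 0" if "n \<le> j" for j
    proof -
      have "u j = 0" using u(2)[of j] that by linarith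
      moreover have "x j = 0" using x(3)[of j] sub that by force
      ultimately show ?thesis by (simp add: D_def)
    qed
    moreover show D_nonneg: "0 \<le> D j" for j using x(2) by (simp add: D_def)
    moreover have "mv d n A D = b" unfolding D_def mv_add u(1) by simp
    ultimately show "gr_feasible d n A \<sigma> b D" by (auto simp: gr_feasible_def)
  qed
  have KD: "K D \<le> \<epsilon> * ((1 + \<theta>) * H)"
  proof -
    have "K D = (\<Sum>j\<in>{..<n} - \<sigma>. ?rc j * real (u j))"
      unfolding K_alt using x(3) by (intro sum.cong) (auto simp: D_def)
    also have "\<dots> \<le> (\<Sum>j\<in>{..<n} - \<sigma>. \<epsilon> * ((1 + \<theta>) * (real (u j) * h j)))"
    proof (intro sum_mono)
      fix j assume j: "j \<in> {..<n} - \<sigma>"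
      show "?rc j * real (u j) \<le> \<epsilon> * ((1 + \<theta>) * (real (u j) * h j))"
      proof (cases "u j = 0")
        case False
        then have "?rc j = \<epsilon> * \<eta> j" "\<eta> j \<le> (1 + \<theta>) * h j" using near[of j] u(2)[of j] j by (auto simp: h_def)
        then have "?rc j * real (u j) \<le> \<epsilon> * ((1 + \<theta>) * h j) * real (u j)"
          using pars by (intro mult_right_mono) auto
        then show ?thesis by (simp add: mult_ac)
      qed simp
    qed
    also have "\<dots> \<le> (\<Sum>j<n. \<epsilon> * ((1 + \<theta>) * (real (u j) * h j)))"
      using pars L(2) by (intro sum_mono2) (auto simp: h_def intro!: mult_nonneg_nonneg sum_nonneg)
    also have "\<dots> = \<epsilon> * ((1 + \<theta>) * (\<Sum>j<n. \<Sum>t<n. real (u j) * L j t))"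
      by (simp add: sum_distrib_left h_def)
    also have "(\<Sum>j<n. \<Sum>t<n. real (u j) * L j t) = (\<Sum>t<n. \<Sum>j<n. real (u j) * L j t)" by (rule sum.swap)
    also have "\<dots> = H" unfolding H_def using fun_cong[OF uL] by (intro sum.cong) auto
    finally show ?thesis .
  qed
  have "\<theta> * H \<le> \<theta> * real n" using pars H by (intro mult_left_mono) auto
  then have "(1 + \<theta>) * H < H + 1" using pars(3) by (simp add: distrib_right)
  then have KD1: "K D < \<epsilon> * (H + 1)"
    using KD pars(1) by (meson mult_strict_left_mono order.strict_trans1)
  have "\<epsilon> * (H + 1) \<le> \<epsilon> * (real n + 1)" using pars H by (intro mult_left_mono) auto
  then have KD2: "K D < \<delta>" using KD1 pars(4) by linarith
  \<comment> \<open>Everything at least as cheap as \<open>D\<close> avoids columns outside the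
    cone, is nonnegative, and is bounded by \<open>x\<close> on \<open>\<sigma>\<close>. This yields
    nonnegativity of the optima and also the finiteness needed for a minimum to exist.\<close>
  have good: "(\<forall>j<n. z j \<noteq> 0 \<longrightarrow> ?C j) \<and> (\<forall>j. 0 \<le> z j) \<and> (\<forall>t\<in>\<sigma>. z t \<le> x t)"
    if z: "gr_feasible d n A \<sigma> b z" and Kz: "K z \<le> K D" for z
  proof -
    have zn: "0 \<le> z j" if "j < n" "j \<notin> \<sigma>" for j using z that by (simp add: gr_feasible_def)
    have zC: "?C j" if "j < n" "z j \<noteq> 0" for j
    proof (rule ccontr)
      assume nC: "\<not> ?C j"
      then have j\<sigma>: "j \<notin> \<sigma>" using \<sigma>C by blast
      then have "1 \<le> z j" using zn[OF that(1)] that(2) by linarith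
      have "\<delta> \<le> ?rc j" using far nC that by blast
      also have "\<dots> \<le> ?rc j * of_int (z j)" using \<open>1 \<le> z j\<close> rc_pos[OF that(1) j\<sigma>] by simp
      also have "\<dots> \<le> K z"
        unfolding K_alt using that j\<sigma> zn rc_pos by (intro member_le_sum) (auto simp: less_imp_le)
      finally show False using Kz KD2 by linarith
    qed
    define y where "y t = (\<Sum>j\<in>{..<n} - \<sigma>. real_of_int (z j) * L j t)" for t
    have "rvec (mv d n A z) = mvr d n A x" using z x(1) by (simp add: gr_feasible_def)
    from coords[OF zC this x(3)]
    have zx: "(\<Sum>j<n. real_of_int (z j) * L j t) = x t" for t by (simp add: fun_eq_iff)
    have split: "x t = y t + (if t \<in> \<sigma> then z t else 0)" for t
    proof -
      have "(\<Sum>j<n. real_of_int (z j) * L j t) = (\<Sum>j\<in>\<sigma>. real_of_int (z j) * L j t) + y t"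
        unfolding y_def by (subst sum.subset_diff[OF sub]) (auto simp: add.commute)
      also have "(\<Sum>j\<in>\<sigma>. real_of_int (z j) * L j t) = (\<Sum>j\<in>\<sigma>. real_of_int (z j) * unit_vec t j)"
        using L_unit by (intro sum.cong) (auto simp: unit_vec_def)
      finally show ?thesis using fin zx[of t] by (simp add: sum_unit_vec)
    qed
    have y0: "0 \<le> y t" for t unfolding y_def using zn L(2) by (intro sum_nonneg) auto
    \<comment> \<open>For \<open>t\<close> in \<open>\<sigma>\<close>, \<open>y t\<close> differs
      from \<open>x t\<close> by the integer \<open>z t\<close>, and it is nonnegative, so it is at
      least the fractional part. A negative \<open>z t\<close> pushes it one unit further, because
      the integral part of \<open>x t\<close> is nonnegative.\<close>
    have frac_le: "frac (x t) \<le> y t" and frac_le1: "z t < 0 \<Longrightarrow> frac (x t) + 1 \<le> y t" if "t \<in> \<sigma>" for t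
    proof -
      have e: "y t = frac (x t) + of_int (\<lfloor>x t\<rfloor> - z t)" using split[of t] that by (simp add: frac_def)
      then have "- 1 < real_of_int (\<lfloor>x t\<rfloor> - z t)" using y0[of t] frac_lt_1[of "x t"] by linarith
      then have "0 \<le> \<lfloor>x t\<rfloor> - z t" by linarith
      then show "frac (x t) \<le> y t" using e by (metis add_increasing2 of_int_0_le_iff order_refl)
      assume "z t < 0"
      moreover have "0 \<le> \<lfloor>x t\<rfloor>" using x(2) by simp
      ultimately have "1 \<le> real_of_int (\<lfloor>x t\<rfloor> - z t)" by linarith
      then show "frac (x t) + 1 \<le> y t" using e by linarith
    qed
    have "0 \<le> z t" if t: "t \<in> \<sigma>" for t
    proof (rule ccontr)
      assume "\<not> 0 \<le> z t"
      then have big: "frac (x t) + 1 \<le> y t" using frac_le1[OF t] by simp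
      have "H + 1 = (\<Sum>s<n. frac (x s) + unit_vec t s)"
        using t sub sum_unit_vec[of "{..<n}" "\<lambda>_. 1::real" t] by (auto simp: H_def sum.distrib)
      also have "\<dots> \<le> (\<Sum>s<n. y s)"
      proof (intro sum_mono)
        fix s assume "s \<in> {..<n}"
        show "frac (x s) + unit_vec t s \<le> y s"
          using big frac_le[of s] x(3)[of s] y0[of s] t by (cases "s = t"; cases "s \<in> \<sigma>") auto
      qed
      also have "(\<Sum>s<n. y s) = (\<Sum>j\<in>{..<n} - \<sigma>. real_of_int (z j) * h j)"
        unfolding y_def h_def sum_distrib_left by (rule sum.swap)
      finally have "\<epsilon> * (H + 1) \<le> (\<Sum>j\<in>{..<n} - \<sigma>. \<epsilon> * (real_of_int (z j) * h j))"
        using pars(1) by (simp add: sum_distrib_left[symmetric])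
      also have "\<dots> \<le> K z"
        unfolding K_alt
      proof (intro sum_mono)
        fix j assume j: "j \<in> {..<n} - \<sigma>"
        show "\<epsilon> * (real_of_int (z j) * h j) \<le> ?rc j * real_of_int (z j)"
        proof (cases "z j = 0")
          case False
          then have "?rc j = \<epsilon> * \<eta> j" "h j \<le> \<eta> j" using near[of j] zC[of j] j by (auto simp: h_def)
          then have "\<epsilon> * h j * real_of_int (z j) \<le> ?rc j * real_of_int (z j)"
            using pars zn[of j] j by (intro mult_right_mono) auto
          then show ?thesis by (simp add: mult_ac)
        qed simp
      qed
      finally show False using Kz KD1 by linarith
    qed
    moreover have "z j = 0" if "n \<le> j" for j using z that by (simp add: gr_feasible_def)
    ultimately have "0 \<le> z j" for j using zn[of j] by (cases "j < n"; cases "j \<in> \<sigma>") auto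
    moreover have "z t \<le> x t" if "t \<in> \<sigma>" for t using split[of t] y0[of t] that by simp
    ultimately show ?thesis using zC by blast
  qed
  define S where "S = {z. gr_feasible d n A \<sigma> b z \<and> K z \<le> K D}"
  have "finite S"
  proof -
    \<comment> \<open>One bound for both kinds of entries. On \<open>\<sigma>\<close> the reduced
      cost is 0, so the first term vanishes by division by zero; outside \<open>\<sigma>\<close> the
      second vanishes because \<open>x j = 0\<close>.\<close>
    let ?B = "\<lambda>j. \<lfloor>K D / ?rc j\<rfloor> + \<lfloor>x j\<rfloor>"
    let ?R = "\<Union>j<n. {0..?B j}"
    have "z j \<in> {0..?B j}" if zS: "z \<in> S" and j: "j < n" for z j
    proof -
      have g: "0 \<le> z j" "j \<in> \<sigma> \<Longrightarrow> real_of_int (z j) \<le> x j" using good[of z] zS by (auto simp: S_def)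
      show ?thesis
      proof (cases "j \<in> \<sigma>")
        case True
        then have "z j \<le> \<lfloor>x j\<rfloor>" using g by (simp add: le_floor_iff)
        then show ?thesis using g True reduced_cost_zero[OF full_rank max True] by simp
      next
        case False
        have nn: "0 \<le> z k" for k using good[of z] zS by (auto simp: S_def)
        have "?rc j * of_int (z j) \<le> K z"
          unfolding K_alt using j False nn rc_pos by (intro member_le_sum) (auto simp: less_imp_le)
        also have "\<dots> \<le> K D" using zS by (simp add: S_def)
        finally have "real_of_int (z j) \<le> K D / ?rc j"
          using rc_pos[OF j False] by (simp add: pos_le_divide_eq mult.commute)
        then show ?thesis using g x(3)[OF False] by (simp add: le_floor_iff)
      qed
    qed
    then have "f j \<in> ?R" if "f \<in> S" "j < n" for f j using that by blast
    moreover have "f j = 0" if "f \<in> S" "\<not> j < n" for f j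
      using that unfolding S_def gr_feasible_def by (simp add: not_less)
    ultimately have "S \<subseteq> {f. \<forall>j. (j \<in> {..<n} \<longrightarrow> f j \<in> ?R) \<and> (j \<notin> {..<n} \<longrightarrow> f j = 0)}"
      by (simp add: subset_iff)
    moreover have "finite {f::nat \<Rightarrow> int. \<forall>j. (j \<in> {..<n} \<longrightarrow> f j \<in> ?R) \<and> (j \<notin> {..<n} \<longrightarrow> f j = 0)}"
      by (rule finite_set_of_finite_funs) auto
    ultimately show ?thesis by (rule finite_subset)
  qed
  moreover have DS: "D \<in> S" using D_feas by (simp add: S_def)
  ultimately obtain z where z: "z \<in> S" "\<And>z'. z' \<in> S \<Longrightarrow> K z \<le> K z'"
    using ex_min_if_finite[of "K ` S"] by (fastforce simp: not_less)
  have z_opt: "gr_optimal d n A c \<sigma> b z"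
    unfolding gr_optimal_def K_def[symmetric]
  proof (intro conjI allI impI)
    show "gr_feasible d n A \<sigma> b z" using z by (simp add: S_def)
    fix z' assume z': "gr_feasible d n A \<sigma> b z'"
    show "K z \<le> K z'"
    proof (cases "K z' \<le> K D")
      case True
      then show ?thesis using z z' by (simp add: S_def)
    next
      case False
      then show ?thesis using z(2)[OF DS] by linarith
    qed
  qed
  have z_nn: "0 \<le> z j" for j using good[of z] z by (auto simp: S_def)
  show "gr_solves d n A c \<sigma> b" unfolding gr_solves_def using z_opt z_nn by blast
  have ip_z: "ip_optimal d n A c b (\<lambda>j. nat (z j))"
    using gr_optimal_ip_optimal[OF full_rank max z_opt] z_nn by blast
  have ip_S: "(\<lambda>j. int (y j)) \<in> S \<and> K (\<lambda>j. int (y j)) = K z" if y: "ip_optimal d n A c b y" for y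
  proof -
    have f: "gr_feasible d n A \<sigma> b (\<lambda>j. int (y j))"
      using y ip_feasible_gr_feasible unfolding ip_optimal_def by blast
    have "cost n c y = cost n c (\<lambda>j. nat (z j))"
      using y ip_z unfolding ip_optimal_def by (meson order_antisym)
    then have "(\<Sum>j<n. c j * of_int (int (y j))) = (\<Sum>j<n. c j * of_int (z j))"
      using z_nn by (simp add: cost_def)
    then have "K (\<lambda>j. int (y j)) = K z"
      unfolding K_def using f z_opt gr_objective_eq[OF full_rank max]
      by (auto simp: gr_feasible_def gr_optimal_def)
    then show ?thesis using f z by (simp add: S_def)
  qed
  show "\<exists>!x. ip_optimal d n A c b x"
  proof (rule ex1I[where a = "\<lambda>j. nat (z j)"])
    show "ip_optimal d n A c b (\<lambda>j. nat (z j))" by (rule ip_z)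
    fix y assume y: "ip_optimal d n A c b y"
    \<comment> \<open>Equal costs give an integer relation among the \<open>\<eta> j\<close>, so
      \<open>e\<close> vanishes outside \<open>\<sigma>\<close>. What is left is a dependence among
      the columns of \<open>\<sigma>\<close>, hence trivial.\<close>
    define e where "e j = int (y j) - z j" for j
    have yS: "(\<lambda>j. int (y j)) \<in> S" "K (\<lambda>j. int (y j)) = K z" using ip_S[OF y] by auto
    have eC: "?C j" if "j < n" "e j \<noteq> 0" for j
    proof -
      have "(\<lambda>j. int (y j)) j \<noteq> 0 \<or> z j \<noteq> 0" using that by (auto simp: e_def)
      then show ?thesis using good[of z] good[of "\<lambda>j. int (y j)"] z(1) yS(1) that(1) unfolding S_def by blast
    qed
    define e' where "e' j = (if j < n \<and> j \<notin> \<sigma> then e j else 0)" for j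
    have "(\<Sum>j\<in>{..<n} - \<sigma>. ?rc j * of_int (e j)) = 0"
      using yS(2) unfolding K_alt by (simp add: e_def right_diff_distrib sum_subtractf)
    moreover have "(\<Sum>j\<in>{..<n} - \<sigma>. ?rc j * of_int (e j)) = \<epsilon> * (\<Sum>j\<in>N. of_int (e' j) * \<eta> j)"
    proof -
      have "(\<Sum>j\<in>{..<n} - \<sigma>. ?rc j * of_int (e j)) = (\<Sum>j\<in>({..<n} - \<sigma>) \<inter> {j. e j \<noteq> 0}. \<epsilon> * (of_int (e' j) * \<eta> j))"
        by (rule sum.mono_neutral_cong_right) (use near eC in \<open>auto simp: e'_def\<close>)
      also have "\<dots> = (\<Sum>j\<in>N. \<epsilon> * (of_int (e' j) * \<eta> j))"
        by (rule sum.mono_neutral_left) (use near eC indep(1) in \<open>auto simp: e'_def split: if_splits\<close>)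
      finally show ?thesis by (simp add: sum_distrib_left)
    qed
    ultimately have "(\<Sum>j\<in>N. of_int (e' j) * \<eta> j) = 0" using pars(1) by simp
    then have eN: "e' j = 0" if "j \<in> N" for j using indep(2) that by blast
    have e0: "e j = 0" if "j < n" "j \<notin> \<sigma>" for j
      using eN[of j] near[of j] eC[of j] that by (auto simp: e'_def)
    have en: "e j = 0" if "n \<le> j" for j using z(1) yS(1) that by (simp add: e_def S_def gr_feasible_def)
    have "mv d n A e = (\<lambda>i. 0)"
      unfolding e_def mv_diff using z(1) yS(1) by (simp add: S_def gr_feasible_def)
    then have "mvr d n A (\<lambda>j. real_of_int (e j)) = (\<lambda>i. 0)"
      unfolding rvec_mv[symmetric] by (simp add: rvec_def)
    then have "real_of_int (e j) = 0" for j
      by (rule lin_indep_zero[OF li]) (metis e0 en not_less of_int_0)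
    then have "int (y j) = z j" for j unfolding e_def by (metis eq_iff_diff_eq_0 of_int_eq_0_iff)
    then show "y = (\<lambda>j. nat (z j))" by (metis ext nat_int)
  qed
qed

end

section \<open>Coordinates of the columns in a triangulation\<close>

lemma dotcol_coordinates:
  assumes "mvr d n A x = rvec (col d A j)"
  shows "dotcol d A y j = (\<Sum>t<n. x t * dotcol d A y t)"
  using dot_mvr[where y = y and x = x and d = d and n = n and A = A]
    dot_col[where y = y and d = d and A = A and j = j] assms by simp

lemma triangulationD:
  assumes "triangulation d n A \<Delta>" "\<sigma> \<in> \<Delta>"
  shows "\<sigma> \<subseteq> {..<n}" "lin_indep_cols d n A \<sigma>" "\<And>\<tau>. \<tau> \<subseteq> \<sigma> \<Longrightarrow> \<tau> \<in> \<Delta>"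
    "\<And>\<tau>. \<tau> \<in> \<Delta> \<Longrightarrow> cone_of d n A \<sigma> \<inter> cone_of d n A \<tau> = cone_of d n A (\<sigma> \<inter> \<tau>)"
proof -
  note t = assms(1)[unfolded triangulation_def, THEN conjunct2]
  note 1 = t[THEN conjunct1] and 3 = t[THEN conjunct2, THEN conjunct1]
    and 2 = t[THEN conjunct2, THEN conjunct2, THEN conjunct1]
    and 4 = t[THEN conjunct2, THEN conjunct2, THEN conjunct2, THEN conjunct1]
  show "\<sigma> \<subseteq> {..<n}" "lin_indep_cols d n A \<sigma>" "\<And>\<tau>. \<tau> \<subseteq> \<sigma> \<Longrightarrow> \<tau> \<in> \<Delta>"
    "\<And>\<tau>. \<tau> \<in> \<Delta> \<Longrightarrow> cone_of d n A \<sigma> \<inter> cone_of d n A \<tau> = cone_of d n A (\<sigma> \<inter> \<tau>)"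
    using bspec[OF 1 assms(2)] bspec[OF 2 assms(2)] bspec[OF 3 assms(2)] bspec[OF 4 assms(2)] by auto
qed

text \<open>A point of two cones lies in the cone of the common face. Independence of
  \<open>\<tau>\<close> makes its coordinates unique, so they are already supported on the
  intersection.\<close>

lemma triangulation_support:
  assumes "triangulation d n A \<Delta>" "\<sigma> \<in> \<Delta>" "\<tau> \<in> \<Delta>" "mvr d n A x \<in> cone_of d n A \<sigma>"
    "\<And>t. 0 \<le> x t" "\<And>t. t \<notin> \<tau> \<Longrightarrow> x t = 0" "t \<notin> \<sigma>"
  shows "x t = 0"
proof -
  have "mvr d n A x \<in> cone_of d n A \<tau>" using assms(5,6) by (intro cone_ofI[OF refl])
  then have "mvr d n A x \<in> cone_of d n A (\<sigma> \<inter> \<tau>)"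
    using triangulationD(4)[OF assms(1-3)] assms(4) by blast
  then obtain z where z: "mvr d n A x = mvr d n A z" "\<And>t. t \<notin> \<sigma> \<inter> \<tau> \<Longrightarrow> z t = 0"
    using cone_ofE by blast
  have "x = z"
    by (rule lin_indep_unique[of d n A \<tau>])
      (use triangulationD(2)[OF assms(1,3)] assms(6) z in auto)
  then show ?thesis using z(2) assms(7) by auto
qed

lemma triangulation_vertex:
  assumes "triangulation d n A \<Delta>" "\<sigma> \<in> \<Delta>" "{j} \<in> \<Delta>" "j < n" "rvec (col d A j) \<in> cone_of d n A \<sigma>"
  shows "j \<in> \<sigma>"
proof (rule ccontr)
  assume "j \<notin> \<sigma>"
  have "unit_vec j j = (0::real)"
    by (rule triangulation_support[OF assms(1-3), of "unit_vec j"])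
      (use assms(4,5) \<open>j \<notin> \<sigma>\<close> in \<open>auto simp: mvr_unit\<close>)
  then show False by simp
qed

lemma triangulation_cover:
  assumes "triangulation d n A \<Delta>" "v \<in> coneA d n A"
  shows "\<exists>\<sigma>. max_face \<Delta> \<sigma> \<and> v \<in> cone_of d n A \<sigma>"
proof -
  have "(\<Union>\<sigma>\<in>\<Delta>. cone_of d n A \<sigma>) = coneA d n A"
    by (rule assms(1)[unfolded triangulation_def, THEN conjunct2, THEN conjunct2, THEN conjunct2,
        THEN conjunct2, THEN conjunct2])
  then obtain \<sigma> where \<sigma>: "\<sigma> \<in> \<Delta>" "v \<in> cone_of d n A \<sigma>" using assms(2) by blast
  obtain \<tau> where "max_face \<Delta> \<tau>" "\<sigma> \<subseteq> \<tau>"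
    using max_face_above[OF \<sigma>(1) triangulationD(1)[OF assms(1)]] by blast
  then show ?thesis using \<sigma>(2) cone_of_mono by blast
qed

text \<open>The coordinates of a column do not depend on which face containing it is used. One
  choice of \<open>L\<close> therefore serves all faces simultaneously.\<close>

lemma triangulation_coordinates:
  assumes "triangulation d n A \<Delta>"
  shows "\<exists>L. (\<forall>j t. 0 \<le> L j t) \<and> (\<forall>j<n. mvr d n A (L j) = rvec (col d A j) \<and>
    (\<forall>\<sigma>\<in>\<Delta>. rvec (col d A j) \<in> cone_of d n A \<sigma> \<longrightarrow> (\<forall>t. t \<notin> \<sigma> \<longrightarrow> L j t = 0)) \<and>
    (\<exists>\<sigma>. max_face \<Delta> \<sigma> \<and> rvec (col d A j) \<in> cone_of d n A \<sigma>))"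
proof -
  have "\<exists>x. (\<forall>t. 0 \<le> x t) \<and> (j < n \<longrightarrow> mvr d n A x = rvec (col d A j) \<and>
    (\<forall>\<sigma>\<in>\<Delta>. rvec (col d A j) \<in> cone_of d n A \<sigma> \<longrightarrow> (\<forall>t. t \<notin> \<sigma> \<longrightarrow> x t = 0)) \<and>
    (\<exists>\<sigma>. max_face \<Delta> \<sigma> \<and> rvec (col d A j) \<in> cone_of d n A \<sigma>))" for j
  proof (cases "j < n")
    case True
    then have "rvec (col d A j) \<in> coneA d n A" unfolding coneA_def by (intro col_in_cone) auto
    then obtain \<tau> where \<tau>: "max_face \<Delta> \<tau>" "rvec (col d A j) \<in> cone_of d n A \<tau>"
      using triangulation_cover[OF assms] by blast
    then obtain x where x: "rvec (col d A j) = mvr d n A x" "\<And>t. 0 \<le> x t" "\<And>t. t \<notin> \<tau> \<Longrightarrow> x t = 0"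
      using cone_ofE by blast
    have "x t = 0" if "\<sigma> \<in> \<Delta>" "rvec (col d A j) \<in> cone_of d n A \<sigma>" "t \<notin> \<sigma>" for \<sigma> t
      by (rule triangulation_support[OF assms that(1) max_faceD[OF \<tau>(1)]]) (use x that in auto)
    then have "\<forall>\<sigma>\<in>\<Delta>. rvec (col d A j) \<in> cone_of d n A \<sigma> \<longrightarrow> (\<forall>t. t \<notin> \<sigma> \<longrightarrow> x t = 0)" by blast
    moreover have "\<forall>t. 0 \<le> x t" "mvr d n A x = rvec (col d A j)" using x by auto
    ultimately show ?thesis using \<tau> by blast
  qed (intro exI[of _ "\<lambda>_. 0"], auto)
  then show ?thesis by metis
qed

section \<open>Construction of a supporting cost vector\<close>

context standing_matrix
begin

lemma supports_if_generated:
  assumes reg: "regular_triangulation d n A \<Delta>" and gen: "\<And>\<sigma>. max_face \<Delta> \<sigma> \<Longrightarrow> generated \<sigma>"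
  shows "\<exists>c. supports d n A \<Delta> c"
proof -
  obtain c0 where \<Delta>: "\<Delta> = delta d n A c0" and tri: "triangulation d n A \<Delta>"
    using reg unfolding regular_triangulation_def by blast
  note sub = triangulationD(1)[OF tri] and li = triangulationD(2)[OF tri]
  have vert: "{j} \<in> \<Delta>" if "j \<in> \<sigma>" "\<sigma> \<in> \<Delta>" for j \<sigma>
    using triangulationD(3)[OF tri that(2), of "{j}"] that(1) by simp
  obtain L where L: "\<And>j t. 0 \<le> L j t" "\<And>j. j < n \<Longrightarrow> mvr d n A (L j) = rcol j"
    "\<And>j \<sigma> t. j < n \<Longrightarrow> \<sigma> \<in> \<Delta> \<Longrightarrow> rcol j \<in> cone \<sigma> \<Longrightarrow> t \<notin> \<sigma> \<Longrightarrow> L j t = 0"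
    "\<And>j. j < n \<Longrightarrow> \<exists>\<sigma>. max_face \<Delta> \<sigma> \<and> rcol j \<in> cone \<sigma>"
    using triangulation_coordinates[OF tri] by metis
  define h where "h j = (\<Sum>t<n. L j t)" for j
  define G where "G j = (\<Sum>t<n. L j t * c0 t)" for j
  define N where "N = {j. j < n \<and> {j} \<notin> \<Delta>}"
  \<comment> \<open>Positive, so that the interval for \<open>\<eta> j\<close> is nonempty, and with
    \<open>\<theta> * real n < 1\<close>, so that the distortion of a residue stays below one
    unit.\<close>
  define \<theta> where "\<theta> = 1 / (real n + 1)"
  let ?y = "dual_vec d A c0" and ?rc = "reduced_cost d A c0"
  have L_vert: "L j t = 0" if "j < n" "{t} \<notin> \<Delta>" for j t
    using L(3,4)[OF that(1)] vert that(2) max_faceD by metis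
  have h_pos: "0 < h j" if j: "j < n" for j
  proof -
    have "h j \<noteq> 0"
    proof
      assume "h j = 0"
      then have "\<forall>t<n. L j t = 0" unfolding h_def using L(1) by (subst (asm) sum_nonneg_eq_0_iff) auto
      then have "mvr d n A (L j) = mvr d n A (\<lambda>t. 0)" by (intro mvr_cong) auto
      then have "rcol j = rvec (\<lambda>i. 0)" using L(2)[OF j] by (simp add: rvec_def)
      then show False using col_nonzero[OF j] by (simp only: rvec_inject)
    qed
    moreover have "0 \<le> h j" unfolding h_def using L(1) by (intro sum_nonneg) auto
    ultimately show ?thesis by linarith
  qed
  have "finite N" by (simp add: N_def)
  obtain \<eta> where \<eta>: "\<forall>j\<in>N. h j < \<eta> j \<and> \<eta> j < (1 + \<theta>) * h j"
    "\<And>z::nat \<Rightarrow> int. (\<Sum>j\<in>N. real_of_int (z j) * \<eta> j) = 0 \<Longrightarrow> \<forall>j\<in>N. z j = 0"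
    using rationally_independent_choice[OF \<open>finite N\<close>, of h "\<lambda>j. (1 + \<theta>) * h j"] h_pos
    by (auto simp: N_def \<theta>_def)
  \<comment> \<open>The gap between \<open>G\<close> and the functional of a face is a nonnegative
    combination of reduced costs. It vanishes for columns in the cone of the face and is positive
    for all others.\<close>
  have gap: "G j - dotcol d A (?y \<sigma>) j = (\<Sum>t<n. L j t * ?rc \<sigma> t)" if "j < n" for j \<sigma>
    unfolding G_def dotcol_coordinates[OF L(2)[OF that], of "?y \<sigma>"] reduced_cost_def
    by (simp add: right_diff_distrib sum_subtractf)
  have gap0: "G j = dotcol d A (?y \<sigma>) j" if "j < n" "max_face \<Delta> \<sigma>" "rcol j \<in> cone \<sigma>" for j \<sigma>
  proof -
    have "L j t * ?rc \<sigma> t = 0" for t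
      using L(3)[OF that(1) max_faceD[OF that(2)] that(3), of t] reduced_cost_zero[OF full_rank] that(2) \<Delta>
      by (cases "t \<in> \<sigma>") auto
    then show ?thesis using gap[OF that(1), of \<sigma>] by (simp del: mult_eq_0_iff)
  qed
  have gap_pos: "0 < G j - dotcol d A (?y \<sigma>) j"
    if j: "j < n" and \<sigma>: "max_face \<Delta> \<sigma>" and out: "rcol j \<notin> cone \<sigma>" for j \<sigma>
  proof -
    have nn: "0 \<le> L j t * ?rc \<sigma> t" if "t < n" for t
      using L(1)[of j t] reduced_cost_nonneg[OF full_rank, of c0 \<sigma> t] \<sigma> \<Delta> that by simp
    have "(\<Sum>t<n. L j t * ?rc \<sigma> t) \<noteq> 0"
    proof
      assume "(\<Sum>t<n. L j t * ?rc \<sigma> t) = 0"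
      then have 0: "L j t * ?rc \<sigma> t = 0" if "t < n" for t
        using nn that by (subst (asm) sum_nonneg_eq_0_iff) auto
      have "L j t = 0" if "t \<notin> \<sigma>" for t
      proof (cases "t < n")
        case True
        then show ?thesis using 0[OF True] reduced_cost_pos[OF full_rank, of c0 \<sigma> t] \<sigma> \<Delta> that by auto
      next
        case False
        then have "{t} \<notin> \<Delta>" using sub by blast
        then show ?thesis using L_vert j by blast
      qed
      then have "rcol j \<in> cone \<sigma>"
        using L(1,2) j by (intro cone_ofI[of _ _ _ _ "L j"]) auto
      with out show False ..
    qed
    moreover have "0 \<le> (\<Sum>t<n. L j t * ?rc \<sigma> t)" using nn by (intro sum_nonneg) auto
    ultimately show ?thesis using gap[OF j, of \<sigma>] by linarith
  qed
  define S where "S = {(\<sigma>, j). max_face \<Delta> \<sigma> \<and> j < n \<and> rcol j \<notin> cone \<sigma>}"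
  \<comment> \<open>The least gap over all pairs of a maximal face and a column outside its cone.
    Inserting 1 keeps the minimum defined when there are no such pairs.\<close>
  define \<delta> where "\<delta> = Min (insert 1 ((\<lambda>(\<sigma>, j). G j - dotcol d A (?y \<sigma>) j) ` S))"
  have "S \<subseteq> Pow {..<n} \<times> {..<n}" using sub max_faceD by (auto simp: S_def)
  then have "finite S" by (rule finite_subset) auto
  then have \<delta>: "0 < \<delta>" "\<And>\<sigma> j. (\<sigma>, j) \<in> S \<Longrightarrow> \<delta> \<le> G j - dotcol d A (?y \<sigma>) j"
    unfolding \<delta>_def using gap_pos by (auto simp: S_def intro!: Min_le)
  \<comment> \<open>Then \<open>\<epsilon> * (real n + 1)\<close> is \<open>\<delta> / 2\<close>: a
    single column outside the cone costs more than any residue represented inside it.\<close>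
  define \<epsilon> where "\<epsilon> = \<delta> / (2 * (real n + 1))"
  have \<epsilon>: "0 < \<epsilon>" using \<delta> by (simp add: \<epsilon>_def)
  define c where "c j = (if j \<in> N then G j + \<epsilon> * \<eta> j else c0 j)" for j
  have c_vert: "c t = c0 t" if "{t} \<in> \<Delta>" for t using that by (simp add: c_def N_def)
  have c_gt: "G j < c j" if "j \<in> N" for j
  proof -
    have "0 < \<eta> j" using \<eta>(1) h_pos[of j] that by (auto simp: N_def)
    then show ?thesis using \<epsilon> that by (simp add: c_def)
  qed
  have c0_gt: "G j < c0 j" if j: "j \<in> N" for j
  proof -
    have jn: "j < n" using j by (simp add: N_def)
    obtain \<sigma> where \<sigma>: "max_face \<Delta> \<sigma>" "rcol j \<in> cone \<sigma>" using L(4)[OF jn] by blast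
    have "j \<notin> \<sigma>" using j vert max_faceD[OF \<sigma>(1)] by (auto simp: N_def)
    then show ?thesis using gap0[OF jn \<sigma>] dual_vec_tight(2)[OF full_rank, of c0 \<sigma> j] \<sigma> jn \<Delta> by simp
  qed
  have below: "dotcol d A y j \<le> G j"
    if "j < n" "\<And>t. t < n \<Longrightarrow> {t} \<in> \<Delta> \<Longrightarrow> dotcol d A y t \<le> c0 t" for y j
    unfolding G_def dotcol_coordinates[OF L(2)[OF that(1)], of y]
  proof (intro sum_mono)
    fix t assume "t \<in> {..<n}"
    then show "L j t * dotcol d A y t \<le> L j t * c0 t"
      using that L(1)[of j t] L_vert[OF that(1), of t] by (cases "{t} \<in> \<Delta>") (auto intro: mult_left_mono)
  qed
  have dc: "\<Delta> = delta d n A c"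
  proof (intro equalityI subsetI)
    fix \<tau> assume \<tau>: "\<tau> \<in> \<Delta>"
    have "\<tau> \<in> delta d n A c0" using \<tau> \<Delta> by simp
    then obtain y where "\<tau> \<subseteq> {..<n}" and y: "\<And>j. j \<in> \<tau> \<Longrightarrow> dotcol d A y j = c0 j"
      "\<And>j. j < n \<Longrightarrow> j \<notin> \<tau> \<Longrightarrow> dotcol d A y j < c0 j"
      by (rule deltaE) (rule that)
    have le: "dotcol d A y t \<le> c0 t" if "t < n" for t using y that by (cases "t \<in> \<tau>") (auto simp: less_imp_le)
    show "\<tau> \<in> delta d n A c"
    proof (rule deltaI[where y = y])
      show "\<tau> \<subseteq> {..<n}" using sub[OF \<tau>] .
      show "dotcol d A y j = c j" if "j \<in> \<tau>" for j using y(1)[OF that] c_vert vert \<tau> that by simp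
      show "dotcol d A y j < c j" if "j < n" "j \<notin> \<tau>" for j
      proof (cases "j \<in> N")
        case True
        then show ?thesis using below[of j y] le c_gt[OF True] that by fastforce
      next
        case False
        then show ?thesis using y(2) that by (simp add: c_def)
      qed
    qed
  next
    fix \<tau> assume \<tau>: "\<tau> \<in> delta d n A c"
    obtain y where y: "\<tau> \<subseteq> {..<n}" "\<And>j. j \<in> \<tau> \<Longrightarrow> dotcol d A y j = c j"
      "\<And>j. j < n \<Longrightarrow> j \<notin> \<tau> \<Longrightarrow> dotcol d A y j < c j"
      by (rule deltaE[OF \<tau>]) (rule that)
    have le: "dotcol d A y t \<le> c0 t" if "t < n" "{t} \<in> \<Delta>" for t
      using y(2,3)[of t] that c_vert[OF that(2)] by (cases "t \<in> \<tau>") (auto simp: less_imp_le)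
    have N: "dotcol d A y j \<le> G j" if "j \<in> N" for j using below[of j y] le that by (simp add: N_def)
    have "\<tau> \<in> delta d n A c0"
    proof (rule deltaI[where y = y])
      show "\<tau> \<subseteq> {..<n}" by fact
      show "dotcol d A y j = c0 j" if "j \<in> \<tau>" for j
      proof -
        have "j \<notin> N" using N[of j] c_gt[of j] y(2)[OF that] by auto
        then show ?thesis using y(2)[OF that] by (simp add: c_def)
      qed
      show "dotcol d A y j < c0 j" if "j < n" "j \<notin> \<tau>" for j
        using N[of j] c0_gt[of j] y(3)[OF that] by (cases "j \<in> N") (auto simp: c_def)
    qed
    then show "\<tau> \<in> \<Delta>" using \<Delta> by simp
  qed
  have dual_eq: "dual_vec d A c \<sigma> = ?y \<sigma>" if "\<sigma> \<in> \<Delta>" for \<sigma>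
  proof -
    have "(\<forall>j\<in>\<sigma>. dotcol d A y j = c j) = (\<forall>j\<in>\<sigma>. dotcol d A y j = c0 j)" for y
      using c_vert vert that by simp
    then show ?thesis by (simp add: dual_vec_def)
  qed
  have core: "gr_solves d n A c \<sigma> b" "\<exists>!x. ip_optimal d n A c b x"
    if \<sigma>: "max_face \<Delta> \<sigma>" and b: "b \<in> ivecs d" "rvec b \<in> cone \<sigma>" for \<sigma> b
  proof -
    have \<sigma>\<Delta>: "\<sigma> \<in> \<Delta>" using max_faceD[OF \<sigma>] .
    have \<sigma>c: "max_face (delta d n A c) \<sigma>" using \<sigma> dc by simp
    have rc: "reduced_cost d A c \<sigma> j = c j - dotcol d A (?y \<sigma>) j" for j
      by (simp add: reduced_cost_def dual_eq[OF \<sigma>\<Delta>])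
    have far: "\<delta> \<le> reduced_cost d A c \<sigma> j" if "j < n" "rcol j \<notin> cone \<sigma>" for j
    proof -
      have "G j \<le> c j"
      proof (cases "j \<in> N")
        case False
        then have v: "{j} \<in> \<Delta>" using that by (simp add: N_def)
        have "L j t = 0" if "t \<noteq> j" for t
          using L(3)[OF _ v, of j t] col_in_cone[of j "{j}" n d A] \<open>j < n\<close> that by simp
        then have 1: "L j = (\<lambda>t. L j j * unit_vec j t)" by (auto simp: unit_vec_def)
        have "L j = unit_vec j"
          by (rule lin_indep_unique[OF li[OF v]])
            (use L(2)[OF \<open>j < n\<close>] \<open>j < n\<close> \<open>\<And>t. t \<noteq> j \<Longrightarrow> L j t = 0\<close> in \<open>auto simp: mvr_unit\<close>)
        then have "G j = c0 j" unfolding G_def using \<open>j < n\<close> by (simp add: sum_unit_vec')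
        then show ?thesis using False by (simp add: c_def)
      qed (use c_gt in \<open>simp add: less_imp_le\<close>)
      moreover have "\<delta> \<le> G j - dotcol d A (?y \<sigma>) j" by (rule \<delta>(2)) (use that \<sigma> in \<open>simp add: S_def\<close>)
      ultimately show ?thesis unfolding rc by linarith
    qed
    have near: "j \<in> N \<and> reduced_cost d A c \<sigma> j = \<epsilon> * \<eta> j \<and> (\<Sum>t<n. L j t) \<le> \<eta> j \<and> \<eta> j \<le> (1 + \<theta>) * (\<Sum>t<n. L j t)"
      if "j < n" "rcol j \<in> cone \<sigma>" "j \<notin> \<sigma>" for j
    proof -
      have "{j} \<notin> \<Delta>" using triangulation_vertex[OF tri \<sigma>\<Delta>] that by blast
      then have jN: "j \<in> N" using that by (simp add: N_def)
      then have "reduced_cost d A c \<sigma> j = \<epsilon> * \<eta> j" unfolding rc using gap0[OF that(1) \<sigma> that(2)] by (simp add: c_def)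
      moreover have "h j < \<eta> j" "\<eta> j < (1 + \<theta>) * h j" using \<eta>(1) jN by auto
      ultimately show ?thesis using jN by (simp add: h_def)
    qed
    have pars: "0 \<le> \<theta>" "\<theta> * real n < 1" "\<epsilon> * (real n + 1) < \<delta>"
      using \<delta>(1) by (auto simp: \<theta>_def \<epsilon>_def field_simps intro!: add_pos_nonneg)
    note core = gomory_core[OF \<sigma>c li[OF \<sigma>\<Delta>] gen[OF \<sigma>] L(2) L(1) L(3)[OF _ \<sigma>\<Delta>] far near \<open>finite N\<close> \<eta>(2) \<epsilon> pars b]
    show "gr_solves d n A c \<sigma> b" by (rule core(1))
    show "\<exists>!x. ip_optimal d n A c b x" by (rule core(2))
  qed
  have cover: "\<exists>\<sigma>. max_face \<Delta> \<sigma> \<and> b \<in> ivecs d \<and> rvec b \<in> cone \<sigma>" if "b \<in> semigroup d n A" for b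
    using that triangulation_cover[OF tri, of "rvec b"] unfolding semigroup_eq lattice_pts_def by blast
  have "generic d n A c" using tri dc cover core(2) unfolding generic_def by metis
  moreover have "gomory_family d n A c" using dc cover core(1) unfolding gomory_family_def by metis
  ultimately show ?thesis unfolding supports_def using dc by blast
qed

lemma max_face_card:
  assumes "regular_triangulation d n A \<Delta>" "max_face \<Delta> \<sigma>"
  shows "\<sigma> \<subseteq> {..<n}" "lin_indep_cols d n A \<sigma>" "card \<sigma> = d"
proof -
  obtain c where c: "\<Delta> = delta d n A c" and tri: "triangulation d n A \<Delta>"
    using assms(1) unfolding regular_triangulation_def by blast
  show sub: "\<sigma> \<subseteq> {..<n}" using assms(2) c max_face_subset by blast
  show li: "lin_indep_cols d n A \<sigma>" using triangulationD(2)[OF tri max_faceD[OF assms(2)]] .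
  have "d \<le> card \<sigma>"
    using max_face_spanning[OF full_rank] assms(2) c sub by (intro card_spanning_ge) (auto intro: finite_subset)
  then show "card \<sigma> = d" using card_lin_indep_le[OF li sub] by simp
qed

theorem low_dim_supports:
  assumes "d = 1 \<or> d = 2 \<or> d = 3 \<and> graded d n A" "regular_triangulation d n A \<Delta>"
  shows "\<exists>c. supports d n A \<Delta> c"
  using supports_if_generated[OF assms(2)] generated_low_dim[OF assms(1)] max_face_card[OF assms(2)] by blast

end

context standing_matrix
begin

subsection \<open>Uniqueness in the graded plane\<close>

text \<open>A residue in the half open parallelogram has height below 2. Height 0 means that the
  residue is 0; height 1 means that it is a column, and not a vertex of \<open>\<sigma>\<close>,
  since all its coordinates are below 1.\<close>

lemma floor_residue:
  assumes d2: "d = 2" and w: "\<And>j. j < n \<Longrightarrow> dotcol d A w j = 1"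
    and \<sigma>: "\<sigma> \<subseteq> {..<n}" "lin_indep_cols d n A \<sigma>" "card \<sigma> = d"
    and b: "b \<in> ivecs d" "rvec b = mvr d n A X" "\<And>t. t \<notin> \<sigma> \<Longrightarrow> X t = 0"
  shows "(\<forall>t. frac (X t) = 0) \<or> (\<exists>k<n. k \<notin> \<sigma> \<and> col d A k = (\<lambda>i. b i - mv d n A (\<lambda>t. \<lfloor>X t\<rfloor>) i) \<and>
    rcol k = mvr d n A (\<lambda>t. frac (X t)) \<and> (\<Sum>t\<in>\<sigma>. frac (X t)) = 1)"
proof -
  have fin: "finite \<sigma>" using \<sigma>(1) finite_subset by blast
  let ?b = "\<lambda>i. b i - mv d n A (\<lambda>t. \<lfloor>X t\<rfloor>) i" and ?\<phi> = "\<lambda>t. frac (X t)"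
  note rb = fractional_part(2)[OF b(1,2)]
  obtain h where hm: "(\<Sum>t\<in>\<sigma>. ?\<phi> t) = real h" and h1: "h = 1 \<longrightarrow> (\<exists>k<n. ?b = col d A k)"
    using graded_lattice_point[OF w fractional_part[OF b(1,2)] _ \<sigma>(1)] b(3) by auto
  have "\<sigma> \<noteq> {}" using \<sigma>(3) d2 by auto
  then have "(\<Sum>t\<in>\<sigma>. ?\<phi> t) < (\<Sum>t\<in>\<sigma>. 1)" using fin by (intro sum_strict_mono) (auto simp: frac_lt_1)
  then have "(\<Sum>t\<in>\<sigma>. ?\<phi> t) < 2" using \<sigma>(3) d2 by simp
  then have "h < 2" using hm by linarith
  then consider "h = 0" | "h = 1" by linarith
  then show ?thesis
  proof cases
    case 1
    then have "(\<Sum>t\<in>\<sigma>. ?\<phi> t) = 0" using hm by simp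
    then have "\<forall>t\<in>\<sigma>. ?\<phi> t = 0" using fin by (simp add: sum_nonneg_eq_0_iff)
    moreover have "?\<phi> t = 0" if "t \<notin> \<sigma>" for t using b(3)[OF that] by simp
    ultimately show ?thesis by blast
  next
    case 2
    then obtain k where k: "k < n" and bk: "col d A k = ?b" using h1 by metis
    have "k \<notin> \<sigma>"
    proof
      assume "k \<in> \<sigma>"
      have "?\<phi> = unit_vec k"
      proof (rule lin_indep_unique[OF \<sigma>(2)])
        show "mvr d n A ?\<phi> = mvr d n A (unit_vec k)" using rb bk k by (simp add: mvr_unit)
        show "unit_vec k j = (0::real)" if "j \<notin> \<sigma>" for j
          using that \<open>k \<in> \<sigma>\<close> by (auto simp: unit_vec_def)
      qed (use b(3) in simp)
      from fun_cong[OF this, of k] show False using frac_lt_1[of "X k"] by simp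
    qed
    moreover have "rcol k = mvr d n A ?\<phi>" using rb bk by simp
    ultimately show ?thesis using k bk hm 2 by auto
  qed
qed

lemma gr_objective_unit_plus:
  assumes "j < n" "j \<notin> \<sigma>" "\<And>t. t \<notin> \<sigma> \<Longrightarrow> z t = 0"
  shows "gr_objective d n A c \<sigma> (\<lambda>i. unit_vec j i + z i) = reduced_cost d A c \<sigma> j"
proof -
  have "gr_objective d n A c \<sigma> (\<lambda>i. unit_vec j i + z i)
      = (\<Sum>i\<in>{..<n} - \<sigma>. reduced_cost d A c \<sigma> i * unit_vec j i)"
    unfolding gr_objective_def using assms by (intro sum.cong) auto
  then show ?thesis using assms by (simp add: sum_unit_vec)
qed

lemma gr_feasible_unit_plus:
  assumes "\<sigma> \<subseteq> {..<n}" "j < n" "\<And>t. t \<notin> \<sigma> \<Longrightarrow> z t = 0"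
    "\<And>i. b i = col d A j i + mv d n A z i"
  shows "gr_feasible d n A \<sigma> b (\<lambda>i. unit_vec j i + z i)"
  unfolding gr_feasible_def
proof (intro conjI allI impI ballI)
  show "unit_vec j i + z i = 0" if "n \<le> i" for i
  proof -
    have "i \<notin> \<sigma>" "i \<noteq> j" using assms(1,2) that by auto
    then show ?thesis using assms(3) by simp
  qed
  show "0 \<le> unit_vec j i + z i" if "i \<in> {..<n} - \<sigma>" for i using assms(3)[of i] that by simp
  show "mv d n A (\<lambda>i. unit_vec j i + z i) = b" using assms(2,4) by (simp add: mv_add mv_unit fun_eq_iff)
qed

text \<open>In a Gomory family each unused column \<open>j\<close> solves its own program through some face \<open>s j\<close>. Its residue in
  the parallelogram of \<open>s j\<close> is again an unused column \<open>m j\<close>, and \<open>m\<close> is a permutation of the unused columns.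
  Summing reduced costs over this permutation shows that \<open>j\<close> lies in the cone of \<open>s j\<close>.\<close>

lemma unused_column_optimal:
  assumes d2: "d = 2" and w: "\<And>j. j < n \<Longrightarrow> dotcol d A w j = 1"
    and reg: "regular_triangulation d n A \<Delta>" and sup: "supports d n A \<Delta> c"
    and j: "j < n" "{j} \<notin> \<Delta>"
  shows "\<exists>\<sigma>. max_face \<Delta> \<sigma> \<and> rcol j \<in> cone \<sigma> \<and> gr_optimal d n A c \<sigma> (col d A j) (unit_vec j)"
proof -
  have tri: "triangulation d n A \<Delta>" using reg by (simp add: regular_triangulation_def)
  have \<Delta>: "\<Delta> = delta d n A c" and gen: "generic d n A c" and gom: "gomory_family d n A c"
    using sup by (auto simp: supports_def)
  note face = max_face_card[OF reg]
  have vert: "{j} \<in> \<Delta>" if "j \<in> \<sigma>" "\<sigma> \<in> \<Delta>" for j \<sigma>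
    using triangulationD(3)[OF tri that(2), of "{j}"] that(1) by simp
  define N where "N = {j. j < n \<and> {j} \<notin> \<Delta>}"
  have finN: "finite N" by (simp add: N_def)
  have N_face: "j \<notin> \<sigma>" if "j \<in> N" "max_face \<Delta> \<sigma>" for j \<sigma>
    using that vert max_faceD by (auto simp: N_def)
  let ?rc = "reduced_cost d A c"
  have "\<exists>\<sigma>. max_face \<Delta> \<sigma> \<and> gr_optimal d n A c \<sigma> (col d A j) (unit_vec j)" if j: "j \<in> N" for j
  proof -
    have jn: "j < n" using j by (simp add: N_def)
    have "col d A j = mv d n A (\<lambda>i. int (unit_vec j i))" using mv_unit[OF jn] by simp
    then have "col d A j \<in> semigroup d n A" unfolding semigroup_iff by blast
    then obtain \<sigma> x where \<sigma>: "max_face \<Delta> \<sigma>" "gr_optimal d n A c \<sigma> (col d A j) x" "\<And>k. k < n \<Longrightarrow> 0 \<le> x k"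
      using gom \<Delta> unfolding gomory_family_def gr_solves_def by metis
    have f: "gr_feasible d n A \<sigma> (col d A j) x" using \<sigma>(2) by (simp add: gr_optimal_def)
    have "mv d n A (\<lambda>i. int (nat (x i))) = col d A j"
      using gr_feasible_ip_feasible(1)[OF f \<sigma>(3)] by (simp add: ip_feasible_def)
    then have u: "nat (x k) = unit_vec j k" if "k < n" for k
      using col_fiber_unique[where w = "\<lambda>i. nat (x i)"] jn that by blast
    have "x k = unit_vec j k" for k
    proof (cases "k < n")
      case True
      then have "x k = int (nat (x k))" using \<sigma>(3) by simp
      also have "\<dots> = unit_vec j k" using u[OF True] by simp
      finally show ?thesis .
    next
      case False
      then show ?thesis using f jn by (auto simp: gr_feasible_def unit_vec_def)
    qed
    then have "x = unit_vec j" by (rule ext)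
    then show ?thesis using \<sigma> by blast
  qed
  then obtain s where s: "\<And>j. j \<in> N \<Longrightarrow> max_face \<Delta> (s j)"
    "\<And>j. j \<in> N \<Longrightarrow> gr_optimal d n A c (s j) (col d A j) (unit_vec j)"
    by metis
  have s_opt: "?rc (s j) j \<le> ?rc (s j) k"
    if j: "j \<in> N" and k: "k < n" "k \<notin> s j" and z: "\<And>t. t \<notin> s j \<Longrightarrow> z t = 0"
      "\<And>i. col d A j i = col d A k i + mv d n A z i" for j k z
  proof -
    have jn: "j < n" "j \<notin> s j" using j N_face[OF j s(1)[OF j]] by (auto simp: N_def)
    have "gr_feasible d n A (s j) (col d A j) (\<lambda>i. unit_vec k i + z i)"
      by (rule gr_feasible_unit_plus[OF face(1)[OF s(1)[OF j]] k(1) z])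
    then have "gr_objective d n A c (s j) (unit_vec j) \<le> gr_objective d n A c (s j) (\<lambda>i. unit_vec k i + z i)"
      using s(2)[OF j] unfolding gr_optimal_def by blast
    moreover have "gr_objective d n A c (s j) (unit_vec j) = ?rc (s j) j"
      using gr_objective_unit_plus[OF jn, of "\<lambda>_. 0"] by simp
    ultimately show ?thesis using gr_objective_unit_plus[where z = z, OF k z(1)] by simp
  qed
  \<comment> \<open>\<open>k\<close> is the residue of \<open>j\<close>, \<open>z\<close> the
    integral shift and \<open>\<phi>\<close> the coordinates of the residue, bundled so that one
    choice yields all three functions. Strict positivity of \<open>\<phi>\<close> puts the residue
    in the relative interior of its face.\<close>
  define R where "R j k z \<phi> \<longleftrightarrow> k \<in> N \<and> (\<forall>t. t \<notin> s j \<longrightarrow> z t = 0) \<and> (\<forall>i. col d A j i = col d A k i + mv d n A z i) \<and>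
      (\<forall>t\<in>s j. 0 < \<phi> t) \<and> (\<forall>t. 0 \<le> \<phi> t) \<and> (\<forall>t. t \<notin> s j \<longrightarrow> \<phi> t = 0) \<and> rcol k = mvr d n A \<phi>"
    for j k z \<phi>
  have "\<exists>k z \<phi>. R j k z \<phi>" if j: "j \<in> N" for j
  proof -
    note sj = s(1)[OF j]
    have jn: "j < n" "j \<notin> s j" using j N_face[OF j sj] by (auto simp: N_def)
    have "\<exists>X. (\<forall>t. t \<notin> s j \<longrightarrow> X t = 0) \<and> mvr d n A X = rcol j"
      by (rule basis_coordinates[OF face(2,1,3)[OF sj]]) (simp add: rvec_def col_def)
    then obtain X where X: "\<And>t. t \<notin> s j \<Longrightarrow> X t = 0" "rcol j = mvr d n A X" by metis
    let ?z = "\<lambda>t. \<lfloor>X t\<rfloor>" and ?\<phi> = "\<lambda>t. frac (X t)"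
    have z0: "?z t = 0" if "t \<notin> s j" for t using X(1)[OF that] by simp
    from floor_residue[OF d2 w face[OF sj] col_ivecs X(2) X(1)]
    consider "\<forall>t. ?\<phi> t = 0" | k where "k < n" "k \<notin> s j" "col d A k = (\<lambda>i. col d A j i - mv d n A ?z i)"
      "rcol k = mvr d n A ?\<phi>" "(\<Sum>t\<in>s j. ?\<phi> t) = 1" by blast
    then show ?thesis
    proof cases
      \<comment> \<open>With zero residue, column \<open>j\<close> is an integer combination of the
        face with objective 0. This undercuts the positive reduced cost of \<open>j\<close>,
        contradicting optimality.\<close>
      case 1
      then have "X = (\<lambda>t. real_of_int (?z t))" by (auto simp: frac_def)
      then have "rcol j = mvr d n A (\<lambda>t. real_of_int (?z t))" using X(2) by simp
      then have cz: "col d A j = mv d n A ?z" unfolding rvec_mv[symmetric] rvec_inject .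
      have f: "gr_feasible d n A (s j) (col d A j) ?z"
        unfolding gr_feasible_def
      proof (intro conjI allI impI ballI)
        show "?z i = 0" if "n \<le> i" for i
        proof (rule z0)
          show "i \<notin> s j" using face(1)[OF sj] that by auto
        qed
        show "0 \<le> ?z i" if "i \<in> {..<n} - s j" for i using z0[of i] that by simp
        show "mv d n A ?z = col d A j" using cz by simp
      qed
      have "gr_objective d n A c (s j) ?z = 0" unfolding gr_objective_def using z0 by (intro sum.neutral) auto
      moreover have "gr_objective d n A c (s j) (unit_vec j) = ?rc (s j) j"
        using gr_objective_unit_plus[OF jn, of "\<lambda>_. 0"] by simp
      moreover have "0 < ?rc (s j) j" using reduced_cost_pos[OF full_rank _ jn, of c] sj \<Delta> by simp
      ultimately show ?thesis using s(2)[OF j] f unfolding gr_optimal_def by fastforce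
    next
      case (2 k)
      have "rcol k \<in> cone (s j)"
        using 2(4) X(1) by (intro cone_ofI[of _ _ _ _ ?\<phi>]) auto
      then have "k \<in> N" using 2(1,2) triangulation_vertex[OF tri max_faceD[OF sj]] by (auto simp: N_def)
      moreover have "0 < ?\<phi> t" if t: "t \<in> s j" for t
      proof -
        have cs: "card (s j) = 2" "finite (s j)" using face(3)[OF sj] d2 by (auto intro: card_ge_0_finite)
        obtain t' where t': "s j = {t, t'}" "t \<noteq> t'"
          using cs(1) t unfolding card_2_iff by (metis insertE insert_commute singletonD)
        then have "?\<phi> t + ?\<phi> t' = 1" using 2(5) by simp
        then show ?thesis using frac_lt_1[of "X t'"] by linarith
      qed
      moreover have "\<forall>i. col d A j i = col d A k i + mv d n A ?z i" using 2(3) by simp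
      moreover have "\<forall>t. t \<notin> s j \<longrightarrow> ?\<phi> t = 0" using X(1) by simp
      moreover have "\<forall>t. 0 \<le> ?\<phi> t" by simp
      ultimately have "R j k ?z ?\<phi>" using z0 2(4) unfolding R_def by blast
      then show ?thesis by blast
    qed
  qed
  then have "\<forall>j\<in>N. \<exists>p. R j (fst p) (fst (snd p)) (snd (snd p))" by simp
  then obtain p where p: "\<forall>j\<in>N. R j (fst (p j)) (fst (snd (p j))) (snd (snd (p j)))"
    by (rule bchoice[THEN exE])
  define m where "m j = fst (p j)" for j
  define z where "z j = fst (snd (p j))" for j
  define \<phi> where "\<phi> j = snd (snd (p j))" for j
  have m: "\<And>j. j \<in> N \<Longrightarrow> m j \<in> N"
    "\<And>j t. j \<in> N \<Longrightarrow> t \<notin> s j \<Longrightarrow> z j t = 0"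
    "\<And>j i. j \<in> N \<Longrightarrow> col d A j i = col d A (m j) i + mv d n A (z j) i"
    "\<And>j t. j \<in> N \<Longrightarrow> t \<in> s j \<Longrightarrow> 0 < \<phi> j t" "\<And>j t. j \<in> N \<Longrightarrow> 0 \<le> \<phi> j t"
    "\<And>j t. j \<in> N \<Longrightarrow> t \<notin> s j \<Longrightarrow> \<phi> j t = 0"
    "\<And>j. j \<in> N \<Longrightarrow> rcol (m j) = mvr d n A (\<phi> j)"
    using p unfolding R_def m_def[symmetric] z_def[symmetric] \<phi>_def[symmetric] by blast+
  have m_cone: "rcol (m j) \<in> cone (s j)" if "j \<in> N" for j
    using m(5,6,7)[OF that] by (intro cone_ofI[of _ _ _ _ "\<phi> j"])
  \<comment> \<open>An interior point determines its face, so equal residues give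
    \<open>s j = s j'\<close>. Then \<open>j\<close> and \<open>j'\<close> differ by an integral
    vector on that face, each is at most as expensive as the other, and uniqueness of the optimum of
    the relaxation makes them equal.\<close>
  have inj: "inj_on m N"
  proof (rule inj_onI, rule ccontr)
    fix j j' assume jj: "j \<in> N" "j' \<in> N" "m j = m j'" "j \<noteq> j'"
    have "s a \<subseteq> s a'" if "a \<in> N" "a' \<in> N" "m a = m a'" for a a'
    proof
      fix t assume t: "t \<in> s a"
      show "t \<in> s a'"
      proof (rule ccontr)
        assume "t \<notin> s a'"
        have "\<phi> a t = 0"
          by (rule triangulation_support[OF tri max_faceD[OF s(1)[OF that(2)]] max_faceD[OF s(1)[OF that(1)]]])
            (use m(5,6)[OF that(1)] m(7)[OF that(1)] m_cone[OF that(2)] that(3) \<open>t \<notin> s a'\<close> in auto)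
        then show False using m(4)[OF that(1) t] by simp
      qed
    qed
    from this[of j j'] this[of j' j] have ss: "s j = s j'" using jj by (auto simp: equalityI)
    let ?z = "\<lambda>t. z j t - z j' t"
    have c1: "col d A j i = col d A j' i + mv d n A ?z i" for i
      using m(3)[OF jj(1), of i] m(3)[OF jj(2), of i] jj(3) by (simp add: mv_diff)
    have z0: "?z t = 0" if "t \<notin> s j" for t using m(2)[OF jj(1) that] m(2)[OF jj(2)] that ss by simp
    have out: "j < n" "j' < n" "j \<notin> s j" "j' \<notin> s j" "j' \<notin> s j'" "j \<notin> s j'"
      using jj N_face s(1) ss by (auto simp: N_def)
    have le1: "?rc (s j) j \<le> ?rc (s j) j'" by (rule s_opt[OF jj(1) out(2,4) z0 c1])
    have "?rc (s j') j' \<le> ?rc (s j') j"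
    proof (rule s_opt[OF jj(2) out(1,6), where z = "\<lambda>t. z j' t - z j t"])
      show "z j' t - z j t = 0" if "t \<notin> s j'" for t using z0[of t] that ss by simp
      show "col d A j' i = col d A j i + mv d n A (\<lambda>t. z j' t - z j t) i" for i
        using c1[of i] by (simp add: mv_diff)
    qed
    then have eq: "?rc (s j) j = ?rc (s j) j'" using le1 ss by simp
    let ?x = "\<lambda>i. unit_vec j' i + ?z i"
    have "gr_objective d n A c (s j) (unit_vec j) = ?rc (s j) j"
      using gr_objective_unit_plus[OF out(1,3), of "\<lambda>_. 0"] by simp
    moreover have "gr_objective d n A c (s j) ?x = ?rc (s j) j'"
      by (rule gr_objective_unit_plus[OF out(2,4) z0])
    moreover have "gr_feasible d n A (s j) (col d A j) ?x"
      by (rule gr_feasible_unit_plus[OF face(1)[OF s(1)[OF jj(1)]] out(2) z0 c1])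
    ultimately have "gr_optimal d n A c (s j) (col d A j) ?x"
      using s(2)[OF jj(1)] eq unfolding gr_optimal_def by simp
    then have "unit_vec j = ?x"
      using gr_optimal_unique[OF full_rank _ gen s(2)[OF jj(1)]] s(1)[OF jj(1)] \<Delta> by blast
    from fun_cong[OF this, of j] show False using z0[OF out(3)] jj(4) by simp
  qed
  have mN: "m ` N = N" by (rule endo_inj_surj[OF finN _ inj]) (use m(1) in auto)
  obtain L where L: "\<And>j t. 0 \<le> L j t" "\<And>j. j < n \<Longrightarrow> mvr d n A (L j) = rcol j"
    "\<And>j \<sigma> t. j < n \<Longrightarrow> \<sigma> \<in> \<Delta> \<Longrightarrow> rcol j \<in> cone \<sigma> \<Longrightarrow> t \<notin> \<sigma> \<Longrightarrow> L j t = 0"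
    "\<And>j. j < n \<Longrightarrow> \<exists>\<sigma>. max_face \<Delta> \<sigma> \<and> rcol j \<in> cone \<sigma>"
    using triangulation_coordinates[OF tri] by metis
  \<comment> \<open>The reduced cost of \<open>j\<close> splits into \<open>e j\<close>, its excess
    over the interpolated cost, which is independent of the face, and
    \<open>g j \<sigma> \<ge> 0\<close>, which vanishes only if the coordinates of \<open>j\<close>
    are supported on \<open>\<sigma>\<close>. The residue \<open>m j\<close> lies in the cone of
    \<open>s j\<close>, so its reduced cost there is just \<open>e (m j)\<close>. In the sum the
    \<open>e\<close> terms cancel and the \<open>g\<close> terms are left with a nonpositive
    total.\<close>
  define e where "e j = c j - (\<Sum>t<n. L j t * c t)" for j
  define g where "g j \<sigma> = (\<Sum>t<n. L j t * ?rc \<sigma> t)" for j \<sigma>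
  have rc_e: "?rc \<sigma> j = e j + g j \<sigma>" if "j < n" for j \<sigma>
    unfolding e_def g_def reduced_cost_def dotcol_coordinates[OF L(2)[OF that], of "dual_vec d A c \<sigma>"]
    by (simp add: right_diff_distrib sum_subtractf)
  have g_nonneg: "0 \<le> L j t * ?rc \<sigma> t" if "max_face \<Delta> \<sigma>" "t < n" for j \<sigma> t
    using L(1)[of j t] reduced_cost_nonneg[OF full_rank, of c \<sigma> t] that \<Delta> by simp
  have rc_m: "?rc (s j) (m j) = e (m j)" if j: "j \<in> N" for j
  proof -
    have mn: "m j < n" using m(1)[OF j] by (simp add: N_def)
    have "L (m j) t * ?rc (s j) t = 0" for t
      using L(3)[OF mn max_faceD[OF s(1)[OF j]] m_cone[OF j], of t]
        reduced_cost_zero[OF full_rank, of c "s j" t] s(1)[OF j] \<Delta>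
      by (cases "t \<in> s j") auto
    then have "g (m j) (s j) = 0" unfolding g_def by (intro sum.neutral) blast
    then show ?thesis using rc_e[OF mn] by simp
  qed
  have "(\<Sum>j\<in>N. e j) + (\<Sum>j\<in>N. g j (s j)) = (\<Sum>j\<in>N. ?rc (s j) j)"
    unfolding sum.distrib[symmetric] by (intro sum.cong refl) (simp add: rc_e N_def)
  also have "\<dots> \<le> (\<Sum>j\<in>N. e (m j))"
  proof (intro sum_mono)
    fix j assume j: "j \<in> N"
    have mn: "m j < n" "m j \<notin> s j" using m(1)[OF j] N_face s(1)[OF j] by (auto simp: N_def)
    have "?rc (s j) j \<le> ?rc (s j) (m j)"
      by (rule s_opt[OF j mn m(2)[OF j] m(3)[OF j]])
    then show "?rc (s j) j \<le> e (m j)" using rc_m[OF j] by simp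
  qed
  also have "\<dots> = (\<Sum>j\<in>N. e j)" using sum.reindex[OF inj, of e] mN by simp
  finally have "(\<Sum>j\<in>N. g j (s j)) \<le> 0" by simp
  moreover have g0: "0 \<le> g j (s j)" if "j \<in> N" for j
    unfolding g_def using g_nonneg[OF s(1)[OF that]] by (intro sum_nonneg) auto
  ultimately have "g j (s j) = 0" if "j \<in> N" for j
    using sum_nonneg_eq_0_iff[OF finN, of "\<lambda>j. g j (s j)"] sum_nonneg[of N "\<lambda>j. g j (s j)"] that
    by (metis (no_types, lifting) order_antisym)
  moreover have jN: "j \<in> N" using j by (simp add: N_def)
  ultimately have gj: "g j (s j) = 0" by blast
  have "L j t = 0" if "t \<notin> s j" for t
  proof (cases "t < n")
    case True
    have "L j t * ?rc (s j) t = 0"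
      using gj g_nonneg[OF s(1)[OF jN]] True unfolding g_def
      by (subst (asm) sum_nonneg_eq_0_iff) auto
    moreover have "0 < ?rc (s j) t" using reduced_cost_pos[OF full_rank _ True that, of c] s(1)[OF jN] \<Delta> by simp
    ultimately show ?thesis by simp
  next
    case False
    obtain \<sigma> where \<sigma>: "max_face \<Delta> \<sigma>" "rcol j \<in> cone \<sigma>" using L(4)[OF j(1)] by blast
    then have "t \<notin> \<sigma>" using face(1)[OF \<sigma>(1)] False by auto
    then show ?thesis using L(3)[OF j(1) max_faceD[OF \<sigma>(1)] \<sigma>(2)] by blast
  qed
  then have "rcol j \<in> cone (s j)"
    using L(1,2) j(1) by (intro cone_ofI[of _ _ _ _ "L j"]) auto
  then show ?thesis using s jN by blast
qed

text \<open>No cost vector occurs here. Identifying the optima of every supporting cost with this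
  set is what makes them all coincide.\<close>

definition plane_optima :: "nat set set \<Rightarrow> (nat \<Rightarrow> nat) set" where
  "plane_optima \<Delta> = {x \<in> natvecs n. \<exists>\<sigma>. max_face \<Delta> \<sigma> \<and> ((\<forall>i. i \<notin> \<sigma> \<longrightarrow> x i = 0) \<or>
     (\<exists>j<n. j \<notin> \<sigma> \<and> rcol j \<in> cone \<sigma> \<and> (\<forall>i. i \<notin> \<sigma> \<longrightarrow> x i = unit_vec j i)))}"

text \<open>A point supported on \<open>\<sigma>\<close> has objective 0, the least possible value.
  Otherwise the point is an optimal unit vector translated along \<open>\<sigma>\<close>, and such
  translations preserve optimality in the relaxation of \<open>\<sigma>\<close>.\<close>

lemma plane_optima_optimal:
  assumes d2: "d = 2" and w: "\<And>j. j < n \<Longrightarrow> dotcol d A w j = 1"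
    and reg: "regular_triangulation d n A \<Delta>" and sup: "supports d n A \<Delta> c"
    and x: "x \<in> plane_optima \<Delta>"
  shows "ip_optimal d n A c (mv d n A (\<lambda>j. int (x j))) x"
proof -
  let ?b = "mv d n A (\<lambda>j. int (x j))"
  have tri: "triangulation d n A \<Delta>" using reg by (simp add: regular_triangulation_def)
  have \<Delta>: "\<Delta> = delta d n A c" using sup by (simp add: supports_def)
  note face = max_face_card[OF reg]
  have xn: "x \<in> natvecs n" using x by (simp add: plane_optima_def)
  have feas: "gr_feasible d n A \<sigma> ?b (\<lambda>j. int (x j))" for \<sigma>
    using xn by (auto simp: gr_feasible_def natvecs_def)
  have "\<exists>\<sigma>. max_face \<Delta> \<sigma> \<and> gr_optimal d n A c \<sigma> ?b (\<lambda>j. int (x j))"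
  proof -
    obtain \<sigma> where \<sigma>: "max_face \<Delta> \<sigma>" and cases: "(\<forall>i. i \<notin> \<sigma> \<longrightarrow> x i = 0) \<or>
      (\<exists>j<n. j \<notin> \<sigma> \<and> rcol j \<in> cone \<sigma> \<and> (\<forall>i. i \<notin> \<sigma> \<longrightarrow> x i = unit_vec j i))"
      using x unfolding plane_optima_def by blast
    have \<sigma>c: "max_face (delta d n A c) \<sigma>" using \<sigma> \<Delta> by simp
    from cases show ?thesis
    proof
      assume 0: "\<forall>i. i \<notin> \<sigma> \<longrightarrow> x i = 0"
      have "gr_objective d n A c \<sigma> (\<lambda>j. int (x j)) = 0"
        unfolding gr_objective_def using 0 by (intro sum.neutral) auto
      moreover have "0 \<le> gr_objective d n A c \<sigma> z" if "gr_feasible d n A \<sigma> ?b z" for z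
        unfolding gr_objective_def using that reduced_cost_nonneg[OF full_rank \<sigma>c]
        by (intro sum_nonneg mult_nonneg_nonneg) (auto simp: gr_feasible_def)
      ultimately show ?thesis using feas \<sigma> unfolding gr_optimal_def by metis
    next
      assume "\<exists>j<n. j \<notin> \<sigma> \<and> rcol j \<in> cone \<sigma> \<and> (\<forall>i. i \<notin> \<sigma> \<longrightarrow> x i = unit_vec j i)"
      then obtain j where j: "j < n" "j \<notin> \<sigma>" "rcol j \<in> cone \<sigma>"
        "\<And>i. i \<notin> \<sigma> \<Longrightarrow> x i = unit_vec j i" by blast
      have "{j} \<notin> \<Delta>" using triangulation_vertex[OF tri max_faceD[OF \<sigma>]] j by blast
      then obtain \<tau> where \<tau>: "max_face \<Delta> \<tau>" "rcol j \<in> cone \<tau>"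
        "gr_optimal d n A c \<tau> (col d A j) (unit_vec j)"
        using unused_column_optimal[OF d2 w reg sup j(1)] by blast
      obtain X where X: "rcol j = mvr d n A X" "\<And>t. 0 \<le> X t" "\<And>t. t \<notin> \<sigma> \<Longrightarrow> X t = 0"
        using j(3) cone_ofE by blast
      \<comment> \<open>The face that solves column \<open>j\<close> must be the face whose cone was
        given. If it missed an edge of \<open>\<sigma>\<close>, column \<open>j\<close> would lie on
        the ray of the other edge, and parallel columns coincide.\<close>
      have "\<sigma> \<subseteq> \<tau>"
      proof (rule subsetI, rule ccontr)
        fix t assume t: "t \<in> \<sigma>" "t \<notin> \<tau>"
        have "X t = 0"
          by (rule triangulation_support[OF tri max_faceD[OF \<tau>(1)] max_faceD[OF \<sigma>]])
            (use X \<tau>(2) t in auto)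
        obtain t' where t': "\<sigma> = {t, t'}" "t \<noteq> t'"
          using face(3)[OF \<sigma>] t(1) unfolding d2 card_2_iff by (metis insertE insert_commute singletonD)
        have tn: "t' < n" using t' face(1)[OF \<sigma>] by auto
        have "X = (\<lambda>i. X t' * unit_vec t' i)"
        proof
          fix i
          show "X i = X t' * unit_vec t' i"
            using X(3)[of i] \<open>X t = 0\<close> t' by (cases "i = t'"; cases "i = t") auto
        qed
        then have "mvr d n A X = mvr d n A (\<lambda>i. X t' * unit_vec t' i)" by (rule arg_cong)
        then have par: "rcol j = (\<lambda>i. X t' * rcol t' i)"
          unfolding mvr_scale mvr_unit[OF tn] X(1) .
        have "X t' \<noteq> 0"
        proof
          assume "X t' = 0"
          then have "rcol j = rvec (\<lambda>i. 0)" using par by (simp add: rvec_def)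
          then show False using col_nonzero[OF j(1)] by (simp only: rvec_inject)
        qed
        then have "0 < X t'" using X(2)[of t'] by linarith
        then have "j = t'" using columns_not_parallel[OF j(1) tn par] by blast
        then show False using j(2) t' by blast
      qed
      then have "\<tau> = \<sigma>" using \<sigma> \<tau>(1) unfolding max_face_def by blast
      then have opt: "gr_optimal d n A c \<sigma> (col d A j) (unit_vec j)" using \<tau>(3) by simp
      let ?v = "\<lambda>i. int (x i) - unit_vec j i"
      have v0: "?v i = 0" if "i \<notin> \<sigma>" for i using j(4)[OF that] by simp
      have "gr_optimal d n A c \<sigma> ?b (\<lambda>j. int (x j))"
        unfolding gr_optimal_iff[OF full_rank \<sigma>c]
      proof (intro conjI allI impI feas)
        fix z assume z: "gr_feasible d n A \<sigma> ?b z"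
        have "gr_feasible d n A \<sigma> (col d A j) (\<lambda>i. z i - ?v i)"
          unfolding gr_feasible_def
        proof (intro conjI allI impI ballI)
          show "z i - ?v i = 0" if "n \<le> i" for i
            using that z v0[of i] face(1)[OF \<sigma>] by (force simp: gr_feasible_def)
          show "0 \<le> z i - ?v i" if "i \<in> {..<n} - \<sigma>" for i
            using that z v0[of i] by (simp add: gr_feasible_def)
          show "mv d n A (\<lambda>i. z i - ?v i) = col d A j"
            unfolding mv_diff using z j(1) by (simp add: gr_feasible_def mv_unit)
        qed
        then have "(\<Sum>i<n. c i * of_int (unit_vec j i)) \<le> (\<Sum>i<n. c i * of_int (z i - ?v i))"
          using opt unfolding gr_optimal_iff[OF full_rank \<sigma>c] by blast
        then show "(\<Sum>i<n. c i * of_int (int (x i))) \<le> (\<Sum>i<n. c i * of_int (z i))"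
          by (simp add: right_diff_distrib sum_subtractf)
      qed
      then show ?thesis using \<sigma> by blast
    qed
  qed
  then obtain \<sigma> where "max_face (delta d n A c) \<sigma>" "gr_optimal d n A c \<sigma> ?b (\<lambda>j. int (x j))"
    using \<Delta> by blast
  from gr_optimal_ip_optimal[OF full_rank this] show ?thesis by simp
qed

text \<open>Rounding down in the cone of a face produces a member of \<open>plane_optima\<close> in
  every fiber. Being optimal there, it is the unique optimum by genericity.\<close>

lemma optimal_set_plane:
  assumes d2: "d = 2" and w: "\<And>j. j < n \<Longrightarrow> dotcol d A w j = 1"
    and reg: "regular_triangulation d n A \<Delta>" and sup: "supports d n A \<Delta> c"
  shows "optimal_set d n A c = plane_optima \<Delta>"
proof (intro equalityI subsetI)
  fix x assume x: "x \<in> plane_optima \<Delta>"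
  have "ip_optimal d n A c (mv d n A (\<lambda>j. int (x j))) x" by (rule plane_optima_optimal[OF d2 w reg sup x])
  then show "x \<in> optimal_set d n A c"
    unfolding optimal_set_def ip_optimal_def using ip_feasible_semigroup by blast
next
  have tri: "triangulation d n A \<Delta>" using reg by (simp add: regular_triangulation_def)
  note face = max_face_card[OF reg]
  fix x assume "x \<in> optimal_set d n A c"
  then obtain b where b: "b \<in> semigroup d n A" "ip_optimal d n A c b x" unfolding optimal_set_def by blast
  have bl: "b \<in> ivecs d" "rvec b \<in> coneA d n A" using b(1) semigroup_eq by (auto simp: lattice_pts_def)
  obtain \<sigma> where \<sigma>: "max_face \<Delta> \<sigma>" "rvec b \<in> cone \<sigma>" using triangulation_cover[OF tri bl(2)] by blast
  obtain X where X: "rvec b = mvr d n A X" "\<And>t. 0 \<le> X t" "\<And>t. t \<notin> \<sigma> \<Longrightarrow> X t = 0"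
    using \<sigma>(2) cone_ofE by blast
  define f where "f t = nat \<lfloor>X t\<rfloor>" for t
  have fX: "int (f t) = \<lfloor>X t\<rfloor>" for t using X(2)[of t] by (simp add: f_def)
  have f0: "f t = 0" if "t \<notin> \<sigma>" for t using X(3)[OF that] by (simp add: f_def)
  have fn: "f t = 0" if "n \<le> t" for t using f0[of t] face(1)[OF \<sigma>(1)] that by force
  have "\<exists>x'\<in>plane_optima \<Delta>. mv d n A (\<lambda>j. int (x' j)) = b"
  proof -
    from floor_residue[OF d2 w face[OF \<sigma>(1)] bl(1) X(1) X(3)]
    consider "\<forall>t. frac (X t) = 0" | k where "k < n" "k \<notin> \<sigma>" "col d A k = (\<lambda>i. b i - mv d n A (\<lambda>t. \<lfloor>X t\<rfloor>) i)"
      "rcol k = mvr d n A (\<lambda>t. frac (X t))" by blast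
    then show ?thesis
    proof cases
      case 1
      then have "X = (\<lambda>t. real_of_int \<lfloor>X t\<rfloor>)" by (auto simp: frac_def)
      then have "rvec b = mvr d n A (\<lambda>t. real_of_int \<lfloor>X t\<rfloor>)" using X(1) by simp
      then have "b = mv d n A (\<lambda>t. \<lfloor>X t\<rfloor>)" unfolding rvec_mv[symmetric] rvec_inject .
      then have "mv d n A (\<lambda>j. int (f j)) = b" by (simp add: fX)
      moreover have "f \<in> plane_optima \<Delta>" using f0 fn \<sigma>(1) by (auto simp: plane_optima_def natvecs_def)
      ultimately show ?thesis by blast
    next
      case (2 k)
      let ?x = "\<lambda>t. f t + unit_vec k t"
      have "mv d n A (\<lambda>j. int (?x j)) = b"
        using 2(1,3) by (simp add: mv_add mv_unit fX)
      moreover have "rcol k \<in> cone \<sigma>"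
        using 2(4) X(3) by (intro cone_ofI[of _ _ _ _ "\<lambda>t. frac (X t)"]) auto
      then have "?x \<in> plane_optima \<Delta>"
        using f0 fn \<sigma>(1) 2(1,2) by (auto simp: plane_optima_def natvecs_def intro!: exI[of _ \<sigma>] exI[of _ k])
      ultimately show ?thesis by (intro bexI[of _ ?x])
    qed
  qed
  then obtain x' where x': "x' \<in> plane_optima \<Delta>" "mv d n A (\<lambda>j. int (x' j)) = b" by blast
  have "ip_optimal d n A c b x'" using plane_optima_optimal[OF d2 w reg sup x'(1)] x'(2) by simp
  moreover have "\<exists>!x. ip_optimal d n A c b x" using sup b(1) unfolding supports_def generic_def by blast
  ultimately have "x = x'" using b(2) by blast
  then show "x \<in> plane_optima \<Delta>" using x'(1) by simp
qed

theorem graded_plane_unique: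
  assumes "d = 2" "graded d n A" "regular_triangulation d n A \<Delta>"
  shows "\<exists>!S. \<exists>c. supports d n A \<Delta> c \<and> S = optimal_set d n A c"
proof -
  obtain w where "\<forall>j<n. dotcol d A w j = 1" using graded_height[OF assms(2)] by blast
  then have eq: "optimal_set d n A c = plane_optima \<Delta>" if "supports d n A \<Delta> c" for c
    using optimal_set_plane[OF assms(1) _ assms(3) that] by blast
  moreover obtain c where "supports d n A \<Delta> c" using low_dim_supports assms by blast
  ultimately show ?thesis by metis
qed

end

subsection \<open>Criteria for concrete matrices\<close>

text \<open>A functional positive on all columns yields the trivial kernel and pointedness.
  Irreducibility puts every column into every Hilbert basis, so the columns form the least one,
  hence the only minimal one.\<close>

lemma standingI:
  assumes rank: "full_row_rank d n A"
    and pos: "\<And>j. j < n \<Longrightarrow> 0 < dotcol d A w j"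
    and lattice: "\<And>b. b \<in> ivecs d \<Longrightarrow> \<exists>u. b = mv d n A u"
    and normal: "\<And>b. b \<in> ivecs d \<Longrightarrow> rvec b \<in> coneA d n A \<Longrightarrow> \<exists>u. b = mv d n A (\<lambda>j. int (u j))"
    and irred: "\<And>u j k. j < n \<Longrightarrow> mv d n A (\<lambda>i. int (u i)) = col d A j \<Longrightarrow> k < n \<Longrightarrow> u k = unit_vec j k"
  shows "standing d n A"
proof -
  let ?K = "coneA d n A" and ?H = "col d A ` {..<n}"
  have kernel: "x j = 0" if x: "\<And>j. j < n \<Longrightarrow> 0 \<le> x j" "mvr d n A x = (\<lambda>i. 0)" and j: "j < n" for x j
  proof -
    have nn: "0 \<le> x j * dotcol d A w j" if "j < n" for j using x(1)[OF that] pos[OF that] by simp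
    have "(\<Sum>j<n. x j * dotcol d A w j) = 0"
      using dot_mvr[where y = w and x = x and d = d and n = n and A = A] x(2) by simp
    then have "x j * dotcol d A w j = 0" using nn j by (subst (asm) sum_nonneg_eq_0_iff) auto
    then show ?thesis using pos[OF j] by simp
  qed
  have pointed: "pointed_cone ?K"
    unfolding pointed_cone_def
  proof (intro allI impI, elim conjE)
    fix v assume v: "v \<in> ?K" "(\<lambda>i. - v i) \<in> ?K"
    obtain x where x: "v = mvr d n A x" "\<And>j. 0 \<le> x j" using v(1) cone_ofE unfolding coneA_def by blast
    obtain y where y: "(\<lambda>i. - v i) = mvr d n A y" "\<And>j. 0 \<le> y j"
      using v(2) cone_ofE unfolding coneA_def by blast
    have "mvr d n A (\<lambda>j. x j + y j) = (\<lambda>i. 0)" unfolding mvr_add x(1)[symmetric] y(1)[symmetric] by simp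
    then have "x j + y j = 0" if "j < n" for j
      by (rule kernel[where x = "\<lambda>j. x j + y j", rotated]) (use x y that in auto)
    then have "x j = 0" if "j < n" for j using x(2)[of j] y(2)[of j] that by (metis add_nonneg_eq_0_iff)
    then have "mvr d n A x = mvr d n A (\<lambda>j. 0)" by (intro mvr_cong)
    then show "v = (\<lambda>i. 0)" using x(1) by simp
  qed
  have sg: "semigroup d n A = lattice_pts d ?K"
  proof (intro equalityI subsetI)
    fix b assume "b \<in> semigroup d n A"
    then obtain u where u: "b = mv d n A (\<lambda>j. int (u j))" by (auto simp: semigroup_iff)
    have "rvec b \<in> ?K" unfolding u rvec_mv by (intro mvr_in_coneA) simp
    then show "b \<in> lattice_pts d ?K" using u by (simp add: lattice_pts_def)
  next
    fix b assume "b \<in> lattice_pts d ?K"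
    then show "b \<in> semigroup d n A" using normal unfolding lattice_pts_def semigroup_iff by blast
  qed
  have inj: "inj_on (col d A) {..<n}"
  proof (rule inj_onI)
    fix i j assume ij: "i \<in> {..<n}" "j \<in> {..<n}" "col d A i = col d A j"
    then have "mv d n A (\<lambda>k. int (unit_vec i k)) = col d A j" by (simp add: mv_unit)
    then have "unit_vec i i = (unit_vec j i :: nat)" using irred[of j "unit_vec i" i] ij by simp
    then show "i = j" by (metis unit_vec_simps(1,3) zero_neq_one)
  qed
  have col_lat: "col d A j \<in> lattice_pts d ?K" if "j < n" for j
    unfolding sg[symmetric] semigroup_iff using that mv_unit[OF that, of d A] by (intro exI[of _ "unit_vec j"]) simp
  have hbH: "hilbert_basis d ?K ?H"
    unfolding hilbert_basis_def
  proof (intro conjI ballI)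
    show "?H \<subseteq> lattice_pts d ?K" using col_lat by auto
    fix b assume "b \<in> lattice_pts d ?K"
    then obtain u where "b = mv d n A (\<lambda>j. int (u j))" unfolding sg[symmetric] semigroup_iff by blast
    then show "\<exists>m. b = (\<lambda>i. \<Sum>h\<in>?H. int (m h) * h i)" using hilbert_combination[OF inj, of n u] by simp
  qed simp
  \<comment> \<open>Expanding the members of \<open>H\<close> in columns turns an expansion of
    column \<open>j\<close> over \<open>H\<close> into one over columns, which is trivial by
    irreducibility. So a member of positive multiplicity that uses column \<open>j\<close> uses
    nothing else.\<close>
  have mem: "col d A j \<in> H" if H: "hilbert_basis d ?K H" and j: "j < n" for H j
  proof -
    have fin: "finite H" and "H \<subseteq> semigroup d n A" using H unfolding sg by (auto simp: hilbert_basis_def)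
    then have "\<exists>u. h = mv d n A (\<lambda>j. int (u j))" if "h \<in> H" for h
      using that semigroup_iff[of h d n A] by blast
    then have "\<forall>h\<in>H. \<exists>u. h = mv d n A (\<lambda>j. int (u j))" by blast
    then obtain U where U: "\<forall>h\<in>H. h = mv d n A (\<lambda>j. int (U h j))" by (rule bchoice[THEN exE])
    obtain m where m: "col d A j = (\<lambda>i. \<Sum>h\<in>H. int (m h) * h i)"
      using H col_lat[OF j] unfolding hilbert_basis_def by blast
    let ?u = "\<lambda>k. \<Sum>h\<in>H. m h * U h k"
    have "mv d n A (\<lambda>k. int (?u k)) = col d A j"
    proof
      fix i
      have "(\<Sum>k<n. A i k * int (?u k)) = (\<Sum>k<n. \<Sum>h\<in>H. int (m h) * (A i k * int (U h k)))"
        by (simp add: sum_distrib_left mult_ac)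
      also have "\<dots> = (\<Sum>h\<in>H. \<Sum>k<n. int (m h) * (A i k * int (U h k)))" by (rule sum.swap)
      also have "\<dots> = (\<Sum>h\<in>H. int (m h) * (\<Sum>k<n. A i k * int (U h k)))" by (simp add: sum_distrib_left)
      finally have s: "(\<Sum>k<n. A i k * int (?u k)) = (\<Sum>h\<in>H. int (m h) * (\<Sum>k<n. A i k * int (U h k)))" .
      have "(\<Sum>h\<in>H. int (m h) * h i) = (\<Sum>h\<in>H. int (m h) * mv d n A (\<lambda>j. int (U h j)) i)"
        using U by (intro sum.cong refl arg_cong[where f = "\<lambda>t. _ * t"]) (rule fun_cong, blast)
      then show "mv d n A (\<lambda>k. int (?u k)) i = col d A j i"
        unfolding m mv_def s by simp
    qed
    then have u: "?u k = unit_vec j k" if "k < n" for k using irred[of j ?u k] j that by blast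
    have "?u j \<noteq> 0" using u[OF j] by simp
    then obtain h where h: "h \<in> H" "m h * U h j \<noteq> 0" by (meson sum.neutral)
    have le: "m h * U h k \<le> unit_vec j k" if "k < n" for k
      using member_le_sum[OF h(1), of "\<lambda>h. m h * U h k"] fin u[OF that] by simp
    have "U h k = unit_vec j k" if "k < n" for k
    proof (cases "k = j")
      case True
      have "m h * U h j \<le> 1" using le[OF j] by simp
      then have "m h * U h j = 1" using h(2) by linarith
      then show ?thesis using True by simp
    next
      case False
      then show ?thesis using le[OF that] h(2) by simp
    qed
    then have "mv d n A (\<lambda>k. int (U h k)) = mv d n A (unit_vec j)" by (intro mv_cong) simp
    then have "h = col d A j" using U h(1) mv_unit[OF j] by metis
    then show ?thesis using h(1) by simp
  qed
  have "minimal_hilbert_basis d ?K H \<longleftrightarrow> H = ?H" for H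
  proof
    assume H: "minimal_hilbert_basis d ?K H"
    then have "?H \<subseteq> H" using mem unfolding minimal_hilbert_basis_def by blast
    then show "H = ?H" using H hbH unfolding minimal_hilbert_basis_def by blast
  next
    assume "H = ?H"
    then show "minimal_hilbert_basis d ?K H" using hbH mem unfolding minimal_hilbert_basis_def by blast
  qed
  then have mhb: "\<forall>H. minimal_hilbert_basis d ?K H \<longleftrightarrow> H = ?H" by blast
  have ker: "\<forall>x. (\<forall>j<n. 0 \<le> x j) \<and> mvr d n A x = (\<lambda>i. 0) \<longrightarrow> (\<forall>j<n. x j = 0)" using kernel by blast
  have "\<forall>b\<in>ivecs d. \<exists>u. b = mv d n A u" using lattice by blast
  from rank pointed ker this sg inj mhb show ?thesis unfolding standing_def by (intro conjI)
qed

text \<open>Two faces of \<open>delta d n A c\<close> sharing a point of their cones share its support, by comparing the values of the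
  two dual vectors at this point.\<close>

lemma delta_support:
  assumes "\<sigma> \<in> delta d n A c" "\<tau> \<in> delta d n A c" "mvr d n A x = mvr d n A z"
    and x: "\<And>t. 0 \<le> x t" "\<And>t. t \<notin> \<sigma> \<Longrightarrow> x t = 0"
    and z: "\<And>t. 0 \<le> z t" "\<And>t. t \<notin> \<tau> \<Longrightarrow> z t = 0"
    and t: "t \<notin> \<sigma>"
  shows "z t = 0"
proof -
  obtain y where y: "\<sigma> \<subseteq> {..<n}" "\<And>j. j \<in> \<sigma> \<Longrightarrow> dotcol d A y j = c j"
    "\<And>j. j < n \<Longrightarrow> j \<notin> \<sigma> \<Longrightarrow> dotcol d A y j < c j" using assms(1) by (rule deltaE) (rule that)
  obtain y' where y': "\<tau> \<subseteq> {..<n}" "\<And>j. j \<in> \<tau> \<Longrightarrow> dotcol d A y' j = c j"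
    "\<And>j. j < n \<Longrightarrow> j \<notin> \<tau> \<Longrightarrow> dotcol d A y' j < c j" using assms(2) by (rule deltaE) (rule that)
  have le: "dotcol d A y j \<le> c j" "dotcol d A y' j \<le> c j" if "j < n" for j
    using y(2,3)[of j] y'(2,3)[of j] that by (cases "j \<in> \<sigma>"; cases "j \<in> \<tau>"; force)+
  have dy: "(\<Sum>j<n. x j * dotcol d A v j) = (\<Sum>j<n. z j * dotcol d A v j)" for v
    using dot_mvr[where d = d and n = n and A = A and y = v] assms(3) by metis
  have "(\<Sum>j<n. x j * c j) = (\<Sum>j<n. x j * dotcol d A y j)"
    using x(2) y(2) by (intro sum.cong) (auto, metis mult_eq_0_iff)
  moreover have "(\<Sum>j<n. z j * c j) = (\<Sum>j<n. z j * dotcol d A y' j)"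
    using z(2) y'(2) by (intro sum.cong) (auto, metis mult_eq_0_iff)
  moreover have "(\<Sum>j<n. x j * dotcol d A y' j) \<le> (\<Sum>j<n. x j * c j)"
    using x(1) le by (intro sum_mono mult_left_mono) auto
  \<comment> \<open>Each dual vector is tight on its own face and bounded by \<open>c\<close>
    elsewhere. Since both points have the same image, this forces complementary slackness of
    \<open>z\<close> against \<open>y\<close>, and the slack at \<open>t\<close> is
    positive.\<close>
  ultimately have "(\<Sum>j<n. z j * c j) \<le> (\<Sum>j<n. z j * dotcol d A y j)" using dy[of y] dy[of y'] by linarith
  then have "(\<Sum>j<n. z j * (c j - dotcol d A y j)) \<le> 0" by (simp add: right_diff_distrib sum_subtractf)
  moreover have nn: "0 \<le> z j * (c j - dotcol d A y j)" if "j < n" for j using z(1) le[OF that] by simp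
  ultimately have "(\<Sum>j<n. z j * (c j - dotcol d A y j)) = 0"
    by (intro order_antisym sum_nonneg) auto
  then have 0: "z j * (c j - dotcol d A y j) = 0" if "j < n" for j
    using nn that by (subst (asm) sum_nonneg_eq_0_iff) auto
  show ?thesis
  proof (cases "t < n")
    case True
    then show ?thesis using 0[OF True] y(3)[OF True t] by simp
  next
    case False
    then show ?thesis using z(2)[of t] y'(1) by auto
  qed
qed

text \<open>The sum of the columns of \<open>\<sigma>\<close> has a positive coordinate at every
  element of \<open>\<sigma>\<close>, so its support detects the whole face.\<close>

lemma delta_face_subset:
  assumes "\<sigma> \<in> delta d n A c" "M \<in> delta d n A c" "mvr d n A (\<lambda>t. if t \<in> \<sigma> then 1 else 0) \<in> cone_of d n A M"
  shows "\<sigma> \<subseteq> M"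
proof
  fix t assume "t \<in> \<sigma>"
  obtain z where z: "mvr d n A (\<lambda>t. if t \<in> \<sigma> then 1 else 0) = mvr d n A z" "\<And>j. 0 \<le> z j" "\<And>j. j \<notin> M \<Longrightarrow> z j = 0"
    using assms(3) cone_ofE by blast
  show "t \<in> M"
  proof (rule ccontr)
    assume t: "t \<notin> M"
    have "(if t \<in> \<sigma> then 1 else (0::real)) = 0"
      by (rule delta_support[OF assms(2,1) z(1)[symmetric] z(2,3) _ _ t]) auto
    then show False using \<open>t \<in> \<sigma>\<close> by simp
  qed
qed

text \<open>The dual vector of a face is tilted to release the columns outside a given subface.\<close>

lemma delta_subset_closed:
  assumes "\<sigma> \<in> delta d n A c" "lin_indep_cols d n A \<sigma>" "\<tau> \<subseteq> \<sigma>"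
  shows "\<tau> \<in> delta d n A c"
proof -
  obtain y where y: "\<sigma> \<subseteq> {..<n}" "\<And>j. j \<in> \<sigma> \<Longrightarrow> dotcol d A y j = c j"
    "\<And>j. j < n \<Longrightarrow> j \<notin> \<sigma> \<Longrightarrow> dotcol d A y j < c j" using assms(1) by (rule deltaE) (rule that)
  have "finite \<sigma>" using y(1) finite_subset by blast
  then obtain v where v: "\<forall>j\<in>\<sigma>. dotcol d A v j = (if j \<in> \<tau> then 0 else 1)"
    using lin_indep_dual[OF _ y(1) assms(2), of "\<lambda>j. if j \<in> \<tau> then 0 else 1"] by blast
  \<comment> \<open>The slack relative to the possible effect of the tilt; adding 1 keeps the
    denominator positive and the resulting inequality strict.\<close>
  let ?r = "\<lambda>j. (c j - dotcol d A y j) / (\<bar>dotcol d A v j\<bar> + 1)"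
  define \<epsilon> where "\<epsilon> = Min (insert 1 (?r ` ({..<n} - \<sigma>)))"
  have r: "0 < ?r j" if "j \<in> {..<n} - \<sigma>" for j using y(3)[of j] that by (intro divide_pos_pos) auto
  have \<epsilon>: "0 < \<epsilon>" using r unfolding \<epsilon>_def by (subst Min_gr_iff) auto
  have le: "\<epsilon> \<le> ?r j" if "j \<in> {..<n} - \<sigma>" for j unfolding \<epsilon>_def using that by (intro Min_le) auto
  let ?y = "\<lambda>i. y i - \<epsilon> * v i"
  have dy: "dotcol d A ?y j = dotcol d A y j - \<epsilon> * dotcol d A v j" for j by (simp add: dotcol_diff dotcol_scale)
  show ?thesis
  proof (rule deltaI[where y = ?y])
    show "\<tau> \<subseteq> {..<n}" using assms(3) y(1) by blast
    show "dotcol d A ?y j = c j" if "j \<in> \<tau>" for j using y(2) v that assms(3) by (auto simp: dy)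
    show "dotcol d A ?y j < c j" if j: "j < n" "j \<notin> \<tau>" for j
    proof (cases "j \<in> \<sigma>")
      case True
      then show ?thesis using y(2) v j \<epsilon> by (simp add: dy)
    next
      case False
      have "\<epsilon> * (\<bar>dotcol d A v j\<bar> + 1) \<le> c j - dotcol d A y j"
        using le[of j] False j by (simp add: pos_le_divide_eq)
      moreover have "- (\<epsilon> * dotcol d A v j) \<le> \<epsilon> * \<bar>dotcol d A v j\<bar>"
        using \<epsilon> by (metis abs_ge_minus_self abs_mult abs_of_pos)
      ultimately show ?thesis using \<epsilon> by (simp add: dy distrib_left)
    qed
  qed
qed

text \<open>It suffices to test candidates for the maximal faces. The sum of the columns of any face
  lies in the cone of some candidate, so that candidate contains the face; independence is
  inherited, and intersections are controlled by comparing supports.\<close>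

lemma delta_triangulation:
  assumes M: "\<And>M. M \<in> Ms \<Longrightarrow> M \<in> delta d n A c" "\<And>M. M \<in> Ms \<Longrightarrow> lin_indep_cols d n A M"
    and cover: "\<And>v. v \<in> coneA d n A \<Longrightarrow> \<exists>M\<in>Ms. v \<in> cone_of d n A M"
  shows "regular_triangulation d n A (delta d n A c)"
    and "\<And>\<sigma>. \<sigma> \<in> delta d n A c \<Longrightarrow> \<exists>M\<in>Ms. \<sigma> \<subseteq> M"
proof -
  let ?\<Delta> = "delta d n A c"
  have sub: "\<sigma> \<subseteq> {..<n}" if "\<sigma> \<in> ?\<Delta>" for \<sigma> using that by (auto simp: delta_def)
  show above: "\<exists>M\<in>Ms. \<sigma> \<subseteq> M" if "\<sigma> \<in> ?\<Delta>" for \<sigma>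
  proof -
    have "mvr d n A (\<lambda>t. if t \<in> \<sigma> then 1 else 0) \<in> coneA d n A" by (intro mvr_in_coneA) simp
    then obtain M where "M \<in> Ms" "mvr d n A (\<lambda>t. if t \<in> \<sigma> then 1 else 0) \<in> cone_of d n A M"
      using cover by blast
    then show ?thesis using delta_face_subset[OF that M(1)] by blast
  qed
  have li: "lin_indep_cols d n A \<sigma>" if "\<sigma> \<in> ?\<Delta>" for \<sigma>
    using above[OF that] M(2) lin_indep_subset by blast
  have "mvr d n A (\<lambda>t. 0) \<in> coneA d n A" by (intro mvr_in_coneA) simp
  then have ne: "?\<Delta> \<noteq> {}" using cover M(1) by blast
  have int: "cone_of d n A \<sigma> \<inter> cone_of d n A \<tau> = cone_of d n A (\<sigma> \<inter> \<tau>)" if "\<sigma> \<in> ?\<Delta>" "\<tau> \<in> ?\<Delta>" for \<sigma> \<tau>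
  proof (intro equalityI subsetI)
    fix v assume v: "v \<in> cone_of d n A \<sigma> \<inter> cone_of d n A \<tau>"
    obtain x where x: "v = mvr d n A x" "\<And>j. 0 \<le> x j" "\<And>j. j \<notin> \<sigma> \<Longrightarrow> x j = 0" using v cone_ofE by blast
    obtain z where z: "v = mvr d n A z" "\<And>j. 0 \<le> z j" "\<And>j. j \<notin> \<tau> \<Longrightarrow> z j = 0" using v cone_ofE by blast
    have "mvr d n A x = mvr d n A z" using x(1) z(1) by simp
    then have "z t = 0" if "t \<notin> \<sigma>" for t by (rule delta_support[OF \<open>\<sigma> \<in> ?\<Delta>\<close> \<open>\<tau> \<in> ?\<Delta>\<close> _ x(2,3) z(2,3) that])
    then show "v \<in> cone_of d n A (\<sigma> \<inter> \<tau>)" using z by (intro cone_ofI[of _ _ _ _ z]) auto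
  next
    fix v assume "v \<in> cone_of d n A (\<sigma> \<inter> \<tau>)"
    then show "v \<in> cone_of d n A \<sigma> \<inter> cone_of d n A \<tau>"
      using cone_of_mono[of "\<sigma> \<inter> \<tau>" \<sigma>] cone_of_mono[of "\<sigma> \<inter> \<tau>" \<tau>] by blast
  qed
  have un: "(\<Union>\<sigma>\<in>?\<Delta>. cone_of d n A \<sigma>) = coneA d n A"
  proof (intro equalityI subsetI)
    fix v assume "v \<in> (\<Union>\<sigma>\<in>?\<Delta>. cone_of d n A \<sigma>)"
    then show "v \<in> coneA d n A" using sub cone_of_mono unfolding coneA_def by blast
  next
    fix v assume "v \<in> coneA d n A"
    then show "v \<in> (\<Union>\<sigma>\<in>?\<Delta>. cone_of d n A \<sigma>)" using cover M(1) by blast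
  qed
  have "triangulation d n A ?\<Delta>"
    unfolding triangulation_def
  proof (intro conjI ballI allI impI)
    show "?\<Delta> \<noteq> {}" by (rule ne)
    fix \<sigma> assume \<sigma>: "\<sigma> \<in> ?\<Delta>"
    show "\<sigma> \<subseteq> {..<n}" "lin_indep_cols d n A \<sigma>" using sub[OF \<sigma>] li[OF \<sigma>] by auto
    show "\<tau> \<in> ?\<Delta>" if "\<tau> \<subseteq> \<sigma>" for \<tau> using delta_subset_closed[OF \<sigma> li[OF \<sigma>] that] .
    show "cone_of d n A \<sigma> \<inter> cone_of d n A \<tau> = cone_of d n A (\<sigma> \<inter> \<tau>)" if "\<tau> \<in> ?\<Delta>" for \<tau>
      by (rule int[OF \<sigma> that])
  next
    show "(\<Union>\<sigma>\<in>?\<Delta>. cone_of d n A \<sigma>) = coneA d n A" by (rule un)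
  qed
  then show "regular_triangulation d n A ?\<Delta>" unfolding regular_triangulation_def by blast
qed

text \<open>A certificate modulo \<open>k\<close>: the functional \<open>f\<close> vanishes modulo
  \<open>k\<close> on every column in the cone, hence on all their integer combinations, but not on
  the lattice point \<open>b\<close>.\<close>

lemma not_delta_normalI:
  assumes "max_face \<Delta> M" "b \<in> ivecs d" "rvec b \<in> cone_of d n A M"
    and dvd: "\<And>j. j < n \<Longrightarrow> rvec (col d A j) \<in> cone_of d n A M \<Longrightarrow> k dvd (\<Sum>i<d. f i * A i j)"
    and not_dvd: "\<not> k dvd (\<Sum>i<d. f i * b i)"
  shows "\<not> delta_normal d n A \<Delta>"
proof
  let ?H = "{col d A j | j. j < n \<and> rvec (col d A j) \<in> cone_of d n A M}"
  assume "delta_normal d n A \<Delta>"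
  then have "hilbert_basis d (cone_of d n A M) ?H" using assms(1) unfolding delta_normal_def by blast
  moreover have "b \<in> lattice_pts d (cone_of d n A M)" using assms(2,3) by (simp add: lattice_pts_def)
  ultimately obtain m :: "(nat \<Rightarrow> int) \<Rightarrow> nat" where m: "b = (\<lambda>i. \<Sum>h\<in>?H. int (m h) * h i)"
    unfolding hilbert_basis_def by blast
  have "(\<Sum>i<d. f i * b i) = (\<Sum>i<d. \<Sum>h\<in>?H. int (m h) * (f i * h i))"
    by (subst m) (simp add: sum_distrib_left mult_ac)
  also have "\<dots> = (\<Sum>h\<in>?H. \<Sum>i<d. int (m h) * (f i * h i))" by (rule sum.swap)
  also have "\<dots> = (\<Sum>h\<in>?H. int (m h) * (\<Sum>i<d. f i * h i))" by (simp add: sum_distrib_left)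
  also have "k dvd \<dots>"
  proof (rule dvd_sum, rule dvd_mult)
    fix h assume "h \<in> ?H"
    then obtain j where "j < n" "rvec (col d A j) \<in> cone_of d n A M" "h = col d A j" by blast
    then show "k dvd (\<Sum>i<d. f i * h i)" using dvd[of j] by (simp add: col_def)
  qed
  finally show False using not_dvd by blast
qed

lemma gr_optimal_cost_le:
  assumes "full_row_rank d n A" "max_face (delta d n A c) \<sigma>" "gr_optimal d n A c \<sigma> b x" "gr_feasible d n A \<sigma> b z"
  shows "(\<Sum>j<n. c j * of_int (x j)) \<le> (\<Sum>j<n. c j * of_int (z j))"
  using assms gr_optimal_iff by blast

subsection \<open>A matrix of rank 3 that is not graded\<close>

text \<open>The face \<open>{2, 3, 4}\<close> has index 3 and contains no further column; \<open>(-1, 1, 1)\<close> is a lattice point of its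
  cone whose only representation is the sum of the columns 0 and 4.\<close>

definition ex3 :: "nat \<Rightarrow> nat \<Rightarrow> int" where
  "ex3 i j = [[1, 0, -1, 0, -2], [0, 1, 2, 0, 1], [0, 0, 0, 1, 1]] ! i ! j"

definition ex3_faces :: "nat set set" where
  "ex3_faces = {{0, 1, 3}, {1, 2, 3}, {2, 3, 4}}"

text \<open>The middle face \<open>{1, 2, 3}\<close> has cost 0 and dual vector 0. The positive
  costs of columns 0 and 4 fold the subdivision along the walls \<open>{1, 3}\<close> and
  \<open>{2, 3}\<close>.\<close>

definition ex3_cost :: "nat \<Rightarrow> real" where
  "ex3_cost = (\<lambda>_. 0)(0 := 1, 4 := 1)"

lemma lt3: "(i::nat) < 3 \<longleftrightarrow> i = 0 \<or> i = 1 \<or> i = 2" by auto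
lemma lt5: "(i::nat) < 5 \<longleftrightarrow> i = 0 \<or> i = 1 \<or> i = 2 \<or> i = 3 \<or> i = 4" by auto
lemma lessThan3: "{..<3::nat} = {0, 1, 2}" by auto
lemma lessThan5: "{..<5::nat} = {0, 1, 2, 3, 4}" by auto

lemma ex3_dotcol:
  "dotcol 3 ex3 y 0 = y 0" "dotcol 3 ex3 y 1 = y 1" "dotcol 3 ex3 y 2 = - y 0 + 2 * y 1"
  "dotcol 3 ex3 y 3 = y 2" "dotcol 3 ex3 y 4 = - 2 * y 0 + y 1 + y 2"
  by (simp_all add: dotcol_def lessThan3 ex3_def)

lemma ex3_mvr: "mvr 3 5 ex3 x = v \<longleftrightarrow>
    v 0 = x 0 - x 2 - 2 * x 4 \<and> v 1 = x 1 + 2 * x 2 + x 4 \<and> v 2 = x 3 + x 4 \<and> (\<forall>i\<ge>3. v i = 0)"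
proof -
  have "mvr 3 5 ex3 x = v \<longleftrightarrow> (\<forall>i<3. (\<Sum>j<5. of_int (ex3 i j) * x j) = v i) \<and> (\<forall>i\<ge>3. v i = 0)"
    by (auto simp: mvr_def fun_eq_iff not_less)
  then show ?thesis by (auto simp: lt3 lessThan5 ex3_def)
qed

lemma ex3_mv: "mv 3 5 ex3 x = v \<longleftrightarrow>
    v 0 = x 0 - x 2 - 2 * x 4 \<and> v 1 = x 1 + 2 * x 2 + x 4 \<and> v 2 = x 3 + x 4 \<and> (\<forall>i\<ge>3. v i = 0)"
proof -
  have "mv 3 5 ex3 x = v \<longleftrightarrow> (\<forall>i<3. (\<Sum>j<5. ex3 i j * x j) = v i) \<and> (\<forall>i\<ge>3. v i = 0)"
    by (auto simp: mv_def fun_eq_iff not_less)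
  then show ?thesis by (auto simp: lt3 lessThan5 ex3_def)
qed

lemma ex3_coneE:
  assumes "v \<in> cone_of 3 5 ex3 \<sigma>"
  obtains x where "\<And>j. 0 \<le> x j" "\<And>j. j \<notin> \<sigma> \<Longrightarrow> x j = 0" "v 0 = x 0 - x 2 - 2 * x 4"
    "v 1 = x 1 + 2 * x 2 + x 4" "v 2 = x 3 + x 4" "\<And>i. 3 \<le> i \<Longrightarrow> v i = 0"
proof -
  obtain x where x: "v = mvr 3 5 ex3 x" "\<And>j. 0 \<le> x j" "\<And>j. j \<notin> \<sigma> \<Longrightarrow> x j = 0"
    using assms by (rule cone_ofE) (rule that)
  have "mvr 3 5 ex3 x = v" using x(1) ..
  then show ?thesis unfolding ex3_mvr by (intro that[of x]) (use x(2,3) in auto)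
qed

lemma ex3_full_rank: "full_row_rank 3 5 ex3"
  unfolding full_row_rank_def by (auto simp: lt3 lt5 ex3_dotcol simp del: One_nat_def)

lemma ex3_standing: "standing 3 5 ex3"
proof (rule standingI[OF ex3_full_rank])
  show "0 < dotcol 3 ex3 (\<lambda>i. if i = 2 then 2 else 1) j" if "j < 5" for j
    using that unfolding lt5 by (auto simp: ex3_dotcol simp del: One_nat_def)
  fix b assume b: "b \<in> ivecs 3"
  then have b0: "\<forall>i\<ge>3. b i = 0" by (simp add: ivecs_def)
  have "mv 3 5 ex3 ((\<lambda>_. 0)(0 := b 0, 1 := b 1, 3 := b 2)) = b"
    unfolding ex3_mv using b0 by simp
  then show "\<exists>u. b = mv 3 5 ex3 u" by metis
  assume "rvec b \<in> coneA 3 5 ex3"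
  then obtain x :: "nat \<Rightarrow> real" where x: "\<And>j. 0 \<le> x j" "rvec b 0 = x 0 - x 2 - 2 * x 4"
    "rvec b 1 = x 1 + 2 * x 2 + x 4" "rvec b 2 = x 3 + x 4"
    unfolding coneA_def by (rule ex3_coneE) (rule that)
  have e: "rvec b 0 + 2 * rvec b 1 = x 0 + 2 * x 1 + 3 * x 2"
    "2 * rvec b 0 + rvec b 1 + 3 * rvec b 2 = 2 * x 0 + x 1 + 3 * x 3" unfolding x(2-4) by algebra+
  have "0 \<le> rvec b 2" "0 \<le> rvec b 1" "0 \<le> rvec b 0 + 2 * rvec b 1" "0 \<le> 2 * rvec b 0 + rvec b 1 + 3 * rvec b 2"
    using x(1)[of 0] x(1)[of 1] x(1)[of 2] x(1)[of 3] x(1)[of 4] e x(3,4) by linarith+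
  then have f: "0 \<le> b 2" "0 \<le> b 1" "0 \<le> b 0 + 2 * b 1" "0 \<le> 2 * b 0 + b 1 + 3 * b 2"
    unfolding rvec_def by linarith+
  \<comment> \<open>Normality is read off from another cover: the cones of \<open>{0, 3, 4}\<close>,
    \<open>{0, 1, 4}\<close> and \<open>{1, 2, 4}\<close> are unimodular, and they all contain
    column 4.\<close>
  consider "b 1 \<le> b 2" | "b 2 \<le> b 1" "0 \<le> b 0 + 2 * b 2" | "b 0 + 2 * b 2 \<le> 0" by linarith
  then have "\<exists>z. mv 3 5 ex3 z = b \<and> (\<forall>j. 0 \<le> z j)"
  proof cases
    case 1
    then show ?thesis using f b0 unfolding ex3_mv
      by (intro exI[of _ "(\<lambda>_. 0)(0 := b 0 + 2 * b 1, 3 := b 2 - b 1, 4 := b 1)"]) auto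
  next
    case 2
    then show ?thesis using f b0 unfolding ex3_mv
      by (intro exI[of _ "(\<lambda>_. 0)(0 := b 0 + 2 * b 2, 1 := b 1 - b 2, 4 := b 2)"]) auto
  next
    case 3
    then show ?thesis using f b0 unfolding ex3_mv
      by (intro exI[of _ "(\<lambda>_. 0)(1 := 2 * b 0 + b 1 + 3 * b 2, 2 := - b 0 - 2 * b 2, 4 := b 2)"]) auto
  qed
  then obtain z where z: "mv 3 5 ex3 z = b" "\<And>j. 0 \<le> z j" by blast
  then have "b = mv 3 5 ex3 (\<lambda>j. int (nat (z j)))" by simp
  then show "\<exists>u. b = mv 3 5 ex3 (\<lambda>j. int (u j))" by (rule exI[of _ "\<lambda>j. nat (z j)"])
next
  fix u :: "nat \<Rightarrow> nat" and j k :: nat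
  assume jk: "j < 5" "k < 5" and "mv 3 5 ex3 (\<lambda>i. int (u i)) = col 3 ex3 j"
  then have eq: "ex3 0 j = int (u 0) - int (u 2) - 2 * int (u 4)" "ex3 1 j = int (u 1) + 2 * int (u 2) + int (u 4)"
    "ex3 2 j = int (u 3) + int (u 4)" unfolding ex3_mv by (simp_all add: col_def)
  from jk(1) consider "j = 0" | "j = 1" | "j = 2" | "j = 3" | "j = 4" unfolding lt5 by blast
  then have "u 0 = unit_vec j 0 \<and> u 1 = unit_vec j 1 \<and> u 2 = unit_vec j 2 \<and> u 3 = unit_vec j 3 \<and> u 4 = unit_vec j 4"
  proof cases
    case 1
    then have e: "int (u 0) - int (u 2) - 2 * int (u 4) = 1" "int (u 1) + 2 * int (u 2) + int (u 4) = 0"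
      "int (u 3) + int (u 4) = 0" using eq by (simp_all add: ex3_def)
    have "u 2 = 0" "u 4 = 0" using e by linarith+
    with e have "u 0 = 1" "u 1 = 0" "u 2 = 0" "u 3 = 0" "u 4 = 0" by linarith+
    with 1 show ?thesis by (simp add: unit_vec_def)
  next
    case 2
    then have e: "int (u 0) - int (u 2) - 2 * int (u 4) = 0" "int (u 1) + 2 * int (u 2) + int (u 4) = 1"
      "int (u 3) + int (u 4) = 0" using eq by (simp_all add: ex3_def)
    have "u 2 = 0" "u 4 = 0" using e by linarith+
    with e have "u 0 = 0" "u 1 = 1" "u 2 = 0" "u 3 = 0" "u 4 = 0" by linarith+
    with 2 show ?thesis by (simp add: unit_vec_def)
  next
    case 3
    then have e: "int (u 0) - int (u 2) - 2 * int (u 4) = -1" "int (u 1) + 2 * int (u 2) + int (u 4) = 2"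
      "int (u 3) + int (u 4) = 0" using eq by (simp_all add: ex3_def)
    have "u 2 = 1" "u 4 = 0" using e by linarith+
    with e have "u 0 = 0" "u 1 = 0" "u 2 = 1" "u 3 = 0" "u 4 = 0" by linarith+
    with 3 show ?thesis by (simp add: unit_vec_def)
  next
    case 4
    then have e: "int (u 0) - int (u 2) - 2 * int (u 4) = 0" "int (u 1) + 2 * int (u 2) + int (u 4) = 0"
      "int (u 3) + int (u 4) = 1" using eq by (simp_all add: ex3_def)
    have "u 2 = 0" "u 4 = 0" using e by linarith+
    with e have "u 0 = 0" "u 1 = 0" "u 2 = 0" "u 3 = 1" "u 4 = 0" by linarith+
    with 4 show ?thesis by (simp add: unit_vec_def)
  next
    case 5
    then have e: "int (u 0) - int (u 2) - 2 * int (u 4) = -2" "int (u 1) + 2 * int (u 2) + int (u 4) = 1"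
      "int (u 3) + int (u 4) = 1" using eq by (simp_all add: ex3_def)
    have "u 2 = 0" "u 4 = 1" using e by linarith+
    with e have "u 0 = 0" "u 1 = 0" "u 2 = 0" "u 3 = 0" "u 4 = 1" by linarith+
    with 5 show ?thesis by (simp add: unit_vec_def)
  qed
  then show "u k = unit_vec j k" using jk(2) unfolding lt5 by blast
qed

lemma ex3_cover:
  assumes "v \<in> coneA 3 5 ex3"
  shows "\<exists>M\<in>ex3_faces. v \<in> cone_of 3 5 ex3 M"
proof -
  obtain x :: "nat \<Rightarrow> real" where x: "\<And>j. 0 \<le> x j" "v 0 = x 0 - x 2 - 2 * x 4" "v 1 = x 1 + 2 * x 2 + x 4" "v 2 = x 3 + x 4"
    "\<And>i. 3 \<le> i \<Longrightarrow> v i = 0"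
    using assms unfolding coneA_def by (rule ex3_coneE) (rule that)
  have e: "v 0 + 2 * v 1 = x 0 + 2 * x 1 + 3 * x 2"
    "2 * v 0 + v 1 + 3 * v 2 = 2 * x 0 + x 1 + 3 * x 3" unfolding x(2-4) by algebra+
  have f: "0 \<le> v 2" "0 \<le> v 1" "0 \<le> v 0 + 2 * v 1" "0 \<le> 2 * v 0 + v 1 + 3 * v 2"
    using x(1)[of 0] x(1)[of 1] x(1)[of 2] x(1)[of 3] x(1)[of 4] e x(3,4) by linarith+
  have mem: "v \<in> cone_of 3 5 ex3 M" if "mvr 3 5 ex3 z = v" "\<And>j. 0 \<le> z j" "\<And>j. j \<notin> M \<Longrightarrow> z j = 0" for M z
    using that by (intro cone_ofI[where x = z]) auto
  \<comment> \<open>The wall spanned by columns 1 and 3 is \<open>v 0 = 0\<close>, and the one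
    spanned by columns 2 and 3 is \<open>v 1 + 2 * v 0 = 0\<close>.\<close>
  consider "0 \<le> v 0" | "v 0 \<le> 0" "0 \<le> v 1 + 2 * v 0" | "v 1 + 2 * v 0 \<le> 0" by linarith
  then show ?thesis
  proof cases
    case 1
    have "v \<in> cone_of 3 5 ex3 {0, 1, 3}"
      by (rule mem[of "(\<lambda>_. 0)(0 := v 0, 1 := v 1, 3 := v 2)"]) (use 1 f x(5) in \<open>auto simp: ex3_mvr\<close>)
    then show ?thesis by (auto simp: ex3_faces_def)
  next
    case 2
    have "v \<in> cone_of 3 5 ex3 {1, 2, 3}"
      by (rule mem[of "(\<lambda>_. 0)(1 := v 1 + 2 * v 0, 2 := - v 0, 3 := v 2)"]) (use 2 f x(5) in \<open>auto simp: ex3_mvr\<close>)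
    then show ?thesis by (auto simp: ex3_faces_def)
  next
    case 3
    have "v \<in> cone_of 3 5 ex3 {2, 3, 4}"
      by (rule mem[of "(\<lambda>_. 0)(2 := (v 0 + 2 * v 1) / 3, 3 := (2 * v 0 + v 1 + 3 * v 2) / 3, 4 := - (2 * v 0 + v 1) / 3)"])
        (use 3 f x(5) in \<open>auto simp: ex3_mvr field_simps\<close>)
    then show ?thesis by (auto simp: ex3_faces_def)
  qed
qed

lemma ex3_faces_delta:
  assumes "M \<in> ex3_faces"
  shows "M \<in> delta 3 5 ex3 ex3_cost"
proof -
  consider "M = {0, 1, 3}" | "M = {1, 2, 3}" | "M = {2, 3, 4}" using assms by (auto simp: ex3_faces_def)
  then show ?thesis
  proof cases
    case 1
    show ?thesis unfolding 1
      by (rule deltaI[where y = "(\<lambda>_. 0)(0 := 1)"])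
        (auto simp: lt5 ex3_dotcol ex3_cost_def simp del: One_nat_def)
  next
    case 2
    show ?thesis unfolding 2
      by (rule deltaI[where y = "\<lambda>_. 0"])
        (auto simp: lt5 ex3_dotcol ex3_cost_def simp del: One_nat_def)
  next
    case 3
    show ?thesis unfolding 3
      by (rule deltaI[where y = "(\<lambda>_. 0)(0 := - 2 / 3, 1 := - 1 / 3)"])
        (auto simp: lt5 ex3_dotcol ex3_cost_def simp del: One_nat_def)
  qed
qed

lemma ex3_faces_lin_indep:
  assumes "M \<in> ex3_faces"
  shows "lin_indep_cols 3 5 ex3 M"
  unfolding lin_indep_cols_def
proof (intro allI impI ballI, elim conjE)
  fix x j assume x: "\<forall>j. j \<notin> M \<longrightarrow> x j = 0" "mvr 3 5 ex3 x = (\<lambda>i. 0)" and j: "j \<in> M"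
  have e: "x 0 - x 2 - 2 * x 4 = 0" "x 1 + 2 * x 2 + x 4 = 0" "x 3 + x 4 = 0" using x(2) unfolding ex3_mvr by auto
  consider "M = {0, 1, 3}" | "M = {1, 2, 3}" | "M = {2, 3, 4}" using assms by (auto simp: ex3_faces_def)
  then show "x j = 0"
  proof cases
    case 1
    then have "x 2 = 0" "x 4 = 0" using x(1) by auto
    then show ?thesis using e j 1 by auto
  next
    case 2
    then have "x 0 = 0" "x 4 = 0" using x(1) by auto
    then show ?thesis using e j 2 by auto
  next
    case 3
    then have "x 0 = 0" "x 1 = 0" using x(1) by auto
    then show ?thesis using e j 3 by auto
  qed
qed

abbreviation "ex3_triang \<equiv> delta 3 5 ex3 ex3_cost"

lemma ex3_triangulation:
  "regular_triangulation 3 5 ex3 ex3_triang" "\<sigma> \<in> ex3_triang \<Longrightarrow> \<exists>M\<in>ex3_faces. \<sigma> \<subseteq> M"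
  using delta_triangulation[OF ex3_faces_delta ex3_faces_lin_indep ex3_cover] by blast+

lemma ex3_max_face: "max_face ex3_triang \<sigma> \<Longrightarrow> \<sigma> \<in> ex3_faces"
  using ex3_triangulation(2) ex3_faces_delta unfolding max_face_def by metis

lemma ex3_max_face_234: "max_face ex3_triang {2, 3, 4}"
  unfolding max_face_def
proof (intro conjI ballI impI)
  show "{2, 3, 4} \<in> ex3_triang" by (rule ex3_faces_delta) (simp add: ex3_faces_def)
  fix \<tau> assume \<tau>: "\<tau> \<in> ex3_triang" "{2, 3, 4} \<subseteq> \<tau>"
  obtain M where M: "M \<in> ex3_faces" "\<tau> \<subseteq> M" using ex3_triangulation(2)[OF \<tau>(1)] by blast
  then have "M = {2, 3, 4}" using \<tau>(2) by (auto simp: ex3_faces_def)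
  then show "\<tau> = {2, 3, 4}" using M \<tau> by blast
qed

definition ex3_b :: "nat \<Rightarrow> int" where
  "ex3_b = (\<lambda>_. 0)(0 := -1, 1 := 1, 2 := 1)"

text \<open>The fiber of \<open>ex3_b\<close> has a single nonnegative point, so some relaxation
  would have to be optimal there. For each face there is an integral competitor that is negative at
  one element of that face, and the inequalities imposed by the triangulation make it strictly
  cheaper.\<close>

lemma ex3_not_supports: "\<not> supports 3 5 ex3 ex3_triang c"
proof
  assume sup: "supports 3 5 ex3 ex3_triang c"
  then have eq: "ex3_triang = delta 3 5 ex3 c" and gom: "gomory_family 3 5 ex3 c"
    by (simp_all add: supports_def)
  have faces: "M \<in> delta 3 5 ex3 c" if "M \<in> ex3_faces" for M
    unfolding eq[symmetric] by (rule ex3_faces_delta[OF that])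
  have "{0, 1, 3} \<in> delta 3 5 ex3 c" by (rule faces) (simp add: ex3_faces_def)
  then obtain y where "{0, 1, 3} \<subseteq> {..<5::nat}" and y: "\<And>j. j \<in> {0, 1, 3} \<Longrightarrow> dotcol 3 ex3 y j = c j"
    "\<And>j. j < 5 \<Longrightarrow> j \<notin> {0, 1, 3} \<Longrightarrow> dotcol 3 ex3 y j < c j"
    by (rule deltaE) (rule that)
  have "{1, 2, 3} \<in> delta 3 5 ex3 c" by (rule faces) (simp add: ex3_faces_def)
  then obtain y' where "{1, 2, 3} \<subseteq> {..<5::nat}" and y': "\<And>j. j \<in> {1, 2, 3} \<Longrightarrow> dotcol 3 ex3 y' j = c j"
    "\<And>j. j < 5 \<Longrightarrow> j \<notin> {1, 2, 3} \<Longrightarrow> dotcol 3 ex3 y' j < c j"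
    by (rule deltaE) (rule that)
  \<comment> \<open>In the face \<open>{0, 1, 3}\<close> column 4 has coordinates -2, 1, 1. In
    \<open>{1, 2, 3}\<close> column 0 has coordinates 2, -1, 0 and column 4 has -3, 2, 1. Tightness
    on the face and slack off it turn these relations into inequalities.\<close>
  have c: "c 4 > - 2 * c 0 + c 1 + c 3" "c 0 + c 2 > 2 * c 1" "c 4 > - 3 * c 1 + 2 * c 2 + c 3"
    using y(1)[of 0] y(1)[of 1] y(1)[of 3] y(2)[of 4] y'(1)[of 1] y'(1)[of 2] y'(1)[of 3] y'(2)[of 0] y'(2)[of 4]
    by (simp_all add: ex3_dotcol del: One_nat_def)
  have "mv 3 5 ex3 (\<lambda>j. int (if j = 0 \<or> j = 4 then 1 else 0)) = ex3_b"
    unfolding ex3_mv by (simp add: ex3_b_def)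
  then have "ex3_b \<in> semigroup 3 5 ex3" unfolding semigroup_iff by metis
  then obtain \<sigma> x where \<sigma>: "max_face ex3_triang \<sigma>" and opt: "gr_optimal 3 5 ex3 c \<sigma> ex3_b x" and nn: "\<And>j. j < 5 \<Longrightarrow> 0 \<le> x j"
    using gom unfolding gomory_family_def gr_solves_def eq by metis
  have \<sigma>c: "max_face (delta 3 5 ex3 c) \<sigma>" using \<sigma> eq by simp
  have "mv 3 5 ex3 x = ex3_b" using opt by (simp add: gr_optimal_def gr_feasible_def)
  then have e: "x 0 - x 2 - 2 * x 4 = - 1" "x 1 + 2 * x 2 + x 4 = 1" "x 3 + x 4 = 1"
    unfolding ex3_mv by (simp_all add: ex3_b_def)
  have x: "x 0 = 1" "x 1 = 0" "x 2 = 0" "x 3 = 0" "x 4 = 1"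
  proof -
    have nn': "0 \<le> x 0" "0 \<le> x 1" "0 \<le> x 2" "0 \<le> x 3" "0 \<le> x 4" by (simp_all add: nn)
    show x2: "x 2 = 0" using e(2) nn' by linarith
    show x4: "x 4 = 1" using e(1,3) nn' x2 by linarith
    show "x 0 = 1" "x 1 = 0" "x 3 = 0" using e x2 x4 nn' by linarith+
  qed
  have le: "c 0 + c 4 \<le> (\<Sum>j<5. c j * of_int (z j))"
    if "mv 3 5 ex3 z = ex3_b" "\<And>j. 5 \<le> j \<Longrightarrow> z j = 0" "\<And>j. j < 5 \<Longrightarrow> j \<notin> \<sigma> \<Longrightarrow> 0 \<le> z j" for z
  proof -
    have "gr_feasible 3 5 ex3 \<sigma> ex3_b z" using that by (simp add: gr_feasible_def)
    from gr_optimal_cost_le[OF ex3_full_rank \<sigma>c opt this] show ?thesis by (simp add: lessThan5 x del: One_nat_def)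
  qed
  consider "\<sigma> = {0, 1, 3}" | "\<sigma> = {1, 2, 3}" | "\<sigma> = {2, 3, 4}" using ex3_max_face[OF \<sigma>] by (auto simp: ex3_faces_def)
  then show False
  proof cases
    case 1
    let ?z = "(\<lambda>_. 0)(0 := -1, 1 := 1, 3 := 1)"
    have "c 0 + c 4 \<le> (\<Sum>j<5. c j * of_int (?z j))" by (rule le) (auto simp: 1 ex3_mv ex3_b_def lt5)
    then show False using c by (simp add: lessThan5)
  next
    case 2
    let ?z = "(\<lambda>_. 0)(1 := -1, 2 := 1, 3 := 1)"
    have "c 0 + c 4 \<le> (\<Sum>j<5. c j * of_int (?z j))" by (rule le) (auto simp: 2 ex3_mv ex3_b_def lt5)
    then show False using c by (simp add: lessThan5)
  next
    case 3
    let ?z = "(\<lambda>_. 0)(1 := 2, 2 := -1, 4 := 1)"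
    have "c 0 + c 4 \<le> (\<Sum>j<5. c j * of_int (?z j))" by (rule le) (auto simp: 3 ex3_mv ex3_b_def lt5)
    then show False using c by (simp add: lessThan5)
  qed
qed

text \<open>The functional (2, 1, 3) takes the values 0, 3, 0 on columns 2, 3, 4 and the value 2 on
  \<open>ex3_b\<close>.\<close>

lemma ex3_not_delta_normal: "\<not> delta_normal 3 5 ex3 ex3_triang"
proof (rule not_delta_normalI[OF ex3_max_face_234, where b = ex3_b and k = 3 and f = "(\<lambda>_. 1)(0 := 2, 2 := 3)"])
  show "ex3_b \<in> ivecs 3" by (simp add: ivecs_def ex3_b_def)
  show "rvec ex3_b \<in> cone_of 3 5 ex3 {2, 3, 4}"
  proof (rule cone_ofI)
    show "rvec ex3_b = mvr 3 5 ex3 ((\<lambda>_. 0)(2 := 1 / 3, 3 := 2 / 3, 4 := 1 / 3))"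
      by (rule sym) (simp add: ex3_mvr rvec_def ex3_b_def)
  qed auto
  show "\<not> 3 dvd (\<Sum>i<3. ((\<lambda>_. 1)(0 := 2, 2 := 3)) i * ex3_b i)" by (simp add: lessThan3 ex3_b_def)
  fix j :: nat assume j: "j < 5" "rvec (col 3 ex3 j) \<in> cone_of 3 5 ex3 {2, 3, 4}"
  obtain x :: "nat \<Rightarrow> real" where x: "\<And>j. 0 \<le> x j" "\<And>j. j \<notin> {2, 3, 4} \<Longrightarrow> x j = 0" "rvec (col 3 ex3 j) 0 = x 0 - x 2 - 2 * x 4"
    "rvec (col 3 ex3 j) 1 = x 1 + 2 * x 2 + x 4" "rvec (col 3 ex3 j) 2 = x 3 + x 4"
    using j(2) by (rule ex3_coneE) (rule that)
  have x0: "x 0 = 0" "x 1 = 0" by (auto intro: x(2))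
  have "j \<noteq> 0"
  proof
    assume "j = 0"
    then have "1 = x 0 - x 2 - 2 * x 4" using x(3) by (simp add: rvec_def col_def ex3_def)
    then show False using x0 x(1)[of 2] x(1)[of 4] by linarith
  qed
  moreover have "j \<noteq> 1"
  proof
    assume "j = 1"
    then have "0 = x 0 - x 2 - 2 * x 4" "1 = x 1 + 2 * x 2 + x 4"
      using x(3,4) by (simp_all add: rvec_def col_def ex3_def)
    then show False using x0 x(1)[of 2] x(1)[of 4] by linarith
  qed
  ultimately show "3 dvd (\<Sum>i<3. ((\<lambda>_. 1)(0 := 2, 2 := 3)) i * ex3 i j)"
    using j(1) unfolding lt5 by (auto simp: lessThan3 ex3_def)
qed

text \<open>Column 4 is a combination of columns 0, 1, 3 with coefficients -2, 1, 1 of sum 0, so a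
  functional constant on the columns vanishes on them.\<close>

lemma ex3_not_graded: "\<not> graded 3 5 ex3"
proof
  assume "graded 3 5 ex3"
  then obtain w \<gamma> where w: "\<gamma> \<noteq> 0" "\<And>j. j < 5 \<Longrightarrow> dotcol 3 ex3 w j = \<gamma>" unfolding graded_def by blast
  show False using w(1) w(2)[of 0] w(2)[of 1] w(2)[of 3] w(2)[of 4] by (simp add: ex3_dotcol del: One_nat_def)
qed

subsection \<open>A graded matrix of rank 4\<close>

text \<open>Here the face \<open>{0, 2, 4, 5}\<close> has index 3, and the lattice point \<open>(1, -1, 1, 1)\<close> of its cone is only
  represented by the sum of the columns 1 and 3.\<close>

definition ex4 :: "nat \<Rightarrow> nat \<Rightarrow> int" where
  "ex4 i j = [[1, 0, 0, 1, 0, 1], [0, 1, 0, -2, 0, -3], [0, 0, 1, 1, 0, 2], [0, 0, 0, 1, 1, 1]] ! i ! j"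

definition ex4_faces :: "nat set set" where
  "ex4_faces = {{0, 1, 2, 4}, {0, 2, 4, 5}, {0, 3, 4, 5}}"

text \<open>Columns 1 and 5 lie on opposite sides of the wall \<open>{0, 2, 4}\<close>, whose
  columns cost 0. The cost of column 3 has to exceed 2/3, the value there of the functional
  belonging to \<open>{0, 2, 4, 5}\<close>.\<close>

definition ex4_cost :: "nat \<Rightarrow> real" where
  "ex4_cost = (\<lambda>_. 0)(1 := 1, 3 := 2, 5 := 1)"

lemma lt4: "(i::nat) < 4 \<longleftrightarrow> i = 0 \<or> i = 1 \<or> i = 2 \<or> i = 3" by auto
lemma lt6: "(i::nat) < 6 \<longleftrightarrow> i = 0 \<or> i = 1 \<or> i = 2 \<or> i = 3 \<or> i = 4 \<or> i = 5" by auto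
lemma lessThan4: "{..<4::nat} = {0, 1, 2, 3}" by auto
lemma lessThan6: "{..<6::nat} = {0, 1, 2, 3, 4, 5}" by auto

lemma ex4_dotcol:
  "dotcol 4 ex4 y 0 = y 0" "dotcol 4 ex4 y 1 = y 1" "dotcol 4 ex4 y 2 = y 2"
  "dotcol 4 ex4 y 3 = y 0 - 2 * y 1 + y 2 + y 3" "dotcol 4 ex4 y 4 = y 3"
  "dotcol 4 ex4 y 5 = y 0 - 3 * y 1 + 2 * y 2 + y 3"
  by (simp_all add: dotcol_def lessThan4 ex4_def)

lemma ex4_mvr: "mvr 4 6 ex4 x = v \<longleftrightarrow> v 0 = x 0 + x 3 + x 5 \<and> v 1 = x 1 - 2 * x 3 - 3 * x 5 \<and>
    v 2 = x 2 + x 3 + 2 * x 5 \<and> v 3 = x 3 + x 4 + x 5 \<and> (\<forall>i\<ge>4. v i = 0)"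
proof -
  have "mvr 4 6 ex4 x = v \<longleftrightarrow> (\<forall>i<4. (\<Sum>j<6. of_int (ex4 i j) * x j) = v i) \<and> (\<forall>i\<ge>4. v i = 0)"
    by (auto simp: mvr_def fun_eq_iff not_less)
  then show ?thesis by (auto simp: lt4 lessThan6 ex4_def)
qed

lemma ex4_mv: "mv 4 6 ex4 x = v \<longleftrightarrow> v 0 = x 0 + x 3 + x 5 \<and> v 1 = x 1 - 2 * x 3 - 3 * x 5 \<and>
    v 2 = x 2 + x 3 + 2 * x 5 \<and> v 3 = x 3 + x 4 + x 5 \<and> (\<forall>i\<ge>4. v i = 0)"
proof -
  have "mv 4 6 ex4 x = v \<longleftrightarrow> (\<forall>i<4. (\<Sum>j<6. ex4 i j * x j) = v i) \<and> (\<forall>i\<ge>4. v i = 0)"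
    by (auto simp: mv_def fun_eq_iff not_less)
  then show ?thesis by (auto simp: lt4 lessThan6 ex4_def)
qed

lemma ex4_coneE:
  assumes "v \<in> cone_of 4 6 ex4 \<sigma>"
  obtains x where "\<And>j. 0 \<le> x j" "\<And>j. j \<notin> \<sigma> \<Longrightarrow> x j = 0" "v 0 = x 0 + x 3 + x 5"
    "v 1 = x 1 - 2 * x 3 - 3 * x 5" "v 2 = x 2 + x 3 + 2 * x 5" "v 3 = x 3 + x 4 + x 5" "\<And>i. 4 \<le> i \<Longrightarrow> v i = 0"
proof -
  obtain x where x: "v = mvr 4 6 ex4 x" "\<And>j. 0 \<le> x j" "\<And>j. j \<notin> \<sigma> \<Longrightarrow> x j = 0"
    using assms by (rule cone_ofE) (rule that)
  have "mvr 4 6 ex4 x = v" using x(1) ..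
  then show ?thesis unfolding ex4_mvr by (intro that[of x]) (use x(2,3) in auto)
qed

lemma ex4_facets:
  assumes "v \<in> coneA 4 6 ex4"
  shows "0 \<le> v 0" "0 \<le> v 2" "0 \<le> v 3" "0 \<le> v 1 + v 2 + v 3" "0 \<le> v 0 + v 1 + v 2"
    "0 \<le> v 1 + 3 * v 3" "0 \<le> v 1 + 2 * v 2" "0 \<le> 3 * v 0 + v 1" "\<And>i. 4 \<le> i \<Longrightarrow> v i = 0"
proof -
  obtain x :: "nat \<Rightarrow> real" where x: "\<And>j. 0 \<le> x j" "v 0 = x 0 + x 3 + x 5" "v 1 = x 1 - 2 * x 3 - 3 * x 5"
    "v 2 = x 2 + x 3 + 2 * x 5" "v 3 = x 3 + x 4 + x 5" and v0: "\<And>i. 4 \<le> i \<Longrightarrow> v i = 0"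
    using assms unfolding coneA_def by (rule ex4_coneE) (rule that)
  have nn: "0 \<le> x 0" "0 \<le> x 1" "0 \<le> x 2" "0 \<le> x 3" "0 \<le> x 4" "0 \<le> x 5" by (simp_all add: x(1))
  show "0 \<le> v 0" "0 \<le> v 2" "0 \<le> v 3" using nn x(2,4,5) by linarith+
  have "v 1 + v 2 + v 3 = x 1 + x 2 + x 4" "v 0 + v 1 + v 2 = x 0 + x 1 + x 2" "v 1 + 3 * v 3 = x 1 + x 3 + 3 * x 4"
    "v 1 + 2 * v 2 = x 1 + 2 * x 2 + x 5" "3 * v 0 + v 1 = 3 * x 0 + x 1 + x 3"
    unfolding x(2-5) by algebra+
  then show "0 \<le> v 1 + v 2 + v 3" "0 \<le> v 0 + v 1 + v 2" "0 \<le> v 1 + 3 * v 3" "0 \<le> v 1 + 2 * v 2" "0 \<le> 3 * v 0 + v 1"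
    using nn by linarith+
  show "v i = 0" if "4 \<le> i" for i by (rule v0[OF that])
qed

lemma ex4_full_rank: "full_row_rank 4 6 ex4"
  unfolding full_row_rank_def
proof (intro allI impI)
  fix y :: "nat \<Rightarrow> real" and i :: nat
  assume y: "\<forall>j<6. dotcol 4 ex4 y j = 0" and "i < 4"
  have "y 0 = 0" "y 1 = 0" "y 2 = 0" "y 3 = 0"
    using y[rule_format, of 0] y[rule_format, of 1] y[rule_format, of 2] y[rule_format, of 4]
    by (simp_all add: ex4_dotcol del: One_nat_def)
  then show "y i = 0" using \<open>i < 4\<close> unfolding lt4 by blast
qed

lemma ex4_height: "j < 6 \<Longrightarrow> dotcol 4 ex4 (\<lambda>_. 1) j = 1"
  unfolding lt6 by (elim disjE) (simp_all add: ex4_dotcol del: One_nat_def)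

lemma ex4_graded: "graded 4 6 ex4"
  unfolding graded_def
  by (rule exI[of _ "\<lambda>_. 1"], rule exI[of _ 1]) (use ex4_height in \<open>auto intro: exI[of _ 0]\<close>)

lemma ex4_standing: "standing 4 6 ex4"
proof (rule standingI[OF ex4_full_rank])
  show "0 < dotcol 4 ex4 (\<lambda>_. 1) j" if "j < 6" for j using ex4_height[OF that] by simp
  fix b assume b: "b \<in> ivecs 4"
  then have b0: "\<forall>i\<ge>4. b i = 0" by (simp add: ivecs_def)
  have "mv 4 6 ex4 ((\<lambda>_. 0)(0 := b 0, 1 := b 1, 2 := b 2, 4 := b 3)) = b"
    unfolding ex4_mv using b0 by simp
  then show "\<exists>u. b = mv 4 6 ex4 u" by metis
  assume "rvec b \<in> coneA 4 6 ex4"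
  note f' = ex4_facets[OF this]
  have f: "0 \<le> b 0" "0 \<le> b 2" "0 \<le> b 3" "0 \<le> b 1 + b 2 + b 3" "0 \<le> b 0 + b 1 + b 2"
    "0 \<le> b 1 + 3 * b 3" "0 \<le> b 1 + 2 * b 2" "0 \<le> 3 * b 0 + b 1"
    using f'(1-8) unfolding rvec_def by linarith+
  \<comment> \<open>Five unimodular cones, each containing column 1, cover the cone:
    \<open>{0, 1, 2, 5}\<close>, \<open>{0, 1, 3, 4}\<close>, \<open>{0, 1, 3, 5}\<close>,
    \<open>{1, 2, 4, 5}\<close> and \<open>{1, 3, 4, 5}\<close>. Their coordinates account for the
    list of inequalities.\<close>
  consider "b 3 \<le> b 0" "2 * b 3 \<le> b 2" | "b 2 \<le> b 0" "b 2 \<le> b 3" | "b 3 \<le> b 0" "b 3 \<le> b 2" "b 2 \<le> 2 * b 3"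
    | "b 0 \<le> b 3" "2 * b 0 \<le> b 2" | "b 0 \<le> b 3" "b 0 \<le> b 2" "b 2 \<le> 2 * b 0" by linarith
  then have "\<exists>z. mv 4 6 ex4 z = b \<and> (\<forall>j. 0 \<le> z j)"
  proof cases
    case 1
    then show ?thesis using f b0 unfolding ex4_mv
      by (intro exI[of _ "(\<lambda>_. 0)(0 := b 0 - b 3, 1 := b 1 + 3 * b 3, 2 := b 2 - 2 * b 3, 5 := b 3)"]) auto
  next
    case 2
    then show ?thesis using f b0 unfolding ex4_mv
      by (intro exI[of _ "(\<lambda>_. 0)(0 := b 0 - b 2, 1 := b 1 + 2 * b 2, 3 := b 2, 4 := b 3 - b 2)"]) auto
  next
    case 3
    then show ?thesis using f b0 unfolding ex4_mv
      by (intro exI[of _ "(\<lambda>_. 0)(0 := b 0 - b 3, 1 := b 1 + b 2 + b 3, 3 := 2 * b 3 - b 2, 5 := b 2 - b 3)"]) auto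
  next
    case 4
    then show ?thesis using f b0 unfolding ex4_mv
      by (intro exI[of _ "(\<lambda>_. 0)(1 := 3 * b 0 + b 1, 2 := b 2 - 2 * b 0, 4 := b 3 - b 0, 5 := b 0)"]) auto
  next
    case 5
    then show ?thesis using f b0 unfolding ex4_mv
      by (intro exI[of _ "(\<lambda>_. 0)(1 := b 0 + b 1 + b 2, 3 := 2 * b 0 - b 2, 4 := b 3 - b 0, 5 := b 2 - b 0)"]) auto
  qed
  then obtain z where z: "mv 4 6 ex4 z = b" "\<And>j. 0 \<le> z j" by blast
  then have "b = mv 4 6 ex4 (\<lambda>j. int (nat (z j)))" by simp
  then show "\<exists>u. b = mv 4 6 ex4 (\<lambda>j. int (u j))" by (rule exI[of _ "\<lambda>j. nat (z j)"])
next
  fix u :: "nat \<Rightarrow> nat" and j k :: nat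
  assume jk: "j < 6" "k < 6" and "mv 4 6 ex4 (\<lambda>i. int (u i)) = col 4 ex4 j"
  then have eq: "ex4 0 j = int (u 0) + int (u 3) + int (u 5)" "ex4 1 j = int (u 1) - 2 * int (u 3) - 3 * int (u 5)"
    "ex4 2 j = int (u 2) + int (u 3) + 2 * int (u 5)" "ex4 3 j = int (u 3) + int (u 4) + int (u 5)"
    unfolding ex4_mv by (simp_all add: col_def)
  from jk(1) consider "j = 0" | "j = 1" | "j = 2" | "j = 3" | "j = 4" | "j = 5" unfolding lt6 by blast
  then have "u 0 = unit_vec j 0 \<and> u 1 = unit_vec j 1 \<and> u 2 = unit_vec j 2 \<and> u 3 = unit_vec j 3 \<and>
    u 4 = unit_vec j 4 \<and> u 5 = unit_vec j 5"
  proof cases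
    case 1
    then have e: "int (u 0) + int (u 3) + int (u 5) = 1" "int (u 1) - 2 * int (u 3) - 3 * int (u 5) = 0"
      "int (u 2) + int (u 3) + 2 * int (u 5) = 0" "int (u 3) + int (u 4) + int (u 5) = 0"
      using eq by (simp_all add: ex4_def)
    have "u 5 = 0" using e by linarith
    with e have "u 3 = 0" by linarith
    with e \<open>u 5 = 0\<close> have "u 0 = 1" "u 1 = 0" "u 2 = 0" "u 3 = 0" "u 4 = 0" "u 5 = 0" by linarith+
    with 1 show ?thesis by (simp add: unit_vec_def)
  next
    case 2
    then have e: "int (u 0) + int (u 3) + int (u 5) = 0" "int (u 1) - 2 * int (u 3) - 3 * int (u 5) = 1"
      "int (u 2) + int (u 3) + 2 * int (u 5) = 0" "int (u 3) + int (u 4) + int (u 5) = 0"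
      using eq by (simp_all add: ex4_def)
    have "u 5 = 0" using e by linarith
    with e have "u 3 = 0" by linarith
    with e \<open>u 5 = 0\<close> have "u 0 = 0" "u 1 = 1" "u 2 = 0" "u 3 = 0" "u 4 = 0" "u 5 = 0" by linarith+
    with 2 show ?thesis by (simp add: unit_vec_def)
  next
    case 3
    then have e: "int (u 0) + int (u 3) + int (u 5) = 0" "int (u 1) - 2 * int (u 3) - 3 * int (u 5) = 0"
      "int (u 2) + int (u 3) + 2 * int (u 5) = 1" "int (u 3) + int (u 4) + int (u 5) = 0"
      using eq by (simp_all add: ex4_def)
    have "u 5 = 0" using e by linarith
    with e have "u 3 = 0" by linarith
    with e \<open>u 5 = 0\<close> have "u 0 = 0" "u 1 = 0" "u 2 = 1" "u 3 = 0" "u 4 = 0" "u 5 = 0" by linarith+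
    with 3 show ?thesis by (simp add: unit_vec_def)
  next
    case 4
    then have e: "int (u 0) + int (u 3) + int (u 5) = 1" "int (u 1) - 2 * int (u 3) - 3 * int (u 5) = -2"
      "int (u 2) + int (u 3) + 2 * int (u 5) = 1" "int (u 3) + int (u 4) + int (u 5) = 1"
      using eq by (simp_all add: ex4_def)
    have "u 5 = 0" using e by linarith
    with e have "u 3 = 1" by linarith
    with e \<open>u 5 = 0\<close> have "u 0 = 0" "u 1 = 0" "u 2 = 0" "u 3 = 1" "u 4 = 0" "u 5 = 0" by linarith+
    with 4 show ?thesis by (simp add: unit_vec_def)
  next
    case 5
    then have e: "int (u 0) + int (u 3) + int (u 5) = 0" "int (u 1) - 2 * int (u 3) - 3 * int (u 5) = 0"
      "int (u 2) + int (u 3) + 2 * int (u 5) = 0" "int (u 3) + int (u 4) + int (u 5) = 1"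
      using eq by (simp_all add: ex4_def)
    have "u 5 = 0" using e by linarith
    with e have "u 3 = 0" by linarith
    with e \<open>u 5 = 0\<close> have "u 0 = 0" "u 1 = 0" "u 2 = 0" "u 3 = 0" "u 4 = 1" "u 5 = 0" by linarith+
    with 5 show ?thesis by (simp add: unit_vec_def)
  next
    case 6
    then have e: "int (u 0) + int (u 3) + int (u 5) = 1" "int (u 1) - 2 * int (u 3) - 3 * int (u 5) = -3"
      "int (u 2) + int (u 3) + 2 * int (u 5) = 2" "int (u 3) + int (u 4) + int (u 5) = 1"
      using eq by (simp_all add: ex4_def)
    have "u 5 = 1" using e by linarith
    with e have "u 3 = 0" by linarith
    with e \<open>u 5 = 1\<close> have "u 0 = 0" "u 1 = 0" "u 2 = 0" "u 3 = 0" "u 4 = 0" "u 5 = 1" by linarith+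
    with 6 show ?thesis by (simp add: unit_vec_def)
  qed
  then show "u k = unit_vec j k" using jk(2) unfolding lt6 by blast
qed

lemma ex4_cover:
  assumes "v \<in> coneA 4 6 ex4"
  shows "\<exists>M\<in>ex4_faces. v \<in> cone_of 4 6 ex4 M"
proof -
  note f = ex4_facets[OF assms]
  have mem: "v \<in> cone_of 4 6 ex4 M" if "mvr 4 6 ex4 z = v" "\<And>j. 0 \<le> z j" "\<And>j. j \<notin> M \<Longrightarrow> z j = 0" for M z
    using that by (intro cone_ofI[where x = z]) auto
  \<comment> \<open>The walls are \<open>v 1 = 0\<close>, spanned by columns 0, 2, 4, and
    \<open>2 * v 1 + 3 * v 2 = 0\<close>, spanned by columns 0, 4, 5.\<close>
  consider "0 \<le> v 1" | "v 1 \<le> 0" "0 \<le> 2 * v 1 + 3 * v 2" | "2 * v 1 + 3 * v 2 \<le> 0" by linarith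
  then show ?thesis
  proof cases
    case 1
    have "v \<in> cone_of 4 6 ex4 {0, 1, 2, 4}"
      by (rule mem[of "(\<lambda>_. 0)(0 := v 0, 1 := v 1, 2 := v 2, 4 := v 3)"]) (use 1 f in \<open>auto simp: ex4_mvr\<close>)
    then show ?thesis by (auto simp: ex4_faces_def)
  next
    case 2
    have "v \<in> cone_of 4 6 ex4 {0, 2, 4, 5}"
      by (rule mem[of "(\<lambda>_. 0)(0 := (3 * v 0 + v 1) / 3, 2 := (2 * v 1 + 3 * v 2) / 3, 4 := (v 1 + 3 * v 3) / 3, 5 := - v 1 / 3)"])
        (use 2 f in \<open>auto simp: ex4_mvr field_simps\<close>)
    then show ?thesis by (auto simp: ex4_faces_def)
  next
    case 3
    have "v \<in> cone_of 4 6 ex4 {0, 3, 4, 5}"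
      by (rule mem[of "(\<lambda>_. 0)(0 := v 0 + v 1 + v 2, 3 := - (2 * v 1 + 3 * v 2), 4 := v 1 + v 2 + v 3, 5 := v 1 + 2 * v 2)"])
        (use 3 f in \<open>auto simp: ex4_mvr\<close>)
    then show ?thesis by (auto simp: ex4_faces_def)
  qed
qed

lemma ex4_faces_delta:
  assumes "M \<in> ex4_faces"
  shows "M \<in> delta 4 6 ex4 ex4_cost"
proof -
  consider "M = {0, 1, 2, 4}" | "M = {0, 2, 4, 5}" | "M = {0, 3, 4, 5}" using assms by (auto simp: ex4_faces_def)
  then show ?thesis
  proof cases
    case 1
    show ?thesis unfolding 1
      by (rule deltaI[where y = "(\<lambda>_. 0)(1 := 1)"])
        (auto simp: lt6 ex4_dotcol ex4_cost_def simp del: One_nat_def)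
  next
    case 2
    show ?thesis unfolding 2
      by (rule deltaI[where y = "(\<lambda>_. 0)(1 := - 1 / 3)"])
        (auto simp: lt6 ex4_dotcol ex4_cost_def simp del: One_nat_def)
  next
    case 3
    show ?thesis unfolding 3
      by (rule deltaI[where y = "(\<lambda>_. 0)(1 := - 3, 2 := - 4)"])
        (auto simp: lt6 ex4_dotcol ex4_cost_def simp del: One_nat_def)
  qed
qed

lemma ex4_faces_lin_indep:
  assumes "M \<in> ex4_faces"
  shows "lin_indep_cols 4 6 ex4 M"
  unfolding lin_indep_cols_def
proof (intro allI impI ballI, elim conjE)
  fix x j assume x: "\<forall>j. j \<notin> M \<longrightarrow> x j = 0" "mvr 4 6 ex4 x = (\<lambda>i. 0)" and j: "j \<in> M"
  have e: "x 0 + x 3 + x 5 = 0" "x 1 - 2 * x 3 - 3 * x 5 = 0" "x 2 + x 3 + 2 * x 5 = 0" "x 3 + x 4 + x 5 = 0"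
    using x(2) unfolding ex4_mvr by auto
  consider "M = {0, 1, 2, 4}" | "M = {0, 2, 4, 5}" | "M = {0, 3, 4, 5}" using assms by (auto simp: ex4_faces_def)
  then show "x j = 0"
  proof cases
    case 1
    then have "x 3 = 0" "x 5 = 0" using x(1) by auto
    then show ?thesis using e j 1 by auto
  next
    case 2
    then have "x 1 = 0" "x 3 = 0" using x(1) by auto
    then show ?thesis using e j 2 by auto
  next
    case 3
    then have "x 1 = 0" "x 2 = 0" using x(1) by auto
    then show ?thesis using e j 3 by auto
  qed
qed

abbreviation "ex4_triang \<equiv> delta 4 6 ex4 ex4_cost"

lemma ex4_triangulation:
  "regular_triangulation 4 6 ex4 ex4_triang" "\<sigma> \<in> ex4_triang \<Longrightarrow> \<exists>M\<in>ex4_faces. \<sigma> \<subseteq> M"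
  using delta_triangulation[OF ex4_faces_delta ex4_faces_lin_indep ex4_cover] by blast+

lemma ex4_max_face: "max_face ex4_triang \<sigma> \<Longrightarrow> \<sigma> \<in> ex4_faces"
  using ex4_triangulation(2) ex4_faces_delta unfolding max_face_def by metis

lemma ex4_max_face_0245: "max_face ex4_triang {0, 2, 4, 5}"
  unfolding max_face_def
proof (intro conjI ballI impI)
  show "{0, 2, 4, 5} \<in> ex4_triang" by (rule ex4_faces_delta) (simp add: ex4_faces_def)
  fix \<tau> assume \<tau>: "\<tau> \<in> ex4_triang" "{0, 2, 4, 5} \<subseteq> \<tau>"
  obtain M where M: "M \<in> ex4_faces" "\<tau> \<subseteq> M" using ex4_triangulation(2)[OF \<tau>(1)] by blast
  then have "M = {0, 2, 4, 5}" using \<tau>(2) by (auto simp: ex4_faces_def)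
  then show "\<tau> = {0, 2, 4, 5}" using M \<tau> by blast
qed

definition ex4_b :: "nat \<Rightarrow> int" where
  "ex4_b = (\<lambda>_. 0)(0 := 1, 1 := -1, 2 := 1, 3 := 1)"

lemma ex4_not_supports: "\<not> supports 4 6 ex4 ex4_triang c"
proof
  assume sup: "supports 4 6 ex4 ex4_triang c"
  then have eq: "ex4_triang = delta 4 6 ex4 c" and gom: "gomory_family 4 6 ex4 c" and gen: "generic 4 6 ex4 c"
    by (simp_all add: supports_def)
  have faces: "M \<in> delta 4 6 ex4 c" if "M \<in> ex4_faces" for M
    unfolding eq[symmetric] by (rule ex4_faces_delta[OF that])
  have "{0, 1, 2, 4} \<in> delta 4 6 ex4 c" by (rule faces) (simp add: ex4_faces_def)
  then obtain y where "{0, 1, 2, 4} \<subseteq> {..<6::nat}" and y: "\<And>j. j \<in> {0, 1, 2, 4} \<Longrightarrow> dotcol 4 ex4 y j = c j"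
    "\<And>j. j < 6 \<Longrightarrow> j \<notin> {0, 1, 2, 4} \<Longrightarrow> dotcol 4 ex4 y j < c j"
    by (rule deltaE) (rule that)
  have "{0, 3, 4, 5} \<in> delta 4 6 ex4 c" by (rule faces) (simp add: ex4_faces_def)
  then obtain y' where "{0, 3, 4, 5} \<subseteq> {..<6::nat}" and y': "\<And>j. j \<in> {0, 3, 4, 5} \<Longrightarrow> dotcol 4 ex4 y' j = c j"
    "\<And>j. j < 6 \<Longrightarrow> j \<notin> {0, 3, 4, 5} \<Longrightarrow> dotcol 4 ex4 y' j < c j"
    by (rule deltaE) (rule that)
  have c1: "c 3 > c 0 - 2 * c 1 + c 2 + c 4"
    using y(1)[of 0] y(1)[of 1] y(1)[of 2] y(1)[of 4] y(2)[of 3] by (simp add: ex4_dotcol del: One_nat_def)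
  have c2: "c 1 > c 0 - 2 * c 3 + c 4 + c 5"
    using y'(1)[of 0] y'(1)[of 3] y'(1)[of 4] y'(1)[of 5] y'(2)[of 1] by (simp add: ex4_dotcol del: One_nat_def)
  have "mv 4 6 ex4 (\<lambda>j. int (if j = 1 \<or> j = 3 then 1 else 0)) = ex4_b"
    unfolding ex4_mv by (simp add: ex4_b_def)
  then have "ex4_b \<in> semigroup 4 6 ex4" unfolding semigroup_iff by metis
  then obtain \<sigma> x where \<sigma>: "max_face ex4_triang \<sigma>" and opt: "gr_optimal 4 6 ex4 c \<sigma> ex4_b x" and nn: "\<And>j. j < 6 \<Longrightarrow> 0 \<le> x j"
    using gom unfolding gomory_family_def gr_solves_def eq by metis
  have \<sigma>c: "max_face (delta 4 6 ex4 c) \<sigma>" using \<sigma> eq by simp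
  have "mv 4 6 ex4 x = ex4_b" using opt by (simp add: gr_optimal_def gr_feasible_def)
  then have e: "x 0 + x 3 + x 5 = 1" "x 1 - 2 * x 3 - 3 * x 5 = - 1" "x 2 + x 3 + 2 * x 5 = 1" "x 3 + x 4 + x 5 = 1"
    unfolding ex4_mv by (simp_all add: ex4_b_def)
  have x: "x 0 = 0" "x 1 = 1" "x 2 = 0" "x 3 = 1" "x 4 = 0" "x 5 = 0"
  proof -
    have nn': "0 \<le> x 0" "0 \<le> x 1" "0 \<le> x 2" "0 \<le> x 3" "0 \<le> x 4" "0 \<le> x 5" by (simp_all add: nn)
    show x5: "x 5 = 0" using e(3) nn' by linarith
    show x3: "x 3 = 1" using e(1,2) nn' x5 by linarith
    show "x 0 = 0" "x 1 = 1" "x 2 = 0" "x 4 = 0" using e x5 x3 nn' by linarith+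
  qed
  have feas: "gr_feasible 4 6 ex4 \<sigma> ex4_b z"
    if "mv 4 6 ex4 z = ex4_b" "\<And>j. 6 \<le> j \<Longrightarrow> z j = 0" "\<And>j. j < 6 \<Longrightarrow> j \<notin> \<sigma> \<Longrightarrow> 0 \<le> z j" for z
    using that by (simp add: gr_feasible_def)
  have cx: "(\<Sum>j<6. c j * of_int (x j)) = c 1 + c 3" by (simp add: lessThan6 x del: One_nat_def)
  have le: "c 1 + c 3 \<le> (\<Sum>j<6. c j * of_int (z j))"
    if "mv 4 6 ex4 z = ex4_b" "\<And>j. 6 \<le> j \<Longrightarrow> z j = 0" "\<And>j. j < 6 \<Longrightarrow> j \<notin> \<sigma> \<Longrightarrow> 0 \<le> z j" for z
    using gr_optimal_cost_le[OF ex4_full_rank \<sigma>c opt feas[OF that]] cx by simp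
  consider "\<sigma> = {0, 1, 2, 4}" | "\<sigma> = {0, 2, 4, 5}" | "\<sigma> = {0, 3, 4, 5}" using ex4_max_face[OF \<sigma>] by (auto simp: ex4_faces_def)
  then show False
  proof cases
    case 1
    let ?z = "(\<lambda>_. 0)(0 := 1, 1 := -1, 2 := 1, 4 := 1)"
    have "c 1 + c 3 \<le> (\<Sum>j<6. c j * of_int (?z j))" by (rule le) (auto simp: 1 ex4_mv ex4_b_def lt6)
    then show False using c1 by (simp add: lessThan6)
  next
    case 2
    \<comment> \<open>The only nonnegative point of the fiber is the midpoint of these two feasible
      points. If it is optimal, both have the same cost as it does, which contradicts uniqueness of
      the optimum in the relaxation.\<close>
    let ?z = "(\<lambda>_. 0)(1 := 2, 2 := -1, 5 := 1)" and ?z' = "(\<lambda>_. 0)(2 := 1, 3 := 2, 5 := -1)"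
    have "gr_feasible 4 6 ex4 \<sigma> ex4_b ?z" by (rule feas) (auto simp: 2 ex4_mv ex4_b_def lt6)
    moreover have "c 1 + c 3 \<le> (\<Sum>j<6. c j * of_int (?z j))" by (rule le) (auto simp: 2 ex4_mv ex4_b_def lt6)
    moreover have "c 1 + c 3 \<le> (\<Sum>j<6. c j * of_int (?z' j))" by (rule le) (auto simp: 2 ex4_mv ex4_b_def lt6)
    ultimately have f: "gr_feasible 4 6 ex4 \<sigma> ex4_b ?z" and "(\<Sum>j<6. c j * of_int (?z j)) = (\<Sum>j<6. c j * of_int (x j))"
      unfolding cx by (simp_all add: lessThan6)
    then have "gr_optimal 4 6 ex4 c \<sigma> ex4_b ?z"
      using opt unfolding gr_optimal_iff[OF ex4_full_rank \<sigma>c] by simp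
    then have "x = ?z" by (rule gr_optimal_unique[OF ex4_full_rank \<sigma>c gen opt])
    then show False using x(3) by simp
  next
    case 3
    let ?z = "(\<lambda>_. 0)(0 := 1, 3 := -1, 4 := 1, 5 := 1)"
    have "c 1 + c 3 \<le> (\<Sum>j<6. c j * of_int (?z j))" by (rule le) (auto simp: 3 ex4_mv ex4_b_def lt6)
    then show False using c2 by (simp add: lessThan6)
  qed
qed

text \<open>The coordinate with index 1 is 0, 0, 0, -3 on columns 0, 2, 4, 5 and -1 on
  \<open>ex4_b\<close>.\<close>

lemma ex4_not_delta_normal: "\<not> delta_normal 4 6 ex4 ex4_triang"
proof (rule not_delta_normalI[OF ex4_max_face_0245, where b = ex4_b and k = 3 and f = "(\<lambda>_. 0)(1 := 1)"])
  show "ex4_b \<in> ivecs 4" by (simp add: ivecs_def ex4_b_def)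
  show "rvec ex4_b \<in> cone_of 4 6 ex4 {0, 2, 4, 5}"
  proof (rule cone_ofI)
    show "rvec ex4_b = mvr 4 6 ex4 ((\<lambda>_. 0)(0 := 2 / 3, 2 := 1 / 3, 4 := 2 / 3, 5 := 1 / 3))"
      by (rule sym) (simp add: ex4_mvr rvec_def ex4_b_def)
  qed auto
  show "\<not> 3 dvd (\<Sum>i<4. ((\<lambda>_. 0)(1 := 1)) i * ex4_b i)" by (simp add: lessThan4 ex4_b_def)
  fix j :: nat assume j: "j < 6" "rvec (col 4 ex4 j) \<in> cone_of 4 6 ex4 {0, 2, 4, 5}"
  obtain x :: "nat \<Rightarrow> real" where x: "\<And>j. 0 \<le> x j" "\<And>j. j \<notin> {0, 2, 4, 5} \<Longrightarrow> x j = 0"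
    "rvec (col 4 ex4 j) 1 = x 1 - 2 * x 3 - 3 * x 5" "rvec (col 4 ex4 j) 2 = x 2 + x 3 + 2 * x 5"
    using j(2) by (rule ex4_coneE) (rule that)
  have x0: "x 1 = 0" "x 3 = 0" by (auto intro: x(2))
  have "j \<noteq> 1"
  proof
    assume "j = 1"
    then have "1 = x 1 - 2 * x 3 - 3 * x 5" using x(3) by (simp add: rvec_def col_def ex4_def)
    then show False using x0 x(1)[of 5] by linarith
  qed
  moreover have "j \<noteq> 3"
  proof
    assume "j = 3"
    then have "- 2 = x 1 - 2 * x 3 - 3 * x 5" "1 = x 2 + x 3 + 2 * x 5"
      using x(3,4) by (simp_all add: rvec_def col_def ex4_def)
    then show False using x0 x(1)[of 2] by linarith
  qed
  ultimately show "3 dvd (\<Sum>i<4. ((\<lambda>_. 0)(1 := 1)) i * ex4 i j)"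
    using j(1) unfolding lt6 by (auto simp: lessThan4 ex4_def)
qed

theorem theorem5p5:
  shows "(\<forall>(d::nat) (n::nat) (A::nat \<Rightarrow> nat \<Rightarrow> int) \<Delta>.
            standing d n A \<and> (d = 1 \<or> d = 2 \<or> (d = 3 \<and> graded d n A)) \<and>
            regular_triangulation d n A \<Delta>
            \<longrightarrow> (\<exists>c. supports d n A \<Delta> c))
       \<and> (\<forall>(d::nat) (n::nat) (A::nat \<Rightarrow> nat \<Rightarrow> int) \<Delta>.
            standing d n A \<and> d = 2 \<and> graded d n A \<and> regular_triangulation d n A \<Delta>
            \<longrightarrow> (\<exists>!S. \<exists>c. supports d n A \<Delta> c \<and> S = optimal_set d n A c))
       \<and> (\<exists>(n::nat) (A::nat \<Rightarrow> nat \<Rightarrow> int) \<Delta>.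
            standing 3 n A \<and> \<not> graded 3 n A \<and> regular_triangulation 3 n A \<Delta> \<and>
            \<not> (\<exists>c. supports 3 n A \<Delta> c) \<and> \<not> delta_normal 3 n A \<Delta>)
       \<and> (\<exists>(n::nat) (A::nat \<Rightarrow> nat \<Rightarrow> int) \<Delta>.
            standing 4 n A \<and> graded 4 n A \<and> regular_triangulation 4 n A \<Delta> \<and>
            \<not> (\<exists>c. supports 4 n A \<Delta> c) \<and> \<not> delta_normal 4 n A \<Delta>)"
proof (intro conjI allI impI; (elim conjE)?)
  fix d n A \<Delta>
  assume "standing d n A" and d: "d = 1 \<or> d = 2 \<or> d = 3 \<and> graded d n A"
    and reg: "regular_triangulation d n A \<Delta>"
  then interpret standing_matrix d n A by unfold_locales
  show "\<exists>c. supports d n A \<Delta> c" using low_dim_supports[OF d reg] .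
next
  fix d n A \<Delta>
  assume "standing d n A" and d: "d = 2" "graded d n A" and reg: "regular_triangulation d n A \<Delta>"
  then interpret standing_matrix d n A by unfold_locales
  show "\<exists>!S. \<exists>c. supports d n A \<Delta> c \<and> S = optimal_set d n A c" using graded_plane_unique[OF d reg] .
next
  show "\<exists>n A \<Delta>. standing 3 n A \<and> \<not> graded 3 n A \<and> regular_triangulation 3 n A \<Delta> \<and>
      \<not> (\<exists>c. supports 3 n A \<Delta> c) \<and> \<not> delta_normal 3 n A \<Delta>"
    using ex3_standing ex3_not_graded ex3_triangulation(1) ex3_not_supports ex3_not_delta_normal by blast
next
  show "\<exists>n A \<Delta>. standing 4 n A \<and> graded 4 n A \<and> regular_triangulation 4 n A \<Delta> \<and>
      \<not> (\<exists>c. supports 4 n A \<Delta> c) \<and> \<not> delta_normal 4 n A \<Delta>"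
    using ex4_standing ex4_graded ex4_triangulation(1) ex4_not_supports ex4_not_delta_normal by blast
qed

end
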